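(* Let $k$ be a field, $T$ a bialgebra over $k$, $A$ a commutative $k$-algebra, and let $\theta\colon M\otimes T\to A$ be the universal measuring, with $M=M(T,A)$ the universal measuring coalgebra. Then there exists a unique algebra structure on $M$ such that $T$ measures $M$ to $A$, i.e. such that $\theta(fg,t)=\theta(f,t_1)\theta(g,t_2)$ and $\theta(1_M,t)=\varepsilon(t)1_A$ for all $f,g\in M$, $t\in T$. Furthermore, with this algebra structure $M$ becomes a bialgebra and $\theta\colon M\otimes T\to A$ becomes the universal bimeasuring. If $T$ is a Hopf algebra, then so is $M$.
   Context: All algebras are associative and unital, all coalgebras are coassociative and counital, over the field $k$; $\Delta(c)=c_1\otimes c_2$ is Sweedler notation, and $f(u,v)$ means $f(u\otimes v)$. Measuring: for algebras $A,B$ and a coalgebra $C$, a linear map $\psi\colon C\otimes B\to A$ is a measuring ($C$ measures $B$ to $A$) if $\psi(c,bb')=\psi(c_1,b)\psi(c_2,b')$ and $\psi(c,1)=\varepsilon(c)1_A$ for all $c\in C$, $b,b'\in B$. Universal measuring: for all algebras $A,B$ there is (Sweedler) a coalgebra $M=M(B,A)$ and a measuring $\theta\colon M\otimes B\to A$, unique up to isomorphism, such that for every coalgebra $C$ and every measuring $f\colon C\otimes B\to A$ there is a unique coalgebra map $\overline f\colon C\to M$ with $f=\theta(\overline f\otimes 1)$. Bimeasuring: for bialgebras $N,T$ and an algebra $A$, a linear map $\psi\colon N\otimes T\to A$ is a bimeasuring if $\psi(nm,t)=\psi(n,t_1)\psi(m,t_2)$, $\psi(1_N,t)=\varepsilon(t)1_A$,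 $\psi(n,ts)=\psi(n_1,t)\psi(n_2,s)$, $\psi(n,1_T)=\varepsilon(n)1_A$ for all $n,m\in N$, $t,s\in T$. Universal bimeasuring: for a bialgebra $T$ and an algebra $A$, a bimeasuring $\theta\colon B\otimes T\to A$ (with $B$ a bialgebra) is the (left) universal bimeasuring if for every bialgebra $N$ and every bimeasuring $f\colon N\otimes T\to A$ there is a unique bialgebra map $\overline f\colon N\to B$ with $f=\theta(\overline f\otimes 1)$.
   Formalization: Uniqueness of the algebra structure on M is claimed only among those making M a bialgebra with its given coalgebra structure; among all algebra structures such that T measures M to A it fails, e.g. for T=k[x] with x primitive, char k = 0, dim A at least 2. *)

theory Defs
  imports "HOL-Algebra.Module" "HOL-Algebra.AbelCoset" "HOL-Library.FuncSet"
begin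

section \<open>Tensor products\<close>

text \<open>
  The vector space \<open>V \<otimes> W\<close> is the free \<open>K\<close>-module on \<open>carrier V \<times> carrier W\<close> modulo the
  submodule generated by the bilinearity relations. In the records below that only describe
  \<open>K\<close>-modules, the fields \<open>mult\<close> and \<open>one\<close> inherited from \<^type>\<open>module\<close> carry no meaning.
\<close>

definition free_module :: "('k, 'x) ring_scheme \<Rightarrow> 'i set \<Rightarrow> ('k, 'i \<Rightarrow> 'k) module" where
  "free_module K I =
    \<lparr>carrier = {f. (\<forall>i. f i \<in> carrier K) \<and> finite {i. f i \<noteq> \<zero>\<^bsub>K\<^esub>} \<and> {i. f i \<noteq> \<zero>\<^bsub>K\<^esub>} \<subseteq> I},
     mult = undefined, one = undefined,
     zero = (\<lambda>i. \<zero>\<^bsub>K\<^esub>),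
     add = (\<lambda>f g i. f i \<oplus>\<^bsub>K\<^esub> g i),
     smult = (\<lambda>a f i. a \<otimes>\<^bsub>K\<^esub> f i)\<rparr>"

definition free_gen :: "('k, 'x) ring_scheme \<Rightarrow> 'i \<Rightarrow> 'i \<Rightarrow> 'k" where
  "free_gen K i = (\<lambda>j. if j = i then \<one>\<^bsub>K\<^esub> else \<zero>\<^bsub>K\<^esub>)"

definition module_span ::
  "('k, 'x) ring_scheme \<Rightarrow> ('k, 'v, 'y) module_scheme \<Rightarrow> 'v set \<Rightarrow> 'v set" where
  "module_span K V S = \<Inter>{H. submodule H K V \<and> S \<subseteq> H}"

definition quotient_module ::
  "('k, 'x) ring_scheme \<Rightarrow> ('k, 'v, 'y) module_scheme \<Rightarrow> 'v set \<Rightarrow> ('k, 'v set) module" where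
  "quotient_module K V H =
    \<lparr>carrier = a_rcosets\<^bsub>V\<^esub> H,
     mult = undefined, one = undefined,
     zero = H,
     add = (\<lambda>X Y. X <+>\<^bsub>V\<^esub> Y),
     smult = (\<lambda>a X. \<Union>x\<in>X. H +>\<^bsub>V\<^esub> (a \<odot>\<^bsub>V\<^esub> x))\<rparr>"

definition bilinear_relations ::
  "('k, 'x) ring_scheme \<Rightarrow> ('k, 'v, 'y) module_scheme \<Rightarrow> ('k, 'w, 'z) module_scheme
    \<Rightarrow> ('v \<times> 'w \<Rightarrow> 'k) set" where
  "bilinear_relations K V W =
    (let F = free_module K (carrier V \<times> carrier W); e = (\<lambda>v w. free_gen K (v, w)) in
      {e (v \<oplus>\<^bsub>V\<^esub> v') w \<ominus>\<^bsub>F\<^esub> (e v w \<oplus>\<^bsub>F\<^esub> e v' w) | v v' w.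
         v \<in> carrier V \<and> v' \<in> carrier V \<and> w \<in> carrier W}
    \<union> {e v (w \<oplus>\<^bsub>W\<^esub> w') \<ominus>\<^bsub>F\<^esub> (e v w \<oplus>\<^bsub>F\<^esub> e v w') | v w w'.
         v \<in> carrier V \<and> w \<in> carrier W \<and> w' \<in> carrier W}
    \<union> {e (a \<odot>\<^bsub>V\<^esub> v) w \<ominus>\<^bsub>F\<^esub> (a \<odot>\<^bsub>F\<^esub> e v w) | a v w.
         a \<in> carrier K \<and> v \<in> carrier V \<and> w \<in> carrier W}
    \<union> {e v (a \<odot>\<^bsub>W\<^esub> w) \<ominus>\<^bsub>F\<^esub> (a \<odot>\<^bsub>F\<^esub> e v w) | a v w.
         a \<in> carrier K \<and> v \<in> carrier V \<and> w \<in> carrier W})"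

definition tensor_null ::
  "('k, 'x) ring_scheme \<Rightarrow> ('k, 'v, 'y) module_scheme \<Rightarrow> ('k, 'w, 'z) module_scheme
    \<Rightarrow> ('v \<times> 'w \<Rightarrow> 'k) set" where
  "tensor_null K V W =
    module_span K (free_module K (carrier V \<times> carrier W)) (bilinear_relations K V W)"

definition tensor ::
  "('k, 'x) ring_scheme \<Rightarrow> ('k, 'v, 'y) module_scheme \<Rightarrow> ('k, 'w, 'z) module_scheme
    \<Rightarrow> ('k, ('v \<times> 'w \<Rightarrow> 'k) set) module" where
  "tensor K V W =
    quotient_module K (free_module K (carrier V \<times> carrier W)) (tensor_null K V W)"

definition tens ::
  "('k, 'x) ring_scheme \<Rightarrow> ('k, 'v, 'y) module_scheme \<Rightarrow> ('k, 'w, 'z) module_scheme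
    \<Rightarrow> 'v \<Rightarrow> 'w \<Rightarrow> ('v \<times> 'w \<Rightarrow> 'k) set" where
  "tens K V W v w =
    tensor_null K V W +>\<^bsub>free_module K (carrier V \<times> carrier W)\<^esub> free_gen K (v, w)"

definition linear_maps ::
  "('k, 'x) ring_scheme \<Rightarrow> ('k, 'v, 'y) module_scheme \<Rightarrow> ('k, 'w, 'z) module_scheme
    \<Rightarrow> ('v \<Rightarrow> 'w) set" where
  "linear_maps K V W = {h \<in> carrier V \<rightarrow> carrier W.
     (\<forall>x\<in>carrier V. \<forall>y\<in>carrier V. h (x \<oplus>\<^bsub>V\<^esub> y) = h x \<oplus>\<^bsub>W\<^esub> h y) \<and>
     (\<forall>a\<in>carrier K. \<forall>x\<in>carrier V. h (a \<odot>\<^bsub>V\<^esub> x) = a \<odot>\<^bsub>W\<^esub> h x)}"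

text \<open>
  The linear map \<open>V \<otimes> W \<rightarrow> X\<close> with \<open>v \<otimes> w \<mapsto> \<beta> v w\<close>; it exists and is unique whenever \<open>\<beta>\<close> is
  bilinear. Being extensional makes it unique as a HOL function.
\<close>

definition tensor_lift ::
  "('k, 'x) ring_scheme \<Rightarrow> ('k, 'v, 'y) module_scheme \<Rightarrow> ('k, 'w, 'z) module_scheme
    \<Rightarrow> ('k, 'u, 'q) module_scheme \<Rightarrow> ('v \<Rightarrow> 'w \<Rightarrow> 'u) \<Rightarrow> ('v \<times> 'w \<Rightarrow> 'k) set \<Rightarrow> 'u" where
  "tensor_lift K V W X \<beta> =
    (THE h. h \<in> linear_maps K (tensor K V W) X \<and>
            h \<in> extensional (carrier (tensor K V W)) \<and>
            (\<forall>v\<in>carrier V. \<forall>w\<in>carrier W. h (tens K V W v w) = \<beta> v w))"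

definition tensor_map ::
  "('k, 'x) ring_scheme \<Rightarrow> ('k, 'v, 'y) module_scheme \<Rightarrow> ('k, 'w, 'z) module_scheme
    \<Rightarrow> ('k, 'v1, 'y1) module_scheme \<Rightarrow> ('k, 'w1, 'z1) module_scheme
    \<Rightarrow> ('v \<Rightarrow> 'v1) \<Rightarrow> ('w \<Rightarrow> 'w1) \<Rightarrow> ('v \<times> 'w \<Rightarrow> 'k) set \<Rightarrow> ('v1 \<times> 'w1 \<Rightarrow> 'k) set" where
  "tensor_map K V W V1 W1 f g =
    tensor_lift K V W (tensor K V1 W1) (\<lambda>v w. tens K V1 W1 (f v) (g w))"

definition ground_module :: "('k, 'x) ring_scheme \<Rightarrow> ('k, 'k) module" where
  "ground_module K =
    \<lparr>carrier = carrier K, mult = mult K, one = one K, zero = zero K, add = add K, smult = mult K\<rparr>"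


section \<open>Algebras, coalgebras, bialgebras, Hopf algebras\<close>

text \<open>The locale \<^locale>\<open>algebra\<close> of the library is for commutative algebras only.\<close>

locale assoc_algebra = module K A + ring A for K (structure) and A (structure) +
  assumes smult_mult_left:
      "\<lbrakk>a \<in> carrier K; x \<in> carrier A; y \<in> carrier A\<rbrakk> \<Longrightarrow>
        (a \<odot>\<^bsub>A\<^esub> x) \<otimes>\<^bsub>A\<^esub> y = a \<odot>\<^bsub>A\<^esub> (x \<otimes>\<^bsub>A\<^esub> y)"
    and smult_mult_right:
      "\<lbrakk>a \<in> carrier K; x \<in> carrier A; y \<in> carrier A\<rbrakk> \<Longrightarrow>
        x \<otimes>\<^bsub>A\<^esub> (a \<odot>\<^bsub>A\<^esub> y) = a \<odot>\<^bsub>A\<^esub> (x \<otimes>\<^bsub>A\<^esub> y)"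

text \<open>
  One record type serves for coalgebras and for bialgebras: for a mere coalgebra the fields
  \<open>mult\<close> and \<open>one\<close> are ignored.
\<close>

record ('k, 'c) coalgebra = "('k, 'c) module" +
  comult :: "'c \<Rightarrow> ('c \<times> 'c \<Rightarrow> 'k) set"
  counit :: "'c \<Rightarrow> 'k"

text \<open>
  Sweedler notation: \<open>sweedler K C X \<beta> c\<close> is \<open>\<beta> c\<^sub>1 c\<^sub>2\<close> (summation understood), for a bilinear map
  \<open>\<beta>\<close> from \<open>C \<times> C\<close> to \<open>X\<close>.
\<close>

definition sweedler ::
  "('k, 'x) ring_scheme \<Rightarrow> ('k, 'c, 'y) coalgebra_scheme \<Rightarrow> ('k, 'u, 'z) module_scheme
    \<Rightarrow> ('c \<Rightarrow> 'c \<Rightarrow> 'u) \<Rightarrow> 'c \<Rightarrow> 'u" where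
  "sweedler K C X \<beta> c = tensor_lift K C C X \<beta> (comult C c)"

locale coalgebra = module K C for K (structure) and C (structure) +
  assumes comult_linear: "comult C \<in> linear_maps K C (tensor K C C)"
    and counit_linear: "counit C \<in> linear_maps K C (ground_module K)"
    and coassoc: "c \<in> carrier C \<Longrightarrow>
      sweedler K C (tensor K C (tensor K C C))
        (\<lambda>x y. sweedler K C (tensor K C (tensor K C C))
           (\<lambda>x1 x2. tens K C (tensor K C C) x1 (tens K C C x2 y)) x) c
      = sweedler K C (tensor K C (tensor K C C))
          (\<lambda>x y. tens K C (tensor K C C) x (comult C y)) c"
    and counit_left: "c \<in> carrier C \<Longrightarrow> sweedler K C C (\<lambda>x y. counit C x \<odot>\<^bsub>C\<^esub> y) c = c"
    and counit_right: "c \<in> carrier C \<Longrightarrow> sweedler K C C (\<lambda>x y. counit C y \<odot>\<^bsub>C\<^esub> x) c = c"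

definition coalgebra_homs ::
  "('k, 'x) ring_scheme \<Rightarrow> ('k, 'c, 'y) coalgebra_scheme \<Rightarrow> ('k, 'd, 'z) coalgebra_scheme
    \<Rightarrow> ('c \<Rightarrow> 'd) set" where
  "coalgebra_homs K C D = {h \<in> linear_maps K C D.
     (\<forall>c\<in>carrier C. comult D (h c) = tensor_map K C C D D h h (comult C c)) \<and>
     (\<forall>c\<in>carrier C. counit D (h c) = counit C c)}"

locale bialgebra = assoc_algebra K B + coalgebra K B for K (structure) and B (structure) +
  assumes comult_mult: "\<lbrakk>x \<in> carrier B; y \<in> carrier B\<rbrakk> \<Longrightarrow>
      comult B (x \<otimes>\<^bsub>B\<^esub> y) =
        sweedler K B (tensor K B B)
          (\<lambda>x1 x2. sweedler K B (tensor K B B)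
            (\<lambda>y1 y2. tens K B B (x1 \<otimes>\<^bsub>B\<^esub> y1) (x2 \<otimes>\<^bsub>B\<^esub> y2)) y) x"
    and comult_one: "comult B \<one>\<^bsub>B\<^esub> = tens K B B \<one>\<^bsub>B\<^esub> \<one>\<^bsub>B\<^esub>"
    and counit_mult: "\<lbrakk>x \<in> carrier B; y \<in> carrier B\<rbrakk> \<Longrightarrow>
      counit B (x \<otimes>\<^bsub>B\<^esub> y) = counit B x \<otimes>\<^bsub>K\<^esub> counit B y"
    and counit_one: "counit B \<one>\<^bsub>B\<^esub> = \<one>\<^bsub>K\<^esub>"

definition bialgebra_homs ::
  "('k, 'x) ring_scheme \<Rightarrow> ('k, 'c, 'y) coalgebra_scheme \<Rightarrow> ('k, 'd, 'z) coalgebra_scheme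
    \<Rightarrow> ('c \<Rightarrow> 'd) set" where
  "bialgebra_homs K B D = coalgebra_homs K B D \<inter> ring_hom B D"

locale hopf_algebra = bialgebra K H for K (structure) and H (structure) +
  assumes ex_antipode: "\<exists>S\<in>linear_maps K H H. \<forall>x\<in>carrier H.
      sweedler K H H (\<lambda>x1 x2. S x1 \<otimes>\<^bsub>H\<^esub> x2) x = counit H x \<odot>\<^bsub>H\<^esub> \<one>\<^bsub>H\<^esub> \<and>
      sweedler K H H (\<lambda>x1 x2. x1 \<otimes>\<^bsub>H\<^esub> S x2) x = counit H x \<odot>\<^bsub>H\<^esub> \<one>\<^bsub>H\<^esub>"


section \<open>Measurings and bimeasurings\<close>

text \<open>\<open>\<psi>\<close> is a linear map on \<open>C \<otimes> B\<close>; \<open>\<psi>(c, b)\<close> is \<open>\<psi> (tens K C B c b)\<close>.\<close>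

definition measuring ::
  "('k, 'x) ring_scheme \<Rightarrow> ('k, 'c, 'y) coalgebra_scheme \<Rightarrow> ('k, 'b, 'z) module_scheme
    \<Rightarrow> ('k, 'a, 'q) module_scheme \<Rightarrow> (('c \<times> 'b \<Rightarrow> 'k) set \<Rightarrow> 'a) \<Rightarrow> bool" where
  "measuring K C B A \<psi> \<longleftrightarrow>
     \<psi> \<in> linear_maps K (tensor K C B) A \<and>
     (\<forall>c\<in>carrier C. \<forall>b\<in>carrier B. \<forall>b'\<in>carrier B.
        \<psi> (tens K C B c (b \<otimes>\<^bsub>B\<^esub> b')) =
          sweedler K C A (\<lambda>c1 c2. \<psi> (tens K C B c1 b) \<otimes>\<^bsub>A\<^esub> \<psi> (tens K C B c2 b')) c) \<and>
     (\<forall>c\<in>carrier C. \<psi> (tens K C B c \<one>\<^bsub>B\<^esub>) = counit C c \<odot>\<^bsub>A\<^esub> \<one>\<^bsub>A\<^esub>)"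

text \<open>
  The condition that \<open>T\<close> measures \<open>N\<close> to \<open>A\<close> through the same map \<open>\<psi>\<close> on \<open>N \<otimes> T\<close>, with the
  coalgebra in the second argument.
\<close>

definition measures_right ::
  "('k, 'x) ring_scheme \<Rightarrow> ('k, 'n, 'y) module_scheme \<Rightarrow> ('k, 't, 'z) coalgebra_scheme
    \<Rightarrow> ('k, 'a, 'q) module_scheme \<Rightarrow> (('n \<times> 't \<Rightarrow> 'k) set \<Rightarrow> 'a) \<Rightarrow> bool" where
  "measures_right K N T A \<psi> \<longleftrightarrow>
     \<psi> \<in> linear_maps K (tensor K N T) A \<and>
     (\<forall>n\<in>carrier N. \<forall>m\<in>carrier N. \<forall>t\<in>carrier T.
        \<psi> (tens K N T (n \<otimes>\<^bsub>N\<^esub> m) t) =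
          sweedler K T A (\<lambda>t1 t2. \<psi> (tens K N T n t1) \<otimes>\<^bsub>A\<^esub> \<psi> (tens K N T m t2)) t) \<and>
     (\<forall>t\<in>carrier T. \<psi> (tens K N T \<one>\<^bsub>N\<^esub> t) = counit T t \<odot>\<^bsub>A\<^esub> \<one>\<^bsub>A\<^esub>)"

definition bimeasuring ::
  "('k, 'x) ring_scheme \<Rightarrow> ('k, 'n, 'y) coalgebra_scheme \<Rightarrow> ('k, 't, 'z) coalgebra_scheme
    \<Rightarrow> ('k, 'a, 'q) module_scheme \<Rightarrow> (('n \<times> 't \<Rightarrow> 'k) set \<Rightarrow> 'a) \<Rightarrow> bool" where
  "bimeasuring K N T A \<psi> \<longleftrightarrow> measures_right K N T A \<psi> \<and> measuring K N T A \<psi>"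

text \<open>
  Universality with respect to coalgebras (bialgebras) whose carrier lies in the type \<open>'c\<close>
  (\<open>'n\<close>): HOL cannot quantify over types inside a formula, so the type is a parameter. As a
  hypothesis, universality for one fixed type is a consequence of universality for all types; the
  type \<open>('k + 'm + 'n) list\<close> has room for isomorphic copies of \<open>K\<close> and of all tensor products and
  quotients built from vector spaces with carriers in \<open>'m\<close> and \<open>'n\<close>, because a tensor can be
  encoded by a list of pairs representing it. As a conclusion, universality for a type variable
  is universality for all types.

  The induced map is required to be extensional so that its uniqueness is uniqueness on the
  carrier.
\<close>

definition universal_measuring ::
  "'c itself \<Rightarrow> ('k, 'x) ring_scheme \<Rightarrow> ('k, 'b, 'y) module_scheme \<Rightarrow> ('k, 'a, 'z) module_scheme
    \<Rightarrow> ('k, 'm, 'q) coalgebra_scheme \<Rightarrow> (('m \<times> 'b \<Rightarrow> 'k) set \<Rightarrow> 'a) \<Rightarrow> bool" where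
  "universal_measuring (_ :: 'c itself) K B A M \<theta> \<longleftrightarrow>
     coalgebra K M \<and> measuring K M B A \<theta> \<and>
     (\<forall>(C :: ('k, 'c) coalgebra) f. coalgebra K C \<and> measuring K C B A f \<longrightarrow>
        (\<exists>!h. h \<in> extensional (carrier C) \<and> h \<in> coalgebra_homs K C M \<and>
              (\<forall>z\<in>carrier (tensor K C B). f z = \<theta> (tensor_map K C B M B h id z))))"

definition universal_bimeasuring ::
  "'n itself \<Rightarrow> ('k, 'x) ring_scheme \<Rightarrow> ('k, 't, 'y) coalgebra_scheme
    \<Rightarrow> ('k, 'a, 'z) module_scheme \<Rightarrow> ('k, 'b, 'q) coalgebra_scheme
    \<Rightarrow> (('b \<times> 't \<Rightarrow> 'k) set \<Rightarrow> 'a) \<Rightarrow> bool" where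
  "universal_bimeasuring (_ :: 'n itself) K T A B \<theta> \<longleftrightarrow>
     bialgebra K B \<and> bimeasuring K B T A \<theta> \<and>
     (\<forall>(N :: ('k, 'n) coalgebra) f. bialgebra K N \<and> bimeasuring K N T A f \<longrightarrow>
        (\<exists>!h. h \<in> extensional (carrier N) \<and> h \<in> bialgebra_homs K N B \<and>
              (\<forall>z\<in>carrier (tensor K N T). f z = \<theta> (tensor_map K N T B T h id z))))"

text \<open>
  \<open>(m, e)\<close> is a multiplication and a unit element turning the coalgebra \<open>M\<close> into a bialgebra such
  that \<open>T\<close> measures \<open>M\<close> to \<open>A\<close> through \<open>\<theta>\<close>. Compatibility with the coalgebra structure has to
  be part of the uniqueness claim: as \<open>\<theta>\<close> may have a nonzero left kernel, conjugating the
  multiplication by a linear automorphism of \<open>M\<close> that fixes the unit and is the identity modulo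
  that kernel yields further algebra structures for which \<open>T\<close> measures \<open>M\<close> to \<open>A\<close>.
  Extensionality of \<open>m\<close> makes uniqueness mean uniqueness on the carrier.
\<close>

definition measured_bialgebra_structure ::
  "('k, 'x) ring_scheme \<Rightarrow> ('k, 't, 'y) coalgebra_scheme \<Rightarrow> ('k, 'a, 'z) module_scheme
    \<Rightarrow> ('k, 'm, 'q) coalgebra_scheme \<Rightarrow> (('m \<times> 't \<Rightarrow> 'k) set \<Rightarrow> 'a)
    \<Rightarrow> ('m \<Rightarrow> 'm \<Rightarrow> 'm) \<times> 'm \<Rightarrow> bool" where
  "measured_bialgebra_structure K T A M \<theta> = (\<lambda>(m, e).
     m \<in> carrier M \<rightarrow>\<^sub>E carrier M \<rightarrow>\<^sub>E carrier M \<and>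
     bialgebra K (M\<lparr>mult := m, one := e\<rparr>) \<and>
     measures_right K (M\<lparr>mult := m, one := e\<rparr>) T A \<theta>)"

end

theory Submission
  imports Defs
begin

text \<open>
  Write \<open>f(t)\<close> for \<open>\<theta>(f, t)\<close>. A product on \<open>M\<close> through which \<open>T\<close> measures \<open>M\<close> to \<open>A\<close> has to satisfy
  \<open>(f g)(t) = f(t\<^sub>1) g(t\<^sub>2)\<close>. As \<open>T\<close> is a bialgebra and \<open>A\<close> is commutative, the right-hand side defines
  a measuring \<open>(M \<otimes> M) \<otimes> T \<rightarrow> A\<close>, so universality of \<open>M\<close> produces a coalgebra map \<open>M \<otimes> M \<rightarrow> M\<close>
  (\<open>ex_product\<close>). In the same way \<open>a \<otimes> t \<mapsto> a \<epsilon>(t) 1\<close> is a measuring \<open>K \<otimes> T \<rightarrow> A\<close> and produces the unit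
  (\<open>ex_unit\<close>).

  The identities that these maps satisfy cannot be tested by evaluation on \<open>T\<close> alone, because \<open>\<theta>\<close> may
  have a nonzero left kernel. What universality does give is that this left kernel contains no
  nonzero coideal: if \<open>J\<close> is a coideal annihilated by \<open>\<theta>\<close>, then \<open>\<theta>\<close> descends to a measuring by \<open>M/J\<close>,
  the induced coalgebra map \<open>M/J \<rightarrow> M\<close> composed with the projection is an endomorphism of \<open>M\<close>
  compatible with \<open>\<theta>\<close>, hence the identity, and so \<open>J = 0\<close>. The lemma \<open>coinduct\<close> puts this as a
  coinduction principle: a relation on \<open>M\<close> is contained in equality if related elements have the
  same counit, the same values on \<open>T\<close>, and comultiplications that become equal once related
  elements are identified in either tensor factor. In this form every identity is an equational
  computation with Sweedler sums. Uniqueness of product and unit (\<open>product_unique\<close>, \<open>unit_unique\<close>),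
  associativity and the unit laws (\<open>product_assoc\<close>, \<open>unit_product\<close>), and multiplicativity and
  uniqueness of the coalgebra map \<open>N \<rightarrow> M\<close> induced by a bimeasuring (\<open>hom_product\<close>, \<open>hom_eqI\<close>) all follow
  from it.

  If \<open>T\<close> has an antipode \<open>S\<close>, then \<open>S\<close> reverses products (\<open>antipode_mult\<close>), hence \<open>(f, t) \<mapsto> f(S t)\<close> is a
  measuring by the co-opposite coalgebra of \<open>M\<close> and induces a map \<open>h\<close> from \<open>M\<close> to \<open>M\<close> that reverses
  comultiplications. The map \<open>\<phi>(x) = h(x\<^sub>1) x\<^sub>2\<close> is not a coalgebra map, but
  \<open>\<Delta>(\<phi>(x)) = \<phi>(x\<^sub>2) \<otimes> h(x\<^sub>1) x\<^sub>3\<close>, and identifying \<open>\<phi>(u)\<close> with \<open>\<epsilon>(u) 1\<close> in the first factor turns this into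
  \<open>1 \<otimes> \<phi>(x)\<close>. So coinduction applies to the pairs \<open>\<phi>(x)\<close>, \<open>\<epsilon>(x) 1\<close> (\<open>left_antipode\<close>), and
  symmetrically to \<open>x\<^sub>1 h(x\<^sub>2)\<close> (\<open>right_antipode\<close>).

  Universality is given for coalgebras with carrier in one fixed type. Coalgebras over other types,
  such as \<open>M \<otimes> M\<close> and the quotients of \<open>M\<close>, are brought into that type by pushing their structure
  forward along a linear map whose kernel is a coideal (\<open>push_coalgebra\<close>, \<open>measuring_push\<close>); an
  injective map gives an isomorphic copy, a general one a quotient.
\<close>

section \<open>Modules and linear maps\<close>


primrec lsum :: "('u, 'z) ring_scheme \<Rightarrow> ('p \<Rightarrow> 'u) \<Rightarrow> 'p list \<Rightarrow> 'u" where
  "lsum X F [] = \<zero>\<^bsub>X\<^esub>"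
| "lsum X F (p # ps) = F p \<oplus>\<^bsub>X\<^esub> lsum X F ps"

lemma lsum_cong:
  "(\<And>p. p \<in> set ps \<Longrightarrow> F p = G p) \<Longrightarrow> lsum X F ps = lsum X G ps"
  by (induction ps) auto

locale ground_ring = cring K for K :: "('k, 'x) ring_scheme" (structure)
begin

abbreviation "Lin \<equiv> linear_maps K"

lemma module_abelian_group: "module K V \<Longrightarrow> abelian_group V"
  by (simp add: module_def)

lemma module_add [simp]:
  assumes "module K V" "x \<in> carrier V" "y \<in> carrier V"
  shows "x \<oplus>\<^bsub>V\<^esub> y \<in> carrier V"
  using assms by (meson abelian_group.axioms(1) abelian_monoid.a_closed module_abelian_group)

lemma module_zero [simp]: "module K V \<Longrightarrow> \<zero>\<^bsub>V\<^esub> \<in> carrier V"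
  by (meson abelian_group.axioms(1) abelian_monoid.zero_closed module_abelian_group)

lemma module_neg [simp]: "module K V \<Longrightarrow> x \<in> carrier V \<Longrightarrow> \<ominus>\<^bsub>V\<^esub> x \<in> carrier V"
  by (meson abelian_group.a_inv_closed module_abelian_group)

lemma module_minus [simp]:
  "module K V \<Longrightarrow> x \<in> carrier V \<Longrightarrow> y \<in> carrier V \<Longrightarrow> x \<ominus>\<^bsub>V\<^esub> y \<in> carrier V"
  by (meson abelian_group.minus_closed module_abelian_group)

lemma module_smult [simp]:
  "module K V \<Longrightarrow> a \<in> carrier K \<Longrightarrow> x \<in> carrier V \<Longrightarrow> a \<odot>\<^bsub>V\<^esub> x \<in> carrier V"
  by (rule module.smult_closed)

lemma module_zero_add [simp]:
  assumes "module K V" "x \<in> carrier V"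
  shows "\<zero>\<^bsub>V\<^esub> \<oplus>\<^bsub>V\<^esub> x = x" "x \<oplus>\<^bsub>V\<^esub> \<zero>\<^bsub>V\<^esub> = x"
  using assms abelian_group.axioms(1) abelian_monoid.l_zero abelian_monoid.r_zero module_abelian_group
  by metis+

lemma module_smult_simps [simp]:
  assumes "module K V" "x \<in> carrier V"
  shows "\<one> \<odot>\<^bsub>V\<^esub> x = x" "\<zero> \<odot>\<^bsub>V\<^esub> x = \<zero>\<^bsub>V\<^esub>"
  using assms by (simp_all add: module.smult_one module.smult_l_null)

lemma module_smult_zero [simp]: "module K V \<Longrightarrow> a \<in> carrier K \<Longrightarrow> a \<odot>\<^bsub>V\<^esub> \<zero>\<^bsub>V\<^esub> = \<zero>\<^bsub>V\<^esub>"
  by (rule module.smult_r_null)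

lemma module_distr:
  assumes "module K V" "a \<in> carrier K" "x \<in> carrier V" "y \<in> carrier V"
  shows "a \<odot>\<^bsub>V\<^esub> (x \<oplus>\<^bsub>V\<^esub> y) = a \<odot>\<^bsub>V\<^esub> x \<oplus>\<^bsub>V\<^esub> a \<odot>\<^bsub>V\<^esub> y"
  using assms by (rule module.smult_r_distr)

lemma module_distr_left:
  assumes "module K V" "a \<in> carrier K" "b \<in> carrier K" "x \<in> carrier V"
  shows "(a \<oplus> b) \<odot>\<^bsub>V\<^esub> x = a \<odot>\<^bsub>V\<^esub> x \<oplus>\<^bsub>V\<^esub> b \<odot>\<^bsub>V\<^esub> x"
  using assms by (rule module.smult_l_distr)

lemma module_smult_smult:
  assumes "module K V" "a \<in> carrier K" "b \<in> carrier K" "x \<in> carrier V"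
  shows "(a \<otimes> b) \<odot>\<^bsub>V\<^esub> x = a \<odot>\<^bsub>V\<^esub> (b \<odot>\<^bsub>V\<^esub> x)"
  using assms by (rule module.smult_assoc1)

lemma module_smult_comm:
  assumes "module K V" "a \<in> carrier K" "b \<in> carrier K" "x \<in> carrier V"
  shows "a \<odot>\<^bsub>V\<^esub> (b \<odot>\<^bsub>V\<^esub> x) = b \<odot>\<^bsub>V\<^esub> (a \<odot>\<^bsub>V\<^esub> x)"
  using assms by (metis m_comm module_smult_smult)

lemma module_ac:
  assumes "module K V"
  shows "x \<in> carrier V \<Longrightarrow> y \<in> carrier V \<Longrightarrow> x \<oplus>\<^bsub>V\<^esub> y = y \<oplus>\<^bsub>V\<^esub> x"
    "x \<in> carrier V \<Longrightarrow> y \<in> carrier V \<Longrightarrow> z \<in> carrier V \<Longrightarrow>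
      (x \<oplus>\<^bsub>V\<^esub> y) \<oplus>\<^bsub>V\<^esub> z = x \<oplus>\<^bsub>V\<^esub> (y \<oplus>\<^bsub>V\<^esub> z)"
    "x \<in> carrier V \<Longrightarrow> y \<in> carrier V \<Longrightarrow> z \<in> carrier V \<Longrightarrow>
      x \<oplus>\<^bsub>V\<^esub> (y \<oplus>\<^bsub>V\<^esub> z) = y \<oplus>\<^bsub>V\<^esub> (x \<oplus>\<^bsub>V\<^esub> z)"
  using abelian_group.axioms(1)[OF module_abelian_group[OF assms]]
  by (auto simp: abelian_monoid.a_comm abelian_monoid.a_assoc abelian_monoid.a_lcomm)

lemma module_neg_smult:
  assumes "module K V" "x \<in> carrier V"
  shows "\<ominus>\<^bsub>V\<^esub> x = (\<ominus> \<one>) \<odot>\<^bsub>V\<^esub> x"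
  using assms by (simp add: module.smult_l_minus)

lemma module_minus_eq: 
  "x \<ominus>\<^bsub>V\<^esub> y = x \<oplus>\<^bsub>V\<^esub> (\<ominus>\<^bsub>V\<^esub> y)"
  by (simp add: a_minus_def)

lemma module_minus_zero_iff:
  assumes "module K V" "x \<in> carrier V" "y \<in> carrier V"
  shows "x \<ominus>\<^bsub>V\<^esub> y = \<zero>\<^bsub>V\<^esub> \<longleftrightarrow> x = y"
proof -
  interpret V: abelian_group V by (rule module_abelian_group[OF assms(1)])
  have "x = y" if "x \<ominus>\<^bsub>V\<^esub> y = \<zero>\<^bsub>V\<^esub>"
    using that assms by (metis V.minus_equality V.add.inv_closed V.minus_minus a_minus_def)
  thus ?thesis using assms by (auto simp: a_minus_def V.r_neg)
qed

lemma linearI: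
  assumes "\<And>x. x \<in> carrier V \<Longrightarrow> h x \<in> carrier W"
    and "\<And>x y. x \<in> carrier V \<Longrightarrow> y \<in> carrier V \<Longrightarrow> h (x \<oplus>\<^bsub>V\<^esub> y) = h x \<oplus>\<^bsub>W\<^esub> h y"
    and "\<And>a x. a \<in> carrier K \<Longrightarrow> x \<in> carrier V \<Longrightarrow> h (a \<odot>\<^bsub>V\<^esub> x) = a \<odot>\<^bsub>W\<^esub> h x"
  shows "h \<in> Lin V W"
  using assms by (simp add: linear_maps_def)

lemma linear_closed: "h \<in> Lin V W \<Longrightarrow> x \<in> carrier V \<Longrightarrow> h x \<in> carrier W"
  by (auto simp: linear_maps_def)

lemma linear_add:
  "h \<in> Lin V W \<Longrightarrow> x \<in> carrier V \<Longrightarrow> y \<in> carrier V \<Longrightarrow> h (x \<oplus>\<^bsub>V\<^esub> y) = h x \<oplus>\<^bsub>W\<^esub> h y"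
  by (auto simp: linear_maps_def)

lemma linear_smult:
  "h \<in> Lin V W \<Longrightarrow> a \<in> carrier K \<Longrightarrow> x \<in> carrier V \<Longrightarrow> h (a \<odot>\<^bsub>V\<^esub> x) = a \<odot>\<^bsub>W\<^esub> h x"
  by (auto simp: linear_maps_def)

lemma linear_zero:
  assumes "h \<in> Lin V W" "module K V" "module K W"
  shows "h \<zero>\<^bsub>V\<^esub> = \<zero>\<^bsub>W\<^esub>"
proof -
  have "h \<zero>\<^bsub>V\<^esub> = h (\<zero> \<odot>\<^bsub>V\<^esub> \<zero>\<^bsub>V\<^esub>)" using assms by simp
  also have "\<dots> = \<zero> \<odot>\<^bsub>W\<^esub> h \<zero>\<^bsub>V\<^esub>" using assms by (intro linear_smult) auto
  also have "\<dots> = \<zero>\<^bsub>W\<^esub>" using assms by (simp add: linear_closed)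
  finally show ?thesis .
qed

lemma linear_neg:
  assumes "h \<in> Lin V W" "module K V" "module K W" "x \<in> carrier V"
  shows "h (\<ominus>\<^bsub>V\<^esub> x) = \<ominus>\<^bsub>W\<^esub> h x"
  using assms by (simp add: module_neg_smult linear_smult linear_closed)

lemma linear_minus:
  assumes "h \<in> Lin V W" "module K V" "module K W" "x \<in> carrier V" "y \<in> carrier V"
  shows "h (x \<ominus>\<^bsub>V\<^esub> y) = h x \<ominus>\<^bsub>W\<^esub> h y"
  using assms by (simp add: module_minus_eq linear_add linear_neg linear_closed)

lemma linear_comp: "g \<in> Lin V W \<Longrightarrow> h \<in> Lin W X \<Longrightarrow> (\<lambda>v. h (g v)) \<in> Lin V X"
  by (auto simp: linear_maps_def Pi_def)

lemma linear_id: "id \<in> Lin V V"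
  by (auto simp: linear_maps_def)

lemma lsum_closed [simp]:
  "module K X \<Longrightarrow> (\<And>p. p \<in> set ps \<Longrightarrow> F p \<in> carrier X) \<Longrightarrow> lsum X F ps \<in> carrier X"
  by (induction ps) auto

lemma lsum_zero: "module K X \<Longrightarrow> lsum X (\<lambda>p. \<zero>\<^bsub>X\<^esub>) ps = \<zero>\<^bsub>X\<^esub>"
  by (induction ps) auto

lemma lsum_add:
  assumes "module K X" "\<And>p. p \<in> set ps \<Longrightarrow> F p \<in> carrier X"
    "\<And>p. p \<in> set ps \<Longrightarrow> G p \<in> carrier X"
  shows "lsum X (\<lambda>p. F p \<oplus>\<^bsub>X\<^esub> G p) ps = lsum X F ps \<oplus>\<^bsub>X\<^esub> lsum X G ps"
  using assms(2,3) by (induction ps) (simp_all add: module_ac assms(1))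

lemma lsum_linear:
  assumes "h \<in> Lin X Y" "module K X" "module K Y" "\<And>p. p \<in> set ps \<Longrightarrow> F p \<in> carrier X"
  shows "h (lsum X F ps) = lsum Y (\<lambda>p. h (F p)) ps"
  using assms(4) by (induction ps) (simp_all add: assms(1-3) linear_zero[OF assms(1-3)] linear_add[OF assms(1)])

lemma lsum_swap:
  assumes "module K X" "\<And>p q. p \<in> set ps \<Longrightarrow> q \<in> set qs \<Longrightarrow> F p q \<in> carrier X"
  shows "lsum X (\<lambda>p. lsum X (F p) qs) ps = lsum X (\<lambda>q. lsum X (\<lambda>p. F p q) ps) qs"
  using assms(2)
proof (induction ps)
  case Nil
  then show ?case by (simp add: lsum_zero assms(1))
next
  case (Cons p ps)
  have "lsum X (\<lambda>q. F p q \<oplus>\<^bsub>X\<^esub> lsum X (\<lambda>p. F p q) ps) qs =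
    lsum X (F p) qs \<oplus>\<^bsub>X\<^esub> lsum X (\<lambda>q. lsum X (\<lambda>p. F p q) ps) qs"
    using Cons.prems by (intro lsum_add) (auto simp: assms(1))
  with Cons show ?case by simp
qed

section \<open>Free modules\<close>

abbreviation "Free \<equiv> free_module K"

lemma free_carrier_iff:
  "f \<in> carrier (Free I) \<longleftrightarrow>
    (\<forall>i. f i \<in> carrier K) \<and> finite {i. f i \<noteq> \<zero>} \<and> {i. f i \<noteq> \<zero>} \<subseteq> I"
  by (simp add: free_module_def)

lemma free_simps:
  "f \<oplus>\<^bsub>Free I\<^esub> g = (\<lambda>i. f i \<oplus> g i)" "a \<odot>\<^bsub>Free I\<^esub> f = (\<lambda>i. a \<otimes> f i)" "\<zero>\<^bsub>Free I\<^esub> = (\<lambda>i. \<zero>)"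
  by (simp_all add: free_module_def)

lemma free_coeff_closed: "f \<in> carrier (Free I) \<Longrightarrow> f i \<in> carrier K"
  by (simp add: free_carrier_iff)

lemma free_zero_closed: "(\<lambda>i. \<zero>) \<in> carrier (Free I)"
  by (simp add: free_carrier_iff)

lemma free_add_closed:
  assumes "f \<in> carrier (Free I)" "g \<in> carrier (Free I)"
  shows "(\<lambda>i. f i \<oplus> g i) \<in> carrier (Free I)"
proof -
  have "{i. f i \<oplus> g i \<noteq> \<zero>} \<subseteq> {i. f i \<noteq> \<zero>} \<union> {i. g i \<noteq> \<zero>}" by auto
  moreover from this have "finite {i. f i \<oplus> g i \<noteq> \<zero>}"
    using assms by (auto simp: free_carrier_iff intro: finite_subset)
  ultimately show ?thesis using assms by (auto simp: free_carrier_iff)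
qed

lemma free_smult_closed:
  assumes "f \<in> carrier (Free I)" "a \<in> carrier K"
  shows "(\<lambda>i. a \<otimes> f i) \<in> carrier (Free I)"
proof -
  have "{i. a \<otimes> f i \<noteq> \<zero>} \<subseteq> {i. f i \<noteq> \<zero>}" using assms by auto
  moreover from this have "finite {i. a \<otimes> f i \<noteq> \<zero>}"
    using assms by (auto simp: free_carrier_iff intro: finite_subset)
  ultimately show ?thesis using assms by (auto simp: free_carrier_iff)
qed

lemma free_module_module [simp]: "module K (Free I)"
proof (rule moduleI)
  have neg: "(\<lambda>i. \<ominus> f i) \<in> carrier (Free I)" if "f \<in> carrier (Free I)" for f
  proof -
    have "(\<lambda>i. \<ominus> \<one> \<otimes> f i) = (\<lambda>i. \<ominus> f i)"
      using that by (auto simp: free_carrier_iff fun_eq_iff l_minus)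
    with free_smult_closed[OF that, of "\<ominus> \<one>"] show ?thesis by simp
  qed
  show "abelian_group (Free I)"
  proof (rule abelian_groupI)
    fix f assume f: "f \<in> carrier (Free I)"
    show "\<exists>g\<in>carrier (Free I). g \<oplus>\<^bsub>Free I\<^esub> f = \<zero>\<^bsub>Free I\<^esub>"
      using f neg[OF f] by (intro bexI[of _ "\<lambda>i. \<ominus> f i"]) (auto simp: free_simps free_carrier_iff l_neg)
  qed (auto simp: free_simps free_add_closed free_zero_closed free_coeff_closed fun_eq_iff a_ac)
qed (auto simp: free_simps free_smult_closed free_coeff_closed fun_eq_iff is_cring l_distr r_distr m_assoc)

lemma free_gen_closed [simp]: "i \<in> I \<Longrightarrow> free_gen K i \<in> carrier (Free I)"
  by (auto simp: free_carrier_iff free_gen_def)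

lemma free_induct [consumes 1, case_names zero add]:
  assumes f: "f \<in> carrier (Free I)"
    and zero: "P \<zero>\<^bsub>Free I\<^esub>"
    and add: "\<And>f a i. f \<in> carrier (Free I) \<Longrightarrow> P f \<Longrightarrow> a \<in> carrier K \<Longrightarrow> i \<in> I \<Longrightarrow>
      P (f \<oplus>\<^bsub>Free I\<^esub> a \<odot>\<^bsub>Free I\<^esub> free_gen K i)"
  shows "P f"
proof -
  have "finite S \<Longrightarrow> f \<in> carrier (Free I) \<Longrightarrow> {i. f i \<noteq> \<zero>} = S \<Longrightarrow> P f" for S f
  proof (induction S arbitrary: f rule: finite_induct)
    case empty
    hence "f = \<zero>\<^bsub>Free I\<^esub>" by (auto simp: free_simps)
    with zero show ?case by simp
  next
    case (insert i S)
    let ?g = "f(i := \<zero>)"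
    have supp: "{j. ?g j \<noteq> \<zero>} = S" using insert by auto
    have g: "?g \<in> carrier (Free I)"
      unfolding free_carrier_iff supp using insert by (auto simp: free_carrier_iff)
    have i: "i \<in> I" "f i \<in> carrier K" using insert by (auto simp: free_carrier_iff)
    have "?g \<oplus>\<^bsub>Free I\<^esub> f i \<odot>\<^bsub>Free I\<^esub> free_gen K i = f"
      using insert.prems(1) by (auto simp: free_simps free_gen_def fun_eq_iff free_carrier_iff)
    with add[OF g insert.IH[OF g supp] i(2) i(1)] show ?case by metis
  qed
  with f show ?thesis by (auto simp: free_carrier_iff)
qed

definition free_lift :: "('k, 'u, 'z) module_scheme \<Rightarrow> ('i \<Rightarrow> 'u) \<Rightarrow> ('i \<Rightarrow> 'k) \<Rightarrow> 'u" where
  "free_lift X \<phi> f = (\<Oplus>\<^bsub>X\<^esub>i\<in>{i. f i \<noteq> \<zero>}. f i \<odot>\<^bsub>X\<^esub> \<phi> i)"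

lemma free_lift_superset:
  assumes X: "module K X" and \<phi>: "\<And>i. i \<in> I \<Longrightarrow> \<phi> i \<in> carrier X" and f: "f \<in> carrier (Free I)"
    and S: "finite S" "{i. f i \<noteq> \<zero>} \<subseteq> S" "S \<subseteq> I"
  shows "free_lift X \<phi> f = (\<Oplus>\<^bsub>X\<^esub>i\<in>S. f i \<odot>\<^bsub>X\<^esub> \<phi> i)"
proof -
  interpret X: module K X by (rule X)
  show ?thesis unfolding free_lift_def
    by (rule X.add.finprod_mono_neutral_cong_left) (use assms in \<open>auto simp: free_carrier_iff subset_iff\<close>)
qed

lemma free_lift_linear:
  assumes X: "module K X" and \<phi>: "\<And>i. i \<in> I \<Longrightarrow> \<phi> i \<in> carrier X"
  shows "free_lift X \<phi> \<in> Lin (Free I) X"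
proof (rule linearI)
  interpret X: module K X by (rule X)
  fix f assume f: "f \<in> carrier (Free I)"
  show "free_lift X \<phi> f \<in> carrier X"
    unfolding free_lift_def using f \<phi> by (intro X.finsum_closed) (auto simp: free_carrier_iff)
  {
    fix g assume g: "g \<in> carrier (Free I)"
    let ?S = "{i. f i \<noteq> \<zero>} \<union> {i. g i \<noteq> \<zero>}"
    have S: "finite ?S" "?S \<subseteq> I" using f g by (auto simp: free_carrier_iff)
    have "free_lift X \<phi> (f \<oplus>\<^bsub>Free I\<^esub> g) = (\<Oplus>\<^bsub>X\<^esub>i\<in>?S. (f i \<oplus> g i) \<odot>\<^bsub>X\<^esub> \<phi> i)"
      using S free_add_closed[OF f g]
      by (subst free_lift_superset[OF X \<phi> _ S(1) _ S(2)]) (auto simp: free_simps)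
    also have "\<dots> = (\<Oplus>\<^bsub>X\<^esub>i\<in>?S. f i \<odot>\<^bsub>X\<^esub> \<phi> i \<oplus>\<^bsub>X\<^esub> g i \<odot>\<^bsub>X\<^esub> \<phi> i)"
      using S f g \<phi> by (intro X.finsum_cong') (auto simp: free_carrier_iff X.smult_l_distr)
    also have "\<dots> = (\<Oplus>\<^bsub>X\<^esub>i\<in>?S. f i \<odot>\<^bsub>X\<^esub> \<phi> i) \<oplus>\<^bsub>X\<^esub> (\<Oplus>\<^bsub>X\<^esub>i\<in>?S. g i \<odot>\<^bsub>X\<^esub> \<phi> i)"
      using S f g \<phi> by (intro X.finsum_addf) (auto simp: free_carrier_iff)
    also have "(\<Oplus>\<^bsub>X\<^esub>i\<in>?S. f i \<odot>\<^bsub>X\<^esub> \<phi> i) = free_lift X \<phi> f"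
      using S f \<phi> by (intro free_lift_superset[symmetric, OF X]) auto
    also have "(\<Oplus>\<^bsub>X\<^esub>i\<in>?S. g i \<odot>\<^bsub>X\<^esub> \<phi> i) = free_lift X \<phi> g"
      using S g \<phi> by (intro free_lift_superset[symmetric, OF X]) auto
    finally show "free_lift X \<phi> (f \<oplus>\<^bsub>Free I\<^esub> g) = free_lift X \<phi> f \<oplus>\<^bsub>X\<^esub> free_lift X \<phi> g" .
  }
  {
    fix a assume a: "a \<in> carrier K"
    let ?S = "{i. f i \<noteq> \<zero>}"
    have S: "finite ?S" "?S \<subseteq> I" using f by (auto simp: free_carrier_iff)
    have "free_lift X \<phi> (a \<odot>\<^bsub>Free I\<^esub> f) = (\<Oplus>\<^bsub>X\<^esub>i\<in>?S. (a \<otimes> f i) \<odot>\<^bsub>X\<^esub> \<phi> i)"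
      using S free_smult_closed[OF f a] a
      by (subst free_lift_superset[OF X \<phi> _ S(1) _ S(2)]) (auto simp: free_simps)
    also have "\<dots> = (\<Oplus>\<^bsub>X\<^esub>i\<in>?S. a \<odot>\<^bsub>X\<^esub> (f i \<odot>\<^bsub>X\<^esub> \<phi> i))"
      using S f a \<phi> by (intro X.finsum_cong') (auto simp: free_carrier_iff X.smult_assoc1)
    also have "\<dots> = a \<odot>\<^bsub>X\<^esub> free_lift X \<phi> f"
      unfolding free_lift_def using S f a \<phi>
      by (subst X.finsum_smult_ldistr) (auto simp: free_carrier_iff)
    finally show "free_lift X \<phi> (a \<odot>\<^bsub>Free I\<^esub> f) = a \<odot>\<^bsub>X\<^esub> free_lift X \<phi> f" .
  }
qed

lemma free_lift_gen:
  assumes X: "module K X" and \<phi>: "\<And>i. i \<in> I \<Longrightarrow> \<phi> i \<in> carrier X" and i: "i \<in> I"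
  shows "free_lift X \<phi> (free_gen K i) = \<phi> i"
proof -
  interpret X: module K X by (rule X)
  have "free_lift X \<phi> (free_gen K i) = (\<Oplus>\<^bsub>X\<^esub>j\<in>{i}. free_gen K i j \<odot>\<^bsub>X\<^esub> \<phi> j)"
    using i by (intro free_lift_superset[OF X \<phi> free_gen_closed]) (auto simp: free_gen_def)
  also have "\<dots> = \<phi> i" using i \<phi> by (simp add: free_gen_def)
  finally show ?thesis .
qed

section \<open>Quotient modules\<close>

abbreviation "Quot \<equiv> quotient_module K"

lemma submodule_abelian_subgroup:
  "module K V \<Longrightarrow> submodule H K V \<Longrightarrow> abelian_subgroup H V"
  by (intro abelian_subgroupI3 additive_subgroup.intro) (auto simp: submodule_def module_abelian_group)

lemma submodule_smult: "submodule H K V \<Longrightarrow> a \<in> carrier K \<Longrightarrow> h \<in> H \<Longrightarrow> a \<odot>\<^bsub>V\<^esub> h \<in> H"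
  by (rule submodule.smult_closed)

lemma coset_eq_iff:
  assumes V: "module K V" and H: "submodule H K V" and x: "x \<in> carrier V" and y: "y \<in> carrier V"
  shows "H +>\<^bsub>V\<^esub> x = H +>\<^bsub>V\<^esub> y \<longleftrightarrow> x \<ominus>\<^bsub>V\<^esub> y \<in> H"
proof -
  interpret abelian_subgroup H V by (rule submodule_abelian_subgroup[OF V H])
  have sub: "subgroup H (add_monoid V)" using H by (simp add: submodule_def)
  show ?thesis
  proof
    assume "H +>\<^bsub>V\<^esub> x = H +>\<^bsub>V\<^esub> y"
    hence "H +>\<^bsub>V\<^esub> (x \<oplus>\<^bsub>V\<^esub> (\<ominus>\<^bsub>V\<^esub> y)) = H"
      using x y a_coset_add_inv2 a_subset by blast
    thus "x \<ominus>\<^bsub>V\<^esub> y \<in> H"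
      using a_coset_join1[of H "x \<ominus>\<^bsub>V\<^esub> y"] V x y sub by (simp add: a_minus_def)
  next
    assume "x \<ominus>\<^bsub>V\<^esub> y \<in> H"
    hence "H +>\<^bsub>V\<^esub> (x \<oplus>\<^bsub>V\<^esub> (\<ominus>\<^bsub>V\<^esub> y)) = H"
      using a_coset_join2[of "x \<ominus>\<^bsub>V\<^esub> y" H] V x y sub by (simp add: a_minus_def)
    thus "H +>\<^bsub>V\<^esub> x = H +>\<^bsub>V\<^esub> y"
      using x y a_coset_add_inv1 a_subset by blast
  qed
qed

lemma quotient_carrier: "carrier (Quot V H) = (\<lambda>x. H +>\<^bsub>V\<^esub> x) ` carrier V"
  by (auto simp: quotient_module_def A_RCOSETS_def')

lemma quotient_add:
  assumes "module K V" "submodule H K V" "x \<in> carrier V" "y \<in> carrier V"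
  shows "(H +>\<^bsub>V\<^esub> x) \<oplus>\<^bsub>Quot V H\<^esub> (H +>\<^bsub>V\<^esub> y) = H +>\<^bsub>V\<^esub> (x \<oplus>\<^bsub>V\<^esub> y)"
  using abelian_subgroup.a_rcos_sum[OF submodule_abelian_subgroup] assms
  by (simp add: quotient_module_def)

lemma quotient_smult:
  assumes V: "module K V" and H: "submodule H K V" and a: "a \<in> carrier K" and x: "x \<in> carrier V"
  shows "a \<odot>\<^bsub>Quot V H\<^esub> (H +>\<^bsub>V\<^esub> x) = H +>\<^bsub>V\<^esub> (a \<odot>\<^bsub>V\<^esub> x)"
proof -
  interpret abelian_subgroup H V by (rule submodule_abelian_subgroup[OF V H])
  have "H +>\<^bsub>V\<^esub> (a \<odot>\<^bsub>V\<^esub> y) = H +>\<^bsub>V\<^esub> (a \<odot>\<^bsub>V\<^esub> x)" if "y \<in> H +>\<^bsub>V\<^esub> x" for y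
  proof -
    from that obtain h where h: "h \<in> H" "y = h \<oplus>\<^bsub>V\<^esub> x" by (auto simp: a_r_coset_def')
    have hV: "h \<in> carrier V" using h a_subset by auto
    have "a \<odot>\<^bsub>V\<^esub> y \<ominus>\<^bsub>V\<^esub> a \<odot>\<^bsub>V\<^esub> x = a \<odot>\<^bsub>V\<^esub> h"
      using V a x hV by (simp add: h module_distr a_minus_def module_ac r_neg)
    also have "\<dots> \<in> H" using submodule_smult[OF H a h(1)] .
    finally show ?thesis using V H a x hV by (subst coset_eq_iff) (auto simp: h)
  qed
  hence "(\<Union>y\<in>H +>\<^bsub>V\<^esub> x. H +>\<^bsub>V\<^esub> (a \<odot>\<^bsub>V\<^esub> y)) = (\<Union>y\<in>H +>\<^bsub>V\<^esub> x. H +>\<^bsub>V\<^esub> (a \<odot>\<^bsub>V\<^esub> x))"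
    by (rule SUP_cong[OF refl])
  also have "\<dots> = H +>\<^bsub>V\<^esub> (a \<odot>\<^bsub>V\<^esub> x)"
    using a_rcos_self[OF x] by blast
  finally show ?thesis by (simp add: quotient_module_def)
qed

lemma quotient_module_module:
  assumes V: "module K V" and H: "submodule H K V"
  shows "module K (Quot V H)"
proof (rule moduleI)
  interpret abelian_subgroup H V by (rule submodule_abelian_subgroup[OF V H])
  have zero: "\<zero>\<^bsub>Quot V H\<^esub> = H +>\<^bsub>V\<^esub> \<zero>\<^bsub>V\<^esub>"
    using a_subset by (simp add: quotient_module_def)
  show "abelian_group (Quot V H)"
  proof (rule abelian_groupI)
    fix X assume "X \<in> carrier (Quot V H)"
    then obtain x where x: "x \<in> carrier V" "X = H +>\<^bsub>V\<^esub> x" by (auto simp: quotient_carrier)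
    have "(H +>\<^bsub>V\<^esub> (\<ominus>\<^bsub>V\<^esub> x)) \<oplus>\<^bsub>Quot V H\<^esub> X = \<zero>\<^bsub>Quot V H\<^esub>"
      using V H x by (simp add: quotient_add zero l_neg)
    thus "\<exists>Y\<in>carrier (Quot V H). Y \<oplus>\<^bsub>Quot V H\<^esub> X = \<zero>\<^bsub>Quot V H\<^esub>"
      using V x by (auto simp: quotient_carrier)
  qed (use V H in \<open>auto simp: quotient_carrier quotient_add zero module_ac\<close>)
  show "cring K" by (rule is_cring)
qed (use V H in \<open>auto simp: quotient_carrier quotient_add quotient_smult module_distr
      module_distr_left module_smult_smult\<close>)

lemma coset_linear:
  assumes "module K V" "submodule H K V"
  shows "(\<lambda>x. H +>\<^bsub>V\<^esub> x) \<in> Lin V (Quot V H)"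
  by (rule linearI) (use assms in \<open>auto simp: quotient_carrier quotient_add quotient_smult\<close>)

lemma coset_zero_iff:
  assumes "module K V" "submodule H K V" "x \<in> carrier V"
  shows "H +>\<^bsub>V\<^esub> x = \<zero>\<^bsub>Quot V H\<^esub> \<longleftrightarrow> x \<in> H"
proof -
  interpret abelian_subgroup H V by (rule submodule_abelian_subgroup[OF assms(1,2)])
  have sub: "subgroup H (add_monoid V)" using assms by (simp add: submodule_def)
  have zero: "\<zero>\<^bsub>Quot V H\<^esub> = H" by (simp add: quotient_module_def)
  show ?thesis
    unfolding zero using a_coset_join1[OF _ assms(3) sub] a_coset_join2[OF assms(3) sub] by blast
qed

lemma kernel_submodule:
  assumes h: "h \<in> Lin V W" and V: "module K V" and W: "module K W"
  shows "submodule {x \<in> carrier V. h x = \<zero>\<^bsub>W\<^esub>} K V"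
  by (rule module.submoduleI[OF V])
     (use V W in \<open>auto simp: linear_zero[OF h] linear_add[OF h] linear_smult[OF h] linear_neg[OF h]
       module_neg_smult[of W]\<close>)

lemma module_span_subset:
  "S \<subseteq> module_span K V S"
  by (auto simp: module_span_def)

lemma module_span_least: "submodule H K V \<Longrightarrow> S \<subseteq> H \<Longrightarrow> module_span K V S \<subseteq> H"
  by (auto simp: module_span_def)

lemma module_span_submodule:
  assumes V: "module K V" and S: "S \<subseteq> carrier V"
  shows "submodule (module_span K V S) K V"
proof (rule module.submoduleI[OF V])
  show "module_span K V S \<subseteq> carrier V"
    by (rule module_span_least) (use V S module.carrier_is_submodule in auto)
qed (auto simp: module_span_def submodule_def subgroup_def submodule_axioms_def a_inv_def)

section \<open>Tensor products\<close>

text \<open>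
  The value of a linear map on a coset does not depend on the representative as soon as the map
  annihilates the submodule.
\<close>

lemma quotient_lift:
  assumes V: "module K V" and X: "module K X" and H: "submodule H K V"
    and g: "g \<in> Lin V X" and H0: "\<And>x. x \<in> H \<Longrightarrow> g x = \<zero>\<^bsub>X\<^esub>"
  shows "\<exists>h\<in>Lin (Quot V H) X. \<forall>x\<in>carrier V. h (H +>\<^bsub>V\<^esub> x) = g x"
proof -
  define h where "h = (\<lambda>Z. g (SOME x. x \<in> carrier V \<and> Z = H +>\<^bsub>V\<^esub> x))"
  have h: "h (H +>\<^bsub>V\<^esub> x) = g x" if x: "x \<in> carrier V" for x
  proof -
    define y where "y = (SOME y. y \<in> carrier V \<and> H +>\<^bsub>V\<^esub> x = H +>\<^bsub>V\<^esub> y)"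
    have y: "y \<in> carrier V \<and> H +>\<^bsub>V\<^esub> x = H +>\<^bsub>V\<^esub> y"
      unfolding y_def by (rule someI[of _ x]) (use x in simp)
    hence "x \<ominus>\<^bsub>V\<^esub> y \<in> H" using coset_eq_iff[OF V H] x by blast
    hence "g x \<ominus>\<^bsub>X\<^esub> g y = \<zero>\<^bsub>X\<^esub>" using H0 linear_minus[OF g V X] x y by metis
    hence "g x = g y" using module_minus_zero_iff[OF X] x y linear_closed[OF g] by blast
    thus ?thesis by (simp add: h_def y_def)
  qed
  moreover have "h \<in> Lin (Quot V H) X"
    by (rule linearI)
       (use V X H in \<open>auto simp: quotient_carrier quotient_add quotient_smult h linear_add[OF g]
          linear_smult[OF g] linear_closed[OF g]\<close>)
  ultimately show ?thesis by blast
qed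

lemma bilinear_relations_closed:
  assumes "module K V" "module K W"
  shows "bilinear_relations K V W \<subseteq> carrier (Free (carrier V \<times> carrier W))"
  unfolding bilinear_relations_def Let_def
proof (intro Un_least subsetI; elim CollectE exE conjE)
qed (use assms in \<open>simp_all only: mem_Sigma_iff free_gen_closed module_add module_smult module_minus
  free_module_module simp_thms HOL.simp_thms\<close>)

lemma bilinear_relationsI:
  defines "e \<equiv> \<lambda>v w. free_gen K (v, w)"
  fixes V :: "('k, 'v, 'y) module_scheme" and W :: "('k, 'w, 'z) module_scheme"
  defines "F \<equiv> Free (carrier V \<times> carrier W)"
  shows "v \<in> carrier V \<Longrightarrow> v' \<in> carrier V \<Longrightarrow> w \<in> carrier W \<Longrightarrow>
      e (v \<oplus>\<^bsub>V\<^esub> v') w \<ominus>\<^bsub>F\<^esub> (e v w \<oplus>\<^bsub>F\<^esub> e v' w) \<in> bilinear_relations K V W"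
    and "v \<in> carrier V \<Longrightarrow> w \<in> carrier W \<Longrightarrow> w' \<in> carrier W \<Longrightarrow>
      e v (w \<oplus>\<^bsub>W\<^esub> w') \<ominus>\<^bsub>F\<^esub> (e v w \<oplus>\<^bsub>F\<^esub> e v w') \<in> bilinear_relations K V W"
    and "a \<in> carrier K \<Longrightarrow> v \<in> carrier V \<Longrightarrow> w \<in> carrier W \<Longrightarrow>
      e (a \<odot>\<^bsub>V\<^esub> v) w \<ominus>\<^bsub>F\<^esub> (a \<odot>\<^bsub>F\<^esub> e v w) \<in> bilinear_relations K V W"
    and "a \<in> carrier K \<Longrightarrow> v \<in> carrier V \<Longrightarrow> w \<in> carrier W \<Longrightarrow>
      e v (a \<odot>\<^bsub>W\<^esub> w) \<ominus>\<^bsub>F\<^esub> (a \<odot>\<^bsub>F\<^esub> e v w) \<in> bilinear_relations K V W"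
  unfolding bilinear_relations_def Let_def e_def F_def by blast+

lemma tensor_null_submodule:
  "module K V \<Longrightarrow> module K W \<Longrightarrow> submodule (tensor_null K V W) K (Free (carrier V \<times> carrier W))"
  unfolding tensor_null_def by (intro module_span_submodule free_module_module bilinear_relations_closed)

lemma tensor_module [simp]: "module K V \<Longrightarrow> module K W \<Longrightarrow> module K (tensor K V W)"
  unfolding tensor_def by (intro quotient_module_module free_module_module tensor_null_submodule)

lemma coset_free_eqI:
  assumes "module K V" "module K W"
    and "f \<ominus>\<^bsub>Free (carrier V \<times> carrier W)\<^esub> g \<in> bilinear_relations K V W"
    and "f \<in> carrier (Free (carrier V \<times> carrier W))" "g \<in> carrier (Free (carrier V \<times> carrier W))"
  shows "tensor_null K V W +>\<^bsub>Free (carrier V \<times> carrier W)\<^esub> f =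
    tensor_null K V W +>\<^bsub>Free (carrier V \<times> carrier W)\<^esub> g"
proof -
  have "f \<ominus>\<^bsub>Free (carrier V \<times> carrier W)\<^esub> g \<in> tensor_null K V W"
    unfolding tensor_null_def by (rule subsetD[OF module_span_subset assms(3)])
  thus ?thesis
    by (simp only: coset_eq_iff[OF free_module_module tensor_null_submodule[OF assms(1,2)] assms(4,5)])
qed

lemma tens_closed [simp]:
  "module K V \<Longrightarrow> module K W \<Longrightarrow> v \<in> carrier V \<Longrightarrow> w \<in> carrier W \<Longrightarrow>
    tens K V W v w \<in> carrier (tensor K V W)"
  by (auto simp: tens_def tensor_def quotient_carrier)

lemma tens_linear:
  assumes V: "module K V" and W: "module K W"
  shows "v \<in> carrier V \<Longrightarrow> v' \<in> carrier V \<Longrightarrow> w \<in> carrier W \<Longrightarrow>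
      tens K V W (v \<oplus>\<^bsub>V\<^esub> v') w = tens K V W v w \<oplus>\<^bsub>tensor K V W\<^esub> tens K V W v' w"
    and "v \<in> carrier V \<Longrightarrow> w \<in> carrier W \<Longrightarrow> w' \<in> carrier W \<Longrightarrow>
      tens K V W v (w \<oplus>\<^bsub>W\<^esub> w') = tens K V W v w \<oplus>\<^bsub>tensor K V W\<^esub> tens K V W v w'"
    and "a \<in> carrier K \<Longrightarrow> v \<in> carrier V \<Longrightarrow> w \<in> carrier W \<Longrightarrow>
      tens K V W (a \<odot>\<^bsub>V\<^esub> v) w = a \<odot>\<^bsub>tensor K V W\<^esub> tens K V W v w"
    and "a \<in> carrier K \<Longrightarrow> v \<in> carrier V \<Longrightarrow> w \<in> carrier W \<Longrightarrow>
      tens K V W v (a \<odot>\<^bsub>W\<^esub> w) = a \<odot>\<^bsub>tensor K V W\<^esub> tens K V W v w"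
  unfolding tens_def tensor_def
  by (simp_all add: V W quotient_add[OF free_module_module tensor_null_submodule[OF V W]]
      quotient_smult[OF free_module_module tensor_null_submodule[OF V W]]
      coset_free_eqI[OF V W] bilinear_relationsI)

text \<open>
  The scalars in a linear combination of generators of the free module are absorbed into the first
  tensor factor, so sums of pure tensors exhaust the tensor product.
\<close>

lemma tensor_induct [consumes 3, case_names zero add]:
  assumes V: "module K V" and W: "module K W" and z: "z \<in> carrier (tensor K V W)"
    and zero: "P \<zero>\<^bsub>tensor K V W\<^esub>"
    and add: "\<And>z v w. z \<in> carrier (tensor K V W) \<Longrightarrow> P z \<Longrightarrow> v \<in> carrier V \<Longrightarrow> w \<in> carrier W \<Longrightarrow>
      P (tens K V W v w \<oplus>\<^bsub>tensor K V W\<^esub> z)"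
  shows "P z"
proof -
  let ?F = "Free (carrier V \<times> carrier W)" and ?N = "tensor_null K V W"
  note N = tensor_null_submodule[OF V W]
  define q where "q = (\<lambda>f. ?N +>\<^bsub>?F\<^esub> f)"
  have q: "q \<in> Lin ?F (tensor K V W)"
    unfolding q_def tensor_def by (rule coset_linear[OF free_module_module N])
  have "P (q f)" if "f \<in> carrier ?F" for f
    using that
  proof (induction rule: free_induct)
    case zero
    show ?case using assms(4) linear_zero[OF q] V W by simp
  next
    case (add f a i)
    obtain v w where i: "i = (v, w)" "v \<in> carrier V" "w \<in> carrier W" using add.hyps by auto
    have "q (f \<oplus>\<^bsub>?F\<^esub> a \<odot>\<^bsub>?F\<^esub> free_gen K i) = q f \<oplus>\<^bsub>tensor K V W\<^esub> a \<odot>\<^bsub>tensor K V W\<^esub> q (free_gen K i)"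
      using add.hyps by (simp add: linear_add[OF q] linear_smult[OF q])
    also have "q (free_gen K i) = tens K V W v w" by (simp add: q_def tens_def i)
    also have "q f \<oplus>\<^bsub>tensor K V W\<^esub> a \<odot>\<^bsub>tensor K V W\<^esub> tens K V W v w
        = tens K V W (a \<odot>\<^bsub>V\<^esub> v) w \<oplus>\<^bsub>tensor K V W\<^esub> q f"
      using V W i add.hyps linear_closed[OF q] by (simp add: tens_linear module_ac)
    finally show ?case using assms(5)[OF _ add.IH, of "a \<odot>\<^bsub>V\<^esub> v" w] V i add.hyps linear_closed[OF q]
      by simp
  qed
  moreover obtain f where "f \<in> carrier ?F" "z = q f"
    using z by (auto simp: tensor_def quotient_carrier q_def)
  ultimately show ?thesis by simp
qed

lemma tensor_decomposition:
  assumes V: "module K V" and W: "module K W" and z: "z \<in> carrier (tensor K V W)"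
  shows "\<exists>ps. set ps \<subseteq> carrier V \<times> carrier W \<and> z = lsum (tensor K V W) (\<lambda>(v, w). tens K V W v w) ps"
  using V W z
proof (induction rule: tensor_induct)
  case zero
  show ?case by (rule exI[of _ "[]"]) simp
next
  case (add z v w)
  then obtain ps where "set ps \<subseteq> carrier V \<times> carrier W"
    "z = lsum (tensor K V W) (\<lambda>(v, w). tens K V W v w) ps" by blast
  with add show ?case by (intro exI[of _ "(v, w) # ps"]) simp
qed

lemma tensor_linear_eqI:
  assumes "f \<in> Lin (tensor K V W) X" "g \<in> Lin (tensor K V W) X"
    and V: "module K V" and W: "module K W" and X: "module K X"
    and "\<And>v w. v \<in> carrier V \<Longrightarrow> w \<in> carrier W \<Longrightarrow> f (tens K V W v w) = g (tens K V W v w)"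
    and z: "z \<in> carrier (tensor K V W)"
  shows "f z = g z"
  using V W z
proof (induction rule: tensor_induct)
  case zero
  show ?case using linear_zero[OF assms(1)] linear_zero[OF assms(2)] V W X by simp
next
  case (add z v w)
  then show ?case
    using V W assms(6) by (simp add: linear_add[OF assms(1)] linear_add[OF assms(2)])
qed

definition bilinear where
  "bilinear V W X \<beta> \<longleftrightarrow>
    (\<forall>v\<in>carrier V. \<forall>w\<in>carrier W. \<beta> v w \<in> carrier X) \<and>
    (\<forall>v\<in>carrier V. \<forall>v'\<in>carrier V. \<forall>w\<in>carrier W. \<beta> (v \<oplus>\<^bsub>V\<^esub> v') w = \<beta> v w \<oplus>\<^bsub>X\<^esub> \<beta> v' w) \<and>
    (\<forall>v\<in>carrier V. \<forall>w\<in>carrier W. \<forall>w'\<in>carrier W. \<beta> v (w \<oplus>\<^bsub>W\<^esub> w') = \<beta> v w \<oplus>\<^bsub>X\<^esub> \<beta> v w') \<and>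
    (\<forall>a\<in>carrier K. \<forall>v\<in>carrier V. \<forall>w\<in>carrier W. \<beta> (a \<odot>\<^bsub>V\<^esub> v) w = a \<odot>\<^bsub>X\<^esub> \<beta> v w) \<and>
    (\<forall>a\<in>carrier K. \<forall>v\<in>carrier V. \<forall>w\<in>carrier W. \<beta> v (a \<odot>\<^bsub>W\<^esub> w) = a \<odot>\<^bsub>X\<^esub> \<beta> v w)"

lemma bilinear_tens: "module K V \<Longrightarrow> module K W \<Longrightarrow> bilinear V W (tensor K V W) (tens K V W)"
  by (simp add: bilinear_def tens_linear)

lemma bilinear_linear:
  "bilinear V W X \<beta> \<Longrightarrow> h \<in> Lin X Y \<Longrightarrow> bilinear V W Y (\<lambda>v w. h (\<beta> v w))"
  by (simp add: bilinear_def linear_closed linear_add linear_smult)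

lemma bilinear_of_tensor:
  "h \<in> Lin (tensor K V W) X \<Longrightarrow> module K V \<Longrightarrow> module K W \<Longrightarrow> 
    bilinear V W X (\<lambda>v w. h (tens K V W v w))"
  by (rule bilinear_linear[OF bilinear_tens])

lemma bilinear_cong:
  assumes "module K V" "module K W"
    and "\<And>v w. v \<in> carrier V \<Longrightarrow> w \<in> carrier W \<Longrightarrow> \<beta> v w = \<gamma> v w"
  shows "bilinear V W X \<beta> \<longleftrightarrow> bilinear V W X \<gamma>"
  unfolding bilinear_def using assms by (intro conj_cong ball_cong refl) (simp_all)

text \<open>
  The linear extension of \<open>\<beta>\<close> to the free module annihilates the four kinds of bilinearity relations,
  hence the submodule that they span, and therefore descends to the quotient.
\<close>

lemma tensor_lift_ex:
  assumes V: "module K V" and W: "module K W" and X: "module K X" and \<beta>: "bilinear V W X \<beta>"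
  shows "\<exists>h\<in>Lin (tensor K V W) X. \<forall>v\<in>carrier V. \<forall>w\<in>carrier W. h (tens K V W v w) = \<beta> v w"
proof -
  let ?F = "Free (carrier V \<times> carrier W)"
  define g where "g = free_lift X (\<lambda>(v, w). \<beta> v w)"
  have cl: "(\<lambda>(v, w). \<beta> v w) i \<in> carrier X" if "i \<in> carrier V \<times> carrier W" for i
    using that \<beta> by (auto simp: bilinear_def)
  have g: "g \<in> Lin ?F X" unfolding g_def by (rule free_lift_linear[OF X cl])
  have gen: "g (free_gen K (v, w)) = \<beta> v w" if "v \<in> carrier V" "w \<in> carrier W" for v w
    unfolding g_def using free_lift_gen[OF X cl, where i = "(v, w)"] that by simp
  have "tensor_null K V W \<subseteq> {f \<in> carrier ?F. g f = \<zero>\<^bsub>X\<^esub>}"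
    unfolding tensor_null_def
  proof (rule module_span_least[OF kernel_submodule[OF g free_module_module X]], rule subsetI)
    fix f assume f: "f \<in> bilinear_relations K V W"
    hence F: "f \<in> carrier ?F" using bilinear_relations_closed[OF V W] by blast
    note s = linear_minus[OF g free_module_module X] linear_add[OF g] linear_smult[OF g]
    from f have "g f = \<zero>\<^bsub>X\<^esub>"
      unfolding bilinear_relations_def Let_def
      using V W X \<beta> by (auto simp: s gen bilinear_def module_minus_zero_iff)
    with F show "f \<in> {f \<in> carrier ?F. g f = \<zero>\<^bsub>X\<^esub>}" by simp
  qed
  hence "g f = \<zero>\<^bsub>X\<^esub>" if "f \<in> tensor_null K V W" for f using that by blast
  then obtain h where h: "h \<in> Lin (tensor K V W) X"
    "\<And>f. f \<in> carrier ?F \<Longrightarrow> h (tensor_null K V W +>\<^bsub>?F\<^esub> f) = g f"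
    using quotient_lift[OF free_module_module X tensor_null_submodule[OF V W] g]
    unfolding tensor_def by blast
  have "h (tens K V W v w) = \<beta> v w" if "v \<in> carrier V" "w \<in> carrier W" for v w
    using that by (simp add: tens_def h(2) gen)
  with h(1) show ?thesis by blast
qed

lemma
  assumes V: "module K V" and W: "module K W" and X: "module K X" and \<beta>: "bilinear V W X \<beta>"
  shows tensor_lift_linear: "tensor_lift K V W X \<beta> \<in> Lin (tensor K V W) X"
    and tensor_lift_tens: "\<And>v w. v \<in> carrier V \<Longrightarrow> w \<in> carrier W \<Longrightarrow>
      tensor_lift K V W X \<beta> (tens K V W v w) = \<beta> v w"
proof -
  obtain h where h: "h \<in> Lin (tensor K V W) X"
    "\<And>v w. v \<in> carrier V \<Longrightarrow> w \<in> carrier W \<Longrightarrow> h (tens K V W v w) = \<beta> v w"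
    using tensor_lift_ex[OF assms] by blast
  let ?P = "\<lambda>h. h \<in> Lin (tensor K V W) X \<and> h \<in> extensional (carrier (tensor K V W)) \<and>
            (\<forall>v\<in>carrier V. \<forall>w\<in>carrier W. h (tens K V W v w) = \<beta> v w)"
  have "restrict h (carrier (tensor K V W)) \<in> Lin (tensor K V W) X"
    using h(1) V W by (auto simp: linear_maps_def)
  hence P: "?P (restrict h (carrier (tensor K V W)))"
    using h V W by auto
  have "?P (tensor_lift K V W X \<beta>)"
    unfolding tensor_lift_def
  proof (rule theI[of ?P, OF P])
    fix g assume g: "?P g"
    show "g = restrict h (carrier (tensor K V W))"
      by (rule extensionalityI[of _ "carrier (tensor K V W)"])
         (use g P tensor_linear_eqI[OF _ _ V W X, of g "restrict h (carrier (tensor K V W))"] in auto)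
  qed
  thus "tensor_lift K V W X \<beta> \<in> Lin (tensor K V W) X"
    "\<And>v w. v \<in> carrier V \<Longrightarrow> w \<in> carrier W \<Longrightarrow> tensor_lift K V W X \<beta> (tens K V W v w) = \<beta> v w"
    by auto
qed

lemma tensor_lift_cong:
  "(\<And>v w. v \<in> carrier V \<Longrightarrow> w \<in> carrier W \<Longrightarrow> \<beta> v w = \<gamma> v w) \<Longrightarrow>
    tensor_lift K V W X \<beta> = tensor_lift K V W X \<gamma>"
  unfolding tensor_lift_def by (intro arg_cong[where f = The]) auto

lemma tensor_lift_lsum:
  assumes "module K V" "module K W" "module K X" "bilinear V W X \<beta>"
    and ps: "set ps \<subseteq> carrier V \<times> carrier W"
  shows "tensor_lift K V W X \<beta> (lsum (tensor K V W) (\<lambda>(v, w). tens K V W v w) ps) =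
    lsum X (\<lambda>(v, w). \<beta> v w) ps"
proof -
  have "tensor_lift K V W X \<beta> (lsum (tensor K V W) (\<lambda>(v, w). tens K V W v w) ps) =
    lsum X (\<lambda>p. tensor_lift K V W X \<beta> ((\<lambda>(v, w). tens K V W v w) p)) ps"
    using assms by (intro lsum_linear[OF tensor_lift_linear]) auto
  also have "\<dots> = lsum X (\<lambda>(v, w). \<beta> v w) ps"
    using assms by (intro lsum_cong) (auto simp: tensor_lift_tens)
  finally show ?thesis .
qed

section \<open>Sweedler sums\<close>

text \<open>
  The part of the coalgebra axioms that is needed to form Sweedler sums. It makes these sums
  available for computing with a candidate coalgebra before its coassociativity is known.
\<close>

definition comult_module where
  "comult_module C \<longleftrightarrow> module K C \<and> comult C \<in> Lin C (tensor K C C)"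

lemma comult_module_module: "comult_module C \<Longrightarrow> module K C"
  by (simp add: comult_module_def)

lemma coalgebra_comult_module: "coalgebra K C \<Longrightarrow> comult_module C"
  by (simp add: comult_module_def coalgebra_def coalgebra_axioms_def)

text \<open>
  A fixed decomposition of \<open>\<Delta>(c)\<close> into pure tensors, and the Sweedler sum over it. In contrast to
  \<^const>\<open>sweedler\<close>, the sum \<open>ssum\<close> is meaningful for every \<open>\<beta>\<close>: exchanging two sums, or moving a linear
  map under a sum, only requires the values of \<open>\<beta>\<close> to lie in the carrier. Bilinearity enters where a
  sum must not depend on the decomposition, and there the two notions agree (\<open>sweedler_eq_ssum\<close>).
\<close>

definition coprod where
  "coprod C c = (SOME ps. set ps \<subseteq> carrier C \<times> carrier C \<and>
    comult C c = lsum (tensor K C C) (\<lambda>(x, y). tens K C C x y) ps)"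

definition ssum where
  "ssum C X \<beta> c = lsum X (\<lambda>(x, y). \<beta> x y) (coprod C c)"

context
  fixes C :: "('k, 'c, 'y) coalgebra_scheme"
  assumes C: "comult_module C"
begin

lemma
  assumes "c \<in> carrier C"
  shows coprod_closed: "set (coprod C c) \<subseteq> carrier C \<times> carrier C"
    and comult_coprod: "comult C c = lsum (tensor K C C) (\<lambda>(x, y). tens K C C x y) (coprod C c)"
proof -
  have "comult C c \<in> carrier (tensor K C C)"
    using C assms unfolding comult_module_def by (meson linear_closed)
  from tensor_decomposition[OF _ _ this] C
  have "\<exists>ps. set ps \<subseteq> carrier C \<times> carrier C \<and>
      comult C c = lsum (tensor K C C) (\<lambda>(x, y). tens K C C x y) ps"
    by (simp add: comult_module_def)
  from someI_ex[OF this]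
  show "set (coprod C c) \<subseteq> carrier C \<times> carrier C"
    "comult C c = lsum (tensor K C C) (\<lambda>(x, y). tens K C C x y) (coprod C c)"
    unfolding coprod_def by blast+
qed

lemma ssum_closed [simp]:
  assumes "module K X" "c \<in> carrier C"
    "\<And>x y. x \<in> carrier C \<Longrightarrow> y \<in> carrier C \<Longrightarrow> \<beta> x y \<in> carrier X"
  shows "ssum C X \<beta> c \<in> carrier X"
  unfolding ssum_def using coprod_closed[OF assms(2)] assms by (intro lsum_closed) auto

lemma ssum_cong:
  assumes "c \<in> carrier C" "\<And>x y. x \<in> carrier C \<Longrightarrow> y \<in> carrier C \<Longrightarrow> \<beta> x y = \<gamma> x y"
  shows "ssum C X \<beta> c = ssum C X \<gamma> c"
  unfolding ssum_def using coprod_closed[OF assms(1)] assms(2) by (intro lsum_cong) auto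

lemma ssum_add:
  assumes "module K X" "c \<in> carrier C"
    "\<And>x y. x \<in> carrier C \<Longrightarrow> y \<in> carrier C \<Longrightarrow> \<beta> x y \<in> carrier X"
    "\<And>x y. x \<in> carrier C \<Longrightarrow> y \<in> carrier C \<Longrightarrow> \<gamma> x y \<in> carrier X"
  shows "ssum C X (\<lambda>x y. \<beta> x y \<oplus>\<^bsub>X\<^esub> \<gamma> x y) c = ssum C X \<beta> c \<oplus>\<^bsub>X\<^esub> ssum C X \<gamma> c"
  unfolding ssum_def case_prod_beta
  using coprod_closed[OF assms(2)] by (intro lsum_add assms) auto

lemma ssum_linear:
  assumes "h \<in> Lin X Y" "module K X" "module K Y" "c \<in> carrier C"
    "\<And>x y. x \<in> carrier C \<Longrightarrow> y \<in> carrier C \<Longrightarrow> \<beta> x y \<in> carrier X"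
  shows "h (ssum C X \<beta> c) = ssum C Y (\<lambda>x y. h (\<beta> x y)) c"
  unfolding ssum_def case_prod_beta
  using coprod_closed[OF assms(4)] by (intro lsum_linear[OF assms(1-3)] assms(5)) auto

lemma ssum_smult:
  assumes "module K X" "c \<in> carrier C" "a \<in> carrier K"
    "\<And>x y. x \<in> carrier C \<Longrightarrow> y \<in> carrier C \<Longrightarrow> \<beta> x y \<in> carrier X"
  shows "ssum C X (\<lambda>x y. a \<odot>\<^bsub>X\<^esub> \<beta> x y) c = a \<odot>\<^bsub>X\<^esub> ssum C X \<beta> c"
  by (rule ssum_linear[symmetric, of _ X])
     (use assms in \<open>auto intro!: linearI simp: module_distr module_smult_comm\<close>)

lemma sweedler_eq_ssum:
  assumes "module K X" "c \<in> carrier C" "bilinear C C X \<beta>"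
  shows "sweedler K C X \<beta> c = ssum C X \<beta> c"
  unfolding sweedler_def ssum_def comult_coprod[OF assms(2)]
  using tensor_lift_lsum[OF _ _ assms(1,3) coprod_closed[OF assms(2)]] C
  by (simp add: comult_module_def)

lemma comult_eq_ssum: "c \<in> carrier C \<Longrightarrow> comult C c = ssum C (tensor K C C) (tens K C C) c"
  unfolding ssum_def by (rule comult_coprod)

lemma sweedler_linear:
  assumes "module K X" "bilinear C C X \<beta>"
  shows "sweedler K C X \<beta> \<in> Lin C X"
proof -
  have "(\<lambda>c. tensor_lift K C C X \<beta> (comult C c)) \<in> Lin C X"
    by (rule linear_comp[of _ _ "tensor K C C"])
       (use C assms in \<open>auto simp: comult_module_def tensor_lift_linear\<close>)
  thus ?thesis by (simp add: sweedler_def[abs_def])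
qed

lemma ssum_arg_linear:
  assumes "module K X" "bilinear C C X \<beta>"
  shows "ssum C X \<beta> \<in> Lin C X"
  using sweedler_linear[OF assms] sweedler_eq_ssum[OF assms(1) _ assms(2)] comult_module_module[OF C]
  by (simp add: linear_maps_def Pi_def)

end

lemma ssum_swap:
  fixes D :: "('k, 'd, 'w) coalgebra_scheme"
  assumes "comult_module C" "comult_module D" "module K X" "c \<in> carrier C" "d \<in> carrier D"
    "\<And>x y u v. x \<in> carrier C \<Longrightarrow> y \<in> carrier C \<Longrightarrow> u \<in> carrier D \<Longrightarrow> v \<in> carrier D \<Longrightarrow>
      \<beta> x y u v \<in> carrier X"
  shows "ssum C X (\<lambda>x y. ssum D X (\<lambda>u v. \<beta> x y u v) d) c =
    ssum D X (\<lambda>u v. ssum C X (\<lambda>x y. \<beta> x y u v) c) d"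
  unfolding ssum_def case_prod_beta
  using coprod_closed[OF assms(1,4)] coprod_closed[OF assms(2,5)]
  by (intro lsum_swap assms) auto

section \<open>Multilinear maps\<close>

lemma bilinearI:
  assumes "\<And>v w. v \<in> carrier V \<Longrightarrow> w \<in> carrier W \<Longrightarrow> \<beta> v w \<in> carrier X"
    and "\<And>v v' w. v \<in> carrier V \<Longrightarrow> v' \<in> carrier V \<Longrightarrow> w \<in> carrier W \<Longrightarrow>
      \<beta> (v \<oplus>\<^bsub>V\<^esub> v') w = \<beta> v w \<oplus>\<^bsub>X\<^esub> \<beta> v' w"
    and "\<And>v w w'. v \<in> carrier V \<Longrightarrow> w \<in> carrier W \<Longrightarrow> w' \<in> carrier W \<Longrightarrow>
      \<beta> v (w \<oplus>\<^bsub>W\<^esub> w') = \<beta> v w \<oplus>\<^bsub>X\<^esub> \<beta> v w'"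
    and "\<And>a v w. a \<in> carrier K \<Longrightarrow> v \<in> carrier V \<Longrightarrow> w \<in> carrier W \<Longrightarrow>
      \<beta> (a \<odot>\<^bsub>V\<^esub> v) w = a \<odot>\<^bsub>X\<^esub> \<beta> v w"
    and "\<And>a v w. a \<in> carrier K \<Longrightarrow> v \<in> carrier V \<Longrightarrow> w \<in> carrier W \<Longrightarrow>
      \<beta> v (a \<odot>\<^bsub>W\<^esub> w) = a \<odot>\<^bsub>X\<^esub> \<beta> v w"
  shows "bilinear V W X \<beta>"
  using assms by (simp add: bilinear_def)

lemma
  assumes "bilinear V W X \<beta>"
  shows bilinear_closed: "v \<in> carrier V \<Longrightarrow> w \<in> carrier W \<Longrightarrow> \<beta> v w \<in> carrier X"
    and bilinear_add_left: "v \<in> carrier V \<Longrightarrow> v' \<in> carrier V \<Longrightarrow> w \<in> carrier W \<Longrightarrow>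
      \<beta> (v \<oplus>\<^bsub>V\<^esub> v') w = \<beta> v w \<oplus>\<^bsub>X\<^esub> \<beta> v' w"
    and bilinear_add_right: "v \<in> carrier V \<Longrightarrow> w \<in> carrier W \<Longrightarrow> w' \<in> carrier W \<Longrightarrow>
      \<beta> v (w \<oplus>\<^bsub>W\<^esub> w') = \<beta> v w \<oplus>\<^bsub>X\<^esub> \<beta> v w'"
    and bilinear_smult_left: "a \<in> carrier K \<Longrightarrow> v \<in> carrier V \<Longrightarrow> w \<in> carrier W \<Longrightarrow>
      \<beta> (a \<odot>\<^bsub>V\<^esub> v) w = a \<odot>\<^bsub>X\<^esub> \<beta> v w"
    and bilinear_smult_right: "a \<in> carrier K \<Longrightarrow> v \<in> carrier V \<Longrightarrow> w \<in> carrier W \<Longrightarrow>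
      \<beta> v (a \<odot>\<^bsub>W\<^esub> w) = a \<odot>\<^bsub>X\<^esub> \<beta> v w"
  using assms by (simp_all add: bilinear_def)

lemma bilinear_linear_left: "bilinear V W X \<beta> \<Longrightarrow> w \<in> carrier W \<Longrightarrow> (\<lambda>v. \<beta> v w) \<in> Lin V X"
  by (auto intro!: linearI simp: bilinear_def)

lemma bilinear_linear_right: "bilinear V W X \<beta> \<Longrightarrow> v \<in> carrier V \<Longrightarrow> \<beta> v \<in> Lin W X"
  by (auto intro!: linearI simp: bilinear_def)

lemma bilinear_iff_linear:
  "bilinear V W X \<beta> \<longleftrightarrow>
    (\<forall>w\<in>carrier W. (\<lambda>v. \<beta> v w) \<in> Lin V X) \<and> (\<forall>v\<in>carrier V. \<beta> v \<in> Lin W X)"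
  by (auto simp: bilinear_linear_left bilinear_linear_right)
     (auto intro!: bilinearI simp: linear_maps_def)

lemma bilinear_flip: "bilinear V W X \<beta> \<Longrightarrow> bilinear W V X (\<lambda>w v. \<beta> v w)"
  by (auto simp: bilinear_iff_linear)

lemma bilinear_comp:
  "bilinear V W X \<beta> \<Longrightarrow> f \<in> Lin V' V \<Longrightarrow> g \<in> Lin W' W \<Longrightarrow> bilinear V' W' X (\<lambda>v w. \<beta> (f v) (g w))"
  by (intro bilinearI)
     (simp_all add: linear_closed[of f] linear_add[of f] linear_smult[of f]
        linear_closed[of g] linear_add[of g] linear_smult[of g] bilinear_closed[of _ _ _ \<beta>] bilinear_add_left[of _ _ _ \<beta>]
        bilinear_add_right[of _ _ _ \<beta>] bilinear_smult_left[of _ _ _ \<beta>] bilinear_smult_right[of _ _ _ \<beta>])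

text \<open>
  Fixing an outer argument and requiring bilinearity in the remaining two covers linearity in each
  of the three arguments, and has the form in which bilinearity is used.
\<close>

definition trilinear where
  "trilinear U V W X \<beta> \<longleftrightarrow>
    (\<forall>w\<in>carrier W. bilinear U V X (\<lambda>u v. \<beta> u v w)) \<and> (\<forall>u\<in>carrier U. bilinear V W X (\<beta> u))"

lemma trilinearI:
  "(\<And>w. w \<in> carrier W \<Longrightarrow> bilinear U V X (\<lambda>u v. \<beta> u v w)) \<Longrightarrow>
   (\<And>u. u \<in> carrier U \<Longrightarrow> bilinear V W X (\<beta> u)) \<Longrightarrow> trilinear U V W X \<beta>"
  by (simp add: trilinear_def)

lemma trilinear_bilinear_left:
  "trilinear U V W X \<beta> \<Longrightarrow> w \<in> carrier W \<Longrightarrow> bilinear U V X (\<lambda>u v. \<beta> u v w)"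
  by (simp add: trilinear_def)

lemma trilinear_bilinear_right:
  "trilinear U V W X \<beta> \<Longrightarrow> u \<in> carrier U \<Longrightarrow> bilinear V W X (\<beta> u)"
  by (simp add: trilinear_def)

lemma trilinear_closed:
  "trilinear U V W X \<beta> \<Longrightarrow> u \<in> carrier U \<Longrightarrow> v \<in> carrier V \<Longrightarrow> w \<in> carrier W \<Longrightarrow> \<beta> u v w \<in> carrier X"
  by (auto simp: trilinear_def bilinear_def)

lemma trilinear_comp:
  assumes t: "trilinear U V W X \<beta>" and f: "f \<in> Lin U' U" and g: "g \<in> Lin V' V" and h: "h \<in> Lin W' W"
  shows "trilinear U' V' W' X (\<lambda>u v w. \<beta> (f u) (g v) (h w))"
proof (rule trilinearI)
  show "bilinear U' V' X (\<lambda>u v. \<beta> (f u) (g v) (h w))" if "w \<in> carrier W'" for w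
    by (rule bilinear_comp[OF trilinear_bilinear_left[OF t linear_closed[OF h that]] f g])
  show "bilinear V' W' X (\<lambda>v w. \<beta> (f u) (g v) (h w))" if "u \<in> carrier U'" for u
    by (rule bilinear_comp[OF trilinear_bilinear_right[OF t linear_closed[OF f that]] g h])
qed

lemma tens_tens_trilinear:
  assumes "module K U" "module K V" "module K W"
  shows "trilinear U V W (tensor K U (tensor K V W)) (\<lambda>u v w. tens K U (tensor K V W) u (tens K V W v w))"
  using assms by (intro trilinearI bilinearI) (simp_all add: tens_linear)

text \<open>
  The last two arguments are lifted first. Linearity of the result in \<open>u\<close> is an identity between
  linear maps on \<open>V \<otimes> W\<close>, hence may be checked on pure tensors.
\<close>

lemma trilinear_lift_right:
  assumes U: "module K U" and V: "module K V" and W: "module K W" and X: "module K X"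
    and t: "trilinear U V W X \<beta>"
  shows "\<exists>G\<in>Lin (tensor K U (tensor K V W)) X. \<forall>u\<in>carrier U. \<forall>v\<in>carrier V. \<forall>w\<in>carrier W.
    G (tens K U (tensor K V W) u (tens K V W v w)) = \<beta> u v w"
proof -
  let ?VW = "tensor K V W"
  have VW: "module K ?VW" using V W by simp
  define B where "B = (\<lambda>u z. tensor_lift K V W X (\<beta> u) z)"
  note bil = trilinear_bilinear_right[OF t]
  have Bt: "B u (tens K V W v w) = \<beta> u v w" if "u \<in> carrier U" "v \<in> carrier V" "w \<in> carrier W" for u v w
    unfolding B_def using tensor_lift_tens[OF V W X bil] that by simp
  have Bl: "B u \<in> Lin ?VW X" if "u \<in> carrier U" for u
    using tensor_lift_linear[OF V W X bil[OF that]] by (simp add: B_def[abs_def])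
  have Badd: "B (u \<oplus>\<^bsub>U\<^esub> u') z = B u z \<oplus>\<^bsub>X\<^esub> B u' z"
    if u: "u \<in> carrier U" "u' \<in> carrier U" and z: "z \<in> carrier ?VW" for u u' z
  proof (rule tensor_linear_eqI[OF _ _ V W X _ z])
    show "B (u \<oplus>\<^bsub>U\<^esub> u') \<in> Lin ?VW X" using u U by (intro Bl) simp
    show "(\<lambda>z. B u z \<oplus>\<^bsub>X\<^esub> B u' z) \<in> Lin ?VW X"
      by (rule linearI) (use u X linear_closed[OF Bl] linear_add[OF Bl] linear_smult[OF Bl] in
          \<open>auto simp: module_ac module_distr\<close>)
    show "B (u \<oplus>\<^bsub>U\<^esub> u') (tens K V W v w) = B u (tens K V W v w) \<oplus>\<^bsub>X\<^esub> B u' (tens K V W v w)"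
      if "v \<in> carrier V" "w \<in> carrier W" for v w
      using bilinear_add_left[OF trilinear_bilinear_left[OF t that(2)] u that(1)] that u U by (simp add: Bt)
  qed
  have Bsm: "B (a \<odot>\<^bsub>U\<^esub> u) z = a \<odot>\<^bsub>X\<^esub> B u z"
    if a: "a \<in> carrier K" and u: "u \<in> carrier U" and z: "z \<in> carrier ?VW" for a u z
  proof (rule tensor_linear_eqI[OF _ _ V W X _ z])
    show "B (a \<odot>\<^bsub>U\<^esub> u) \<in> Lin ?VW X" using a u U by (intro Bl) simp
    show "(\<lambda>z. a \<odot>\<^bsub>X\<^esub> B u z) \<in> Lin ?VW X"
      by (rule linearI) (use a u X linear_closed[OF Bl] linear_add[OF Bl] linear_smult[OF Bl] in
          \<open>auto simp: module_distr module_smult_comm\<close>)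
    show "B (a \<odot>\<^bsub>U\<^esub> u) (tens K V W v w) = a \<odot>\<^bsub>X\<^esub> B u (tens K V W v w)"
      if "v \<in> carrier V" "w \<in> carrier W" for v w
      using bilinear_smult_left[OF trilinear_bilinear_left[OF t that(2)] a u that(1)] that a u U
      by (simp add: Bt)
  qed
  have B: "bilinear U ?VW X B"
    using Badd Bsm linear_closed[OF Bl] linear_add[OF Bl] linear_smult[OF Bl] by (intro bilinearI) auto
  show ?thesis
  proof (intro bexI[of _ "tensor_lift K U ?VW X B"] ballI)
    show "tensor_lift K U ?VW X B \<in> Lin (tensor K U ?VW) X" by (rule tensor_lift_linear[OF U VW X B])
    show "tensor_lift K U ?VW X B (tens K U ?VW u (tens K V W v w)) = \<beta> u v w"
      if "u \<in> carrier U" "v \<in> carrier V" "w \<in> carrier W" for u v w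
      using tensor_lift_tens[OF U VW X B] that V W by (simp add: Bt)
  qed
qed

lemma trilinear_lift_left:
  assumes U: "module K U" and V: "module K V" and W: "module K W" and X: "module K X"
    and t: "trilinear U V W X \<beta>"
  shows "\<exists>G\<in>Lin (tensor K (tensor K U V) W) X. \<forall>u\<in>carrier U. \<forall>v\<in>carrier V. \<forall>w\<in>carrier W.
    G (tens K (tensor K U V) W (tens K U V u v) w) = \<beta> u v w"
proof -
  let ?UV = "tensor K U V"
  have UV: "module K ?UV" using U V by simp
  have uw: "bilinear W U X (\<lambda>w u. \<beta> u v w)" if "v \<in> carrier V" for v
    unfolding bilinear_iff_linear
    using that bilinear_linear_left[OF trilinear_bilinear_left[OF t]]
      bilinear_linear_right[OF trilinear_bilinear_right[OF t]] by blast
  have "trilinear W U V X (\<lambda>w u v. \<beta> u v w)"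
    by (rule trilinearI[OF uw trilinear_bilinear_left[OF t]])
  then obtain G where G: "G \<in> Lin (tensor K W ?UV) X"
    "\<And>u v w. u \<in> carrier U \<Longrightarrow> v \<in> carrier V \<Longrightarrow> w \<in> carrier W \<Longrightarrow>
      G (tens K W ?UV w (tens K U V u v)) = \<beta> u v w"
    using trilinear_lift_right[OF W U V X] by blast
  have b: "bilinear ?UV W X (\<lambda>z w. G (tens K W ?UV w z))"
    by (rule bilinear_flip[OF bilinear_of_tensor[OF G(1) W UV]])
  show ?thesis
  proof (intro bexI[of _ "tensor_lift K ?UV W X (\<lambda>z w. G (tens K W ?UV w z))"] ballI)
    show "tensor_lift K ?UV W X (\<lambda>z w. G (tens K W ?UV w z)) \<in> Lin (tensor K ?UV W) X"
      by (rule tensor_lift_linear[OF UV W X b])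
    show "tensor_lift K ?UV W X (\<lambda>z w. G (tens K W ?UV w z)) (tens K ?UV W (tens K U V u v) w) = \<beta> u v w"
      if "u \<in> carrier U" "v \<in> carrier V" "w \<in> carrier W" for u v w
      using tensor_lift_tens[OF UV W X b] that U V by (simp add: G(2))
  qed
qed

section \<open>Nested Sweedler sums\<close>

text \<open>
  Nested Sweedler sums are again multilinear. The following lemmas provide this for a sum that
  depends linearly on parameters, and for a sum over the coproduct of a variable argument.
\<close>

lemma ssum_param_linear:
  assumes C: "comult_module C" and X: "module K X" and c: "c \<in> carrier C"
    and "\<And>x y. x \<in> carrier C \<Longrightarrow> y \<in> carrier C \<Longrightarrow> (\<lambda>v. \<beta> v x y) \<in> Lin V X"
  shows "(\<lambda>v. ssum C X (\<beta> v) c) \<in> Lin V X"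
proof (rule linearI)
  note * = linear_closed[OF assms(4)] linear_add[OF assms(4)] linear_smult[OF assms(4)]
  show "ssum C X (\<beta> v) c \<in> carrier X" if "v \<in> carrier V" for v
    using assms * that by simp
  show "ssum C X (\<beta> (v \<oplus>\<^bsub>V\<^esub> w)) c = ssum C X (\<beta> v) c \<oplus>\<^bsub>X\<^esub> ssum C X (\<beta> w) c"
    if "v \<in> carrier V" "w \<in> carrier V" for v w
    using assms * that by (subst ssum_add[symmetric]) (auto intro!: ssum_cong)
  show "ssum C X (\<beta> (a \<odot>\<^bsub>V\<^esub> v)) c = a \<odot>\<^bsub>X\<^esub> ssum C X (\<beta> v) c"
    if "a \<in> carrier K" "v \<in> carrier V" for a v
    using assms * that by (subst ssum_smult[symmetric]) (auto intro!: ssum_cong)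
qed

lemma ssum_param_bilinear:
  assumes "comult_module C" "module K X" "c \<in> carrier C"
    and "\<And>x y. x \<in> carrier C \<Longrightarrow> y \<in> carrier C \<Longrightarrow> bilinear V W X (\<lambda>v w. \<beta> v w x y)"
  shows "bilinear V W X (\<lambda>v w. ssum C X (\<beta> v w) c)"
  unfolding bilinear_iff_linear
  using bilinear_linear_left[OF assms(4)] bilinear_linear_right[OF assms(4)]
  by (intro conjI ballI ssum_param_linear[OF assms(1-3)]) auto

lemma ssum_left_bilinear:
  assumes "comult_module C" "module K X" "trilinear C C W X \<beta>"
  shows "bilinear C W X (\<lambda>c w. ssum C X (\<lambda>x y. \<beta> x y w) c)"
proof -
  have "(\<lambda>w. \<beta> x y w) \<in> Lin W X" if "x \<in> carrier C" "y \<in> carrier C" for x y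
    by (rule bilinear_linear_right[OF trilinear_bilinear_right[OF assms(3) that(1)] that(2)])
  moreover have "bilinear C C X (\<lambda>x y. \<beta> x y w)" if "w \<in> carrier W" for w
    using assms(3) that by (simp add: trilinear_def)
  ultimately show ?thesis
    by - (rule bilinear_iff_linear[THEN iffD2],
        intro conjI ballI ssum_param_linear[OF assms(1,2)] ssum_arg_linear[OF assms(1,2)], auto)
qed

lemma ssum_right_bilinear:
  assumes "comult_module C" "module K X" "trilinear V C C X \<beta>"
  shows "bilinear V C X (\<lambda>v. ssum C X (\<beta> v))"
proof -
  have "(\<lambda>v. \<beta> v x y) \<in> Lin V X" if "x \<in> carrier C" "y \<in> carrier C" for x y
    by (rule bilinear_linear_left[OF trilinear_bilinear_left[OF assms(3) that(2)] that(1)])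
  moreover have "bilinear C C X (\<beta> v)" if "v \<in> carrier V" for v
    using assms(3) that by (simp add: trilinear_def)
  ultimately show ?thesis
    by - (rule bilinear_iff_linear[THEN iffD2],
        intro conjI ballI ssum_param_linear[OF assms(1,2)] ssum_arg_linear[OF assms(1,2)], auto)
qed

lemma tens_comult:
  assumes C: "comult_module C" and x: "x \<in> carrier C" and y: "y \<in> carrier C"
  shows "tens K C (tensor K C C) x (comult C y) =
    ssum C (tensor K C (tensor K C C)) (\<lambda>y1 y2. tens K C (tensor K C C) x (tens K C C y1 y2)) y"
  unfolding comult_eq_ssum[OF C y]
  using x y comult_module_module[OF C]
  by (intro ssum_linear[OF C, where X = "tensor K C C"] bilinear_linear_right[OF bilinear_tens]) auto

lemma sweedler_sweedler_left:
  assumes C: "comult_module C" and X: "module K X" and c: "c \<in> carrier C" and t: "trilinear C C C X \<beta>"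
  shows "sweedler K C X (\<lambda>x y. sweedler K C X (\<lambda>x1 x2. \<beta> x1 x2 y) x) c =
    ssum C X (\<lambda>x y. ssum C X (\<lambda>x1 x2. \<beta> x1 x2 y) x) c"
proof -
  have *: "sweedler K C X (\<lambda>x1 x2. \<beta> x1 x2 y) x = ssum C X (\<lambda>x1 x2. \<beta> x1 x2 y) x"
    if "x \<in> carrier C" "y \<in> carrier C" for x y
    by (rule sweedler_eq_ssum) (use assms that in \<open>auto simp: trilinear_def\<close>)
  have "sweedler K C X (\<lambda>x y. sweedler K C X (\<lambda>x1 x2. \<beta> x1 x2 y) x) c =
    sweedler K C X (\<lambda>x y. ssum C X (\<lambda>x1 x2. \<beta> x1 x2 y) x) c"
    unfolding sweedler_def[of K C X _ c] by (subst tensor_lift_cong[OF *]) auto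
  also have "\<dots> = ssum C X (\<lambda>x y. ssum C X (\<lambda>x1 x2. \<beta> x1 x2 y) x) c"
    by (rule sweedler_eq_ssum[OF C X c ssum_left_bilinear[OF C X t]])
  finally show ?thesis .
qed

lemma sweedler_cong:
  "(\<And>v w. v \<in> carrier C \<Longrightarrow> w \<in> carrier C \<Longrightarrow> \<beta> v w = \<gamma> v w) \<Longrightarrow>
    sweedler K C X \<beta> c = sweedler K C X \<gamma> c"
  unfolding sweedler_def by (subst tensor_lift_cong) auto

section \<open>Coassociativity and counit in Sweedler form\<close>

lemma ground_module_simps [simp]:
  "carrier (ground_module K) = carrier K" "add (ground_module K) = add K"
  "zero (ground_module K) = zero K" "smult (ground_module K) = mult K"
  by (simp_all add: ground_module_def)

lemma ground_module_module [simp]: "module K (ground_module K)"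
proof (rule moduleI)
  show "abelian_group (ground_module K)"
    by (rule abelian_groupI) (auto simp: a_ac intro: bexI[of _ "\<ominus> x" for x] l_neg)
qed (auto simp: is_cring l_distr r_distr m_assoc)

lemma scalar_bilinear:
  assumes "module K V" "f \<in> Lin C (ground_module K)" "g \<in> Lin C V"
  shows "bilinear C C V (\<lambda>x y. f x \<odot>\<^bsub>V\<^esub> g y)"
  by (intro bilinearI)
     (use assms linear_closed[OF assms(2)] linear_closed[OF assms(3)] linear_add[OF assms(2)]
        linear_add[OF assms(3)] linear_smult[OF assms(2)] linear_smult[OF assms(3)]
       in \<open>auto simp: module_distr module_distr_left module_smult_smult module_smult_comm[of V]\<close>)

context
  fixes C :: "('k, 'c, 'y) coalgebra_scheme"
  assumes C: "coalgebra K C"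
begin

lemma counit_linear: "counit C \<in> Lin C (ground_module K)"
  using C by (simp add: coalgebra_def coalgebra_axioms_def)

lemma counit_closed: "c \<in> carrier C \<Longrightarrow> counit C c \<in> carrier K"
  using linear_closed[OF counit_linear] by simp

text \<open>
  The coassociativity axiom is the case of the universal trilinear map; the general case results by
  applying the linear map on the threefold tensor product that \<open>\<beta>\<close> induces.
\<close>

lemma ssum_coassoc:
  assumes X: "module K X" and c: "c \<in> carrier C" and t: "trilinear C C C X \<beta>"
  shows "ssum C X (\<lambda>x y. ssum C X (\<lambda>x1 x2. \<beta> x1 x2 y) x) c =
    ssum C X (\<lambda>x y. ssum C X (\<lambda>y1 y2. \<beta> x y1 y2) y) c"
proof -
  note cm = coalgebra_comult_module[OF C]
  note m = comult_module_module[OF cm]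
  let ?CC = "tensor K C C"
  let ?Y = "tensor K C ?CC"
  let ?tt = "\<lambda>x y z. tens K C ?CC x (tens K C C y z)"
  have tt: "trilinear C C C ?Y ?tt" by (rule tens_tens_trilinear[OF m m m])
  have Y: "module K ?Y" using m by simp
  obtain G where G: "G \<in> Lin ?Y X"
    and Gt: "\<And>x y z. x \<in> carrier C \<Longrightarrow> y \<in> carrier C \<Longrightarrow> z \<in> carrier C \<Longrightarrow> G (?tt x y z) = \<beta> x y z"
    using trilinear_lift_right[OF m m m X t] by blast
  have "ssum C ?Y (\<lambda>x y. ssum C ?Y (\<lambda>x1 x2. ?tt x1 x2 y) x) c
      = sweedler K C ?Y (\<lambda>x y. sweedler K C ?Y (\<lambda>x1 x2. ?tt x1 x2 y) x) c"
    by (rule sweedler_sweedler_left[OF cm Y c tt, symmetric])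
  also have "\<dots> = sweedler K C ?Y (\<lambda>x y. tens K C ?CC x (comult C y)) c"
    using C c by (simp add: coalgebra_def coalgebra_axioms_def)
  also have "\<dots> = sweedler K C ?Y (\<lambda>x. ssum C ?Y (?tt x)) c"
    by (rule sweedler_cong[OF tens_comult[OF cm]])
  also have "\<dots> = ssum C ?Y (\<lambda>x y. ssum C ?Y (?tt x) y) c"
    by (rule sweedler_eq_ssum[OF cm Y c ssum_right_bilinear[OF cm Y tt]])
  finally have eq: "ssum C ?Y (\<lambda>x y. ssum C ?Y (\<lambda>x1 x2. ?tt x1 x2 y) x) c =
    ssum C ?Y (\<lambda>x y. ssum C ?Y (?tt x) y) c" .
  have "G (ssum C ?Y (\<lambda>x y. ssum C ?Y (\<lambda>x1 x2. ?tt x1 x2 y) x) c) =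
      ssum C X (\<lambda>x y. G (ssum C ?Y (\<lambda>x1 x2. ?tt x1 x2 y) x)) c"
    using c m cm Y by (intro ssum_linear[OF cm G Y X]) simp_all
  also have "\<dots> = ssum C X (\<lambda>x y. ssum C X (\<lambda>x1 x2. G (?tt x1 x2 y)) x) c"
    using m by (intro ssum_cong[OF cm c] ssum_linear[OF cm G Y X]) simp_all
  also have "\<dots> = ssum C X (\<lambda>x y. ssum C X (\<lambda>x1 x2. \<beta> x1 x2 y) x) c"
    by (intro ssum_cong[OF cm] c Gt) auto
  finally have L: "G (ssum C ?Y (\<lambda>x y. ssum C ?Y (\<lambda>x1 x2. ?tt x1 x2 y) x) c) = \<dots>" .
  have "G (ssum C ?Y (\<lambda>x y. ssum C ?Y (?tt x) y) c) =
      ssum C X (\<lambda>x y. G (ssum C ?Y (?tt x) y)) c"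
    using c m cm Y by (intro ssum_linear[OF cm G Y X]) simp_all
  also have "\<dots> = ssum C X (\<lambda>x y. ssum C X (\<lambda>y1 y2. G (?tt x y1 y2)) y) c"
    using m by (intro ssum_cong[OF cm c] ssum_linear[OF cm G Y X]) simp_all
  also have "\<dots> = ssum C X (\<lambda>x y. ssum C X (\<lambda>y1 y2. \<beta> x y1 y2) y) c"
    by (intro ssum_cong[OF cm] c Gt) auto
  finally show ?thesis using L eq by simp
qed

lemma ssum_counit_left:
  assumes X: "module K X" and f: "f \<in> Lin C X" and c: "c \<in> carrier C"
  shows "ssum C X (\<lambda>x y. counit C x \<odot>\<^bsub>X\<^esub> f y) c = f c"
proof -
  note cm = coalgebra_comult_module[OF C]
  note m = comult_module_module[OF cm]
  have "ssum C C (\<lambda>x y. counit C x \<odot>\<^bsub>C\<^esub> y) c = c"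
    using coalgebra.counit_left[OF C c] 
      sweedler_eq_ssum[OF cm m c scalar_bilinear[OF m counit_linear linear_id]] by simp
  hence "f c = f (ssum C C (\<lambda>x y. counit C x \<odot>\<^bsub>C\<^esub> y) c)" by simp
  also have "\<dots> = ssum C X (\<lambda>x y. f (counit C x \<odot>\<^bsub>C\<^esub> y)) c"
    by (rule ssum_linear[OF cm f m X c]) (simp add: m counit_closed)
  also have "\<dots> = ssum C X (\<lambda>x y. counit C x \<odot>\<^bsub>X\<^esub> f y) c"
    by (rule ssum_cong[OF cm c]) (simp add: linear_smult[OF f] counit_closed)
  finally show ?thesis by simp
qed

lemma ssum_counit_right:
  assumes X: "module K X" and f: "f \<in> Lin C X" and c: "c \<in> carrier C"
  shows "ssum C X (\<lambda>x y. counit C y \<odot>\<^bsub>X\<^esub> f x) c = f c"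
proof -
  note cm = coalgebra_comult_module[OF C]
  note m = comult_module_module[OF cm]
  have "ssum C C (\<lambda>x y. counit C y \<odot>\<^bsub>C\<^esub> x) c = c"
    using coalgebra.counit_right[OF C c] 
      sweedler_eq_ssum[OF cm m c bilinear_flip[OF scalar_bilinear[OF m counit_linear linear_id]]] by simp
  hence "f c = f (ssum C C (\<lambda>x y. counit C y \<odot>\<^bsub>C\<^esub> x) c)" by simp
  also have "\<dots> = ssum C X (\<lambda>x y. f (counit C y \<odot>\<^bsub>C\<^esub> x)) c"
    by (rule ssum_linear[OF cm f m X c]) (simp add: m counit_closed)
  also have "\<dots> = ssum C X (\<lambda>x y. counit C y \<odot>\<^bsub>X\<^esub> f x) c"
    by (rule ssum_cong[OF cm c]) (simp add: linear_smult[OF f] counit_closed)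
  finally show ?thesis by simp
qed

end

lemma coalgebraI:
  assumes cm: "comult_module C" and eps: "counit C \<in> Lin C (ground_module K)"
    and coassoc: "\<And>c. c \<in> carrier C \<Longrightarrow>
      ssum C (tensor K C (tensor K C C))
        (\<lambda>x y. ssum C (tensor K C (tensor K C C)) (\<lambda>x1 x2. tens K C (tensor K C C) x1 (tens K C C x2 y)) x) c =
      ssum C (tensor K C (tensor K C C))
        (\<lambda>x y. ssum C (tensor K C (tensor K C C)) (\<lambda>y1 y2. tens K C (tensor K C C) x (tens K C C y1 y2)) y) c"
    and left: "\<And>c. c \<in> carrier C \<Longrightarrow> ssum C C (\<lambda>x y. counit C x \<odot>\<^bsub>C\<^esub> y) c = c"
    and right: "\<And>c. c \<in> carrier C \<Longrightarrow> ssum C C (\<lambda>x y. counit C y \<odot>\<^bsub>C\<^esub> x) c = c"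
  shows "coalgebra K C"
proof -
  note m = comult_module_module[OF cm]
  let ?CC = "tensor K C C"
  let ?Y = "tensor K C ?CC"
  let ?tt = "\<lambda>x y z. tens K C ?CC x (tens K C C y z)"
  have tt: "trilinear C C C ?Y ?tt" by (rule tens_tens_trilinear[OF m m m])
  have Y: "module K ?Y" using m by simp
  show ?thesis
  proof (intro coalgebra.intro coalgebra_axioms.intro m eps)
    show "comult C \<in> Lin C ?CC" using cm by (simp add: comult_module_def)
    fix c assume c: "c \<in> carrier C"
    have "sweedler K C ?Y (\<lambda>x y. tens K C ?CC x (comult C y)) c = sweedler K C ?Y (\<lambda>x. ssum C ?Y (?tt x)) c"
      by (rule sweedler_cong[OF tens_comult[OF cm]])
    also have "\<dots> = ssum C ?Y (\<lambda>x y. ssum C ?Y (?tt x) y) c"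
      by (rule sweedler_eq_ssum[OF cm Y c ssum_right_bilinear[OF cm Y tt]])
    finally show "sweedler K C ?Y (\<lambda>x y. sweedler K C ?Y (\<lambda>x1 x2. ?tt x1 x2 y) x) c =
      sweedler K C ?Y (\<lambda>x y. tens K C ?CC x (comult C y)) c"
      using sweedler_sweedler_left[OF cm Y c tt] coassoc[OF c] by simp
    show "sweedler K C C (\<lambda>x y. counit C x \<odot>\<^bsub>C\<^esub> y) c = c"
      using left[OF c] sweedler_eq_ssum[OF cm m c scalar_bilinear[OF m eps linear_id]] by simp
    show "sweedler K C C (\<lambda>x y. counit C y \<odot>\<^bsub>C\<^esub> x) c = c"
      using right[OF c] sweedler_eq_ssum[OF cm m c bilinear_flip[OF scalar_bilinear[OF m eps linear_id]]]
      by simp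
  qed
qed

section \<open>Coalgebra maps\<close>

lemma
  assumes "module K V" "module K W" "module K V'" "module K W'" "f \<in> Lin V V'" "g \<in> Lin W W'"
  shows tensor_map_linear: "tensor_map K V W V' W' f g \<in> Lin (tensor K V W) (tensor K V' W')"
    and tensor_map_tens: "v \<in> carrier V \<Longrightarrow> w \<in> carrier W \<Longrightarrow>
      tensor_map K V W V' W' f g (tens K V W v w) = tens K V' W' (f v) (g w)"
proof -
  have "bilinear V W (tensor K V' W') (\<lambda>v w. tens K V' W' (f v) (g w))"
    by (rule bilinear_comp[OF bilinear_tens]) (use assms in auto)
  note b = tensor_lift_linear[OF assms(1,2) _ this] tensor_lift_tens[OF assms(1,2) _ this]
  show "tensor_map K V W V' W' f g \<in> Lin (tensor K V W) (tensor K V' W')"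
    "v \<in> carrier V \<Longrightarrow> w \<in> carrier W \<Longrightarrow>
      tensor_map K V W V' W' f g (tens K V W v w) = tens K V' W' (f v) (g w)"
    unfolding tensor_map_def using assms(3,4) by (simp_all add: b)
qed

lemma tensor_map_comult:
  assumes C: "comult_module C" and D: "module K D" and h: "h \<in> Lin C D" and c: "c \<in> carrier C"
  shows "tensor_map K C C D D h h (comult C c) = ssum C (tensor K D D) (\<lambda>x y. tens K D D (h x) (h y)) c"
proof -
  note m = comult_module_module[OF C]
  have "tensor_map K C C D D h h (comult C c) =
    ssum C (tensor K D D) (\<lambda>x y. tensor_map K C C D D h h (tens K C C x y)) c"
    unfolding comult_eq_ssum[OF C c]
    by (rule ssum_linear[OF C tensor_map_linear]) (use m D h c in auto)
  also have "\<dots> = ssum C (tensor K D D) (\<lambda>x y. tens K D D (h x) (h y)) c"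
    by (rule ssum_cong[OF C c tensor_map_tens[OF m m D D h h]])
  finally show ?thesis .
qed

lemma coalgebra_homsI:
  assumes "comult_module C" "module K D" "h \<in> Lin C D"
    and "\<And>c. c \<in> carrier C \<Longrightarrow>
      comult D (h c) = ssum C (tensor K D D) (\<lambda>x y. tens K D D (h x) (h y)) c"
    and "\<And>c. c \<in> carrier C \<Longrightarrow> counit D (h c) = counit C c"
  shows "h \<in> coalgebra_homs K C D"
  using assms by (simp add: coalgebra_homs_def tensor_map_comult)

lemma ssum_eq_tensor_lift:
  assumes C: "comult_module C" and X: "module K X" and \<beta>: "bilinear C C X \<beta>" and c: "c \<in> carrier C"
  shows "ssum C X \<beta> c = tensor_lift K C C X \<beta> (comult C c)"
  using sweedler_eq_ssum[OF C X c \<beta>] by (simp add: sweedler_def)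

text \<open>
  A decomposition of \<open>\<Delta>(d)\<close> by means of Sweedler components of another element \<open>c\<close>, possibly of a
  different coalgebra, may be used in place of the fixed one.
\<close>

lemma ssum_of_comult:
  assumes C: "comult_module C" and D: "comult_module D" and X: "module K X" and \<beta>: "bilinear D D X \<beta>"
    and c: "c \<in> carrier C" and d: "d \<in> carrier D"
    and uv: "\<And>x y. x \<in> carrier C \<Longrightarrow> y \<in> carrier C \<Longrightarrow> u x y \<in> carrier D \<and> v x y \<in> carrier D"
    and eq: "comult D d = ssum C (tensor K D D) (\<lambda>x y. tens K D D (u x y) (v x y)) c"
  shows "ssum D X \<beta> d = ssum C X (\<lambda>x y. \<beta> (u x y) (v x y)) c"
proof -
  note m = comult_module_module[OF D]
  have "ssum D X \<beta> d = ssum C X (\<lambda>x y. tensor_lift K D D X \<beta> (tens K D D (u x y) (v x y))) c"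
    unfolding ssum_eq_tensor_lift[OF D X \<beta> d] eq
    by (rule ssum_linear[OF C tensor_lift_linear]) (use m X \<beta> c uv in auto)
  also have "\<dots> = ssum C X (\<lambda>x y. \<beta> (u x y) (v x y)) c"
    using uv by (intro ssum_cong[OF C c] tensor_lift_tens[OF m m X \<beta>]) auto
  finally show ?thesis .
qed

lemma ssum_hom:
  assumes C: "comult_module C" and D: "comult_module D" and X: "module K X" and \<beta>: "bilinear D D X \<beta>"
    and h: "h \<in> coalgebra_homs K C D" and c: "c \<in> carrier C"
  shows "ssum D X \<beta> (h c) = ssum C X (\<lambda>x y. \<beta> (h x) (h y)) c"
proof -
  have l: "h \<in> Lin C D" using h by (simp add: coalgebra_homs_def)
  show ?thesis
    by (rule ssum_of_comult[OF C D X \<beta> c])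
       (use h c linear_closed[OF l] tensor_map_comult[OF C comult_module_module[OF D] l] in
         \<open>auto simp: coalgebra_homs_def\<close>)
qed

section \<open>Records over the same module\<close>

text \<open>
  The coalgebras constructed below inherit their linear structure from a given module. Linear maps,
  tensor products and sums only see the four fields compared here, which lets all of them be
  rewritten to the given module.
\<close>

definition module_eq where
  "module_eq V V' \<longleftrightarrow> carrier V = carrier V' \<and> zero V = zero V' \<and> add V = add V' \<and> smult V = smult V'"

lemma module_eq_module:
  assumes "module_eq V V'"
  shows "module K V \<longleftrightarrow> module K V'"
proof -
  have *: "module K W'" if W: "module K W" and eq: "module_eq W W'"
    for W :: "('k, 'v, 'y) module_scheme" and W' :: "('k, 'v, 'z) module_scheme"
  proof -
    have eq: "carrier W' = carrier W" "zero W' = zero W" "add W' = add W" "smult W' = smult W"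
      using eq by (simp_all add: module_eq_def)
    interpret W: abelian_group W by (rule module_abelian_group[OF W])
    have "abelian_group W'"
    proof (rule abelian_groupI)
      fix x assume "x \<in> carrier W'"
      thus "\<exists>y\<in>carrier W'. y \<oplus>\<^bsub>W'\<^esub> x = \<zero>\<^bsub>W'\<^esub>"
        unfolding eq by (intro bexI[of _ "\<ominus>\<^bsub>W\<^esub> x"] W.l_neg W.a_inv_closed)
    qed (use W in \<open>simp_all add: eq module_ac\<close>)
    thus ?thesis
      by (rule moduleI[OF is_cring])
         (use W in \<open>simp_all add: eq module_distr module_distr_left module_smult_smult\<close>)
  qed
  show ?thesis using *[of V V'] *[of V' V] assms by (auto simp: module_eq_def)
qed

lemma module_eq_tensor:
  assumes "module_eq V V'" "module_eq W W'"
  shows "tensor K V W = tensor K V' W'" "tens K V W = tens K V' W'"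
  using assms by (simp_all add: module_eq_def fun_eq_iff tensor_def tens_def tensor_null_def bilinear_relations_def)

lemma module_eq_linear_maps:
  assumes "module_eq V V'" "module_eq W W'"
  shows "Lin V W = Lin V' W'"
  using assms by (simp add: module_eq_def linear_maps_def)

lemma module_eq_bilinear:
  assumes "module_eq V V'" "module_eq W W'" "module_eq X X'"
  shows "bilinear V W X = bilinear V' W' X'"
  using assms by (simp add: module_eq_def bilinear_def fun_eq_iff)

lemma module_eq_refl [simp]: "module_eq V V"
  by (simp add: module_eq_def)

lemma module_eq_lsum:
  assumes "module_eq X X'"
  shows "lsum X F ps = lsum X' F ps"
  using assms by (induction ps) (simp_all add: module_eq_def)

lemma module_eq_tensor_lift:
  assumes "module_eq V V'" "module_eq W W'" "module_eq X X'"
  shows "tensor_lift K V W X \<beta> = tensor_lift K V' W' X' \<beta>"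
  using assms(1,2)
  unfolding tensor_lift_def module_eq_tensor[OF assms(1,2)] module_eq_linear_maps[OF module_eq_refl assms(3)]
  by (simp add: module_eq_def)

lemma module_eq_simps:
  assumes "module_eq V' V"
  shows "carrier V' = carrier V" "zero V' = zero V" "add V' = add V" "smult V' = smult V"
    "module K V' = module K V" "tensor K V' W = tensor K V W" "tensor K W V' = tensor K W V"
    "tens K V' W = tens K V W" "tens K W V' = tens K W V" "Lin V' W = Lin V W" "Lin W V' = Lin W V"
    "bilinear V' W X = bilinear V W X" "bilinear W V' X = bilinear W V X" "bilinear W X V' = bilinear W X V"
    "tensor_lift K V' W X \<beta> = tensor_lift K V W X \<beta>"
    "tensor_lift K W V' X \<beta>' = tensor_lift K W V X \<beta>'"
    "tensor_lift K W X V' \<gamma> = tensor_lift K W X V \<gamma>"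
    "ssum C V' \<delta> c = ssum C V \<delta> c"
  using assms module_eq_module[OF assms] module_eq_lsum[OF assms]
    module_eq_tensor[OF assms module_eq_refl] module_eq_tensor[OF module_eq_refl assms]
    module_eq_linear_maps[OF assms module_eq_refl] module_eq_linear_maps[OF module_eq_refl assms]
    module_eq_bilinear[OF assms module_eq_refl module_eq_refl]
    module_eq_bilinear[OF module_eq_refl assms module_eq_refl]
    module_eq_bilinear[OF module_eq_refl module_eq_refl assms]
    module_eq_tensor_lift[OF assms module_eq_refl module_eq_refl]
    module_eq_tensor_lift[OF module_eq_refl assms module_eq_refl]
    module_eq_tensor_lift[OF module_eq_refl module_eq_refl assms]
  unfolding ssum_def by (simp_all add: module_eq_def fun_eq_iff)

section \<open>The co-opposite coalgebra\<close>

definition coopposite where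
  "coopposite C = C\<lparr>comult := ssum C (tensor K C C) (\<lambda>x y. tens K C C y x)\<rparr>"

lemma module_eq_coopposite: "module_eq (coopposite C) C"
  by (simp add: module_eq_def coopposite_def)

lemma comult_coopposite: "comult (coopposite C) = ssum C (tensor K C C) (\<lambda>x y. tens K C C y x)"
  by (simp add: coopposite_def)

lemma counit_coopposite [simp]: "counit (coopposite C) = counit C"
  by (simp add: coopposite_def)

lemmas coopposite_simps [simp] = module_eq_simps[OF module_eq_coopposite]

lemma coopposite_comult_module:
  assumes "comult_module C"
  shows "comult_module (coopposite C)"
proof -
  note m = comult_module_module[OF assms]
  have "ssum C (tensor K C C) (\<lambda>x y. tens K C C y x) \<in> Lin C (tensor K C C)"
    by (rule ssum_arg_linear[OF assms _ bilinear_flip[OF bilinear_tens]]) (use m in auto)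
  thus ?thesis using m by (simp add: comult_module_def comult_coopposite)
qed

lemma ssum_coopposite:
  assumes "comult_module C" "module K X" "bilinear C C X \<beta>" "c \<in> carrier C"
  shows "ssum (coopposite C) X \<beta> c = ssum C X (\<lambda>x y. \<beta> y x) c"
  by (rule ssum_of_comult[OF assms(1) coopposite_comult_module[OF assms(1)] assms(2)])
     (use assms in \<open>simp_all add: comult_coopposite\<close>)

text \<open>
  Reversing the three tensor factors turns one side of coassociativity for \<open>C\<close> into the other
  side for the flipped comultiplication.
\<close>

lemma coopposite_coalgebra:
  assumes C: "coalgebra K C"
  shows "coalgebra K (coopposite C)"
proof (rule coalgebraI)
  note cm = coalgebra_comult_module[OF C]
  note m = comult_module_module[OF cm]
  let ?C = "coopposite C"
  let ?Y = "tensor K C (tensor K C C)"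
  let ?t = "\<lambda>x y z. tens K C (tensor K C C) x (tens K C C y z)"
  have Y: "module K ?Y" using m by simp
  have t: "trilinear C C C ?Y ?t" by (rule tens_tens_trilinear[OF m m m])
  have t': "trilinear C C C ?Y (\<lambda>x y z. ?t z y x)"
    using t bilinear_flip unfolding trilinear_def by blast
  show "comult_module ?C" by (rule coopposite_comult_module[OF cm])
  show "counit ?C \<in> Lin ?C (ground_module K)" using counit_linear[OF C] by simp
  fix c assume "c \<in> carrier ?C"
  hence c: "c \<in> carrier C" by simp
  have "ssum ?C ?Y (\<lambda>x y. ssum ?C ?Y (\<lambda>x1 x2. ?t x1 x2 y) x) c =
      ssum ?C ?Y (\<lambda>x y. ssum C ?Y (\<lambda>x1 x2. ?t x2 x1 y) x) c"
    using c by (intro ssum_cong[OF coopposite_comult_module[OF cm]] ssum_coopposite[OF cm Y]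
        trilinear_bilinear_left[OF t]) auto
  also have "\<dots> = ssum C ?Y (\<lambda>x y. ssum C ?Y (\<lambda>x1 x2. ?t x2 x1 x) y) c"
    using bilinear_flip[OF ssum_right_bilinear[OF cm Y t']] by (intro ssum_coopposite[OF cm Y] c)
  also have "\<dots> = ssum C ?Y (\<lambda>x y. ssum C ?Y (\<lambda>x1 x2. ?t y x2 x1) x) c"
    by (rule ssum_coassoc[OF C Y c t', symmetric])
  also have "\<dots> = ssum ?C ?Y (\<lambda>x y. ssum C ?Y (\<lambda>y1 y2. ?t x y2 y1) y) c"
    using bilinear_flip[OF ssum_left_bilinear[OF cm Y t']] by (intro ssum_coopposite[OF cm Y, symmetric] c)
  also have "\<dots> = ssum ?C ?Y (\<lambda>x y. ssum ?C ?Y (\<lambda>y1 y2. ?t x y1 y2) y) c"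
    using c by (intro ssum_cong[OF coopposite_comult_module[OF cm]] ssum_coopposite[OF cm Y, symmetric]
        trilinear_bilinear_right[OF t]) auto
  finally show "ssum ?C (tensor K ?C (tensor K ?C ?C))
        (\<lambda>x y. ssum ?C (tensor K ?C (tensor K ?C ?C))
          (\<lambda>x1 x2. tens K ?C (tensor K ?C ?C) x1 (tens K ?C ?C x2 y)) x) c =
      ssum ?C (tensor K ?C (tensor K ?C ?C))
        (\<lambda>x y. ssum ?C (tensor K ?C (tensor K ?C ?C))
          (\<lambda>y1 y2. tens K ?C (tensor K ?C ?C) x (tens K ?C ?C y1 y2)) y) c"
    by simp
  note b = scalar_bilinear[OF m counit_linear[OF C] linear_id]
  have "ssum ?C C (\<lambda>x y. counit C x \<odot>\<^bsub>C\<^esub> y) c = c"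
    using ssum_coopposite[OF cm m b c] ssum_counit_right[OF C m linear_id c] by simp
  moreover have "ssum ?C C (\<lambda>x y. counit C y \<odot>\<^bsub>C\<^esub> x) c = c"
    using ssum_coopposite[OF cm m bilinear_flip[OF b] c] ssum_counit_left[OF C m linear_id c] by simp
  ultimately show "ssum ?C ?C (\<lambda>x y. counit ?C x \<odot>\<^bsub>?C\<^esub> y) c = c"
    "ssum ?C ?C (\<lambda>x y. counit ?C y \<odot>\<^bsub>?C\<^esub> x) c = c"
    by simp_all
qed

section \<open>Tensor products of coalgebras\<close>

lemma ssum_param_trilinear:
  assumes "comult_module C" "module K X" "c \<in> carrier C"
    and "\<And>x y. x \<in> carrier C \<Longrightarrow> y \<in> carrier C \<Longrightarrow> trilinear U V W X (\<lambda>u v w. \<beta> u v w x y)"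
  shows "trilinear U V W X (\<lambda>u v w. ssum C X (\<beta> u v w) c)"
proof (rule trilinearI)
  show "bilinear U V X (\<lambda>u v. ssum C X (\<beta> u v w) c)" if "w \<in> carrier W" for w
    by (rule ssum_param_bilinear[OF assms(1-3) trilinear_bilinear_left[OF assms(4) that]])
  show "bilinear V W X (\<lambda>v w. ssum C X (\<beta> u v w) c)" if "u \<in> carrier U" for u
    by (rule ssum_param_bilinear[OF assms(1-3) trilinear_bilinear_right[OF assms(4) that]])
qed

lemma tens_linear_left: "module K V \<Longrightarrow> module K W \<Longrightarrow> w \<in> carrier W \<Longrightarrow>
    (\<lambda>v. tens K V W v w) \<in> Lin V (tensor K V W)"
  by (rule bilinear_linear_left[OF bilinear_tens])

lemma tens_linear_right: "module K V \<Longrightarrow> module K W \<Longrightarrow> v \<in> carrier V \<Longrightarrow>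
    tens K V W v \<in> Lin W (tensor K V W)"
  by (rule bilinear_linear_right[OF bilinear_tens])

definition tensor_coalgebra ::
  "('k, 'c, 'y) coalgebra_scheme \<Rightarrow> ('k, 'd, 'z) coalgebra_scheme
    \<Rightarrow> ('k, ('c \<times> 'd \<Rightarrow> 'k) set) coalgebra" where
  "tensor_coalgebra C D = (let CD = tensor K C D; Y = tensor K CD CD in
    \<lparr>carrier = carrier CD, mult = undefined, one = undefined, zero = zero CD, add = add CD,
     smult = smult CD,
     comult = tensor_lift K C D Y (\<lambda>c d. ssum C Y (\<lambda>c1 c2. ssum D Y (\<lambda>d1 d2.
       tens K CD CD (tens K C D c1 d1) (tens K C D c2 d2)) d) c),
     counit = tensor_lift K C D (ground_module K) (\<lambda>c d. counit C c \<otimes> counit D d)\<rparr>)"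

lemma module_eq_tensor_coalgebra: "module_eq (tensor_coalgebra C D) (tensor K C D)"
  by (simp add: module_eq_def tensor_coalgebra_def Let_def)

lemmas tensor_coalgebra_simps [simp] = module_eq_simps[OF module_eq_tensor_coalgebra]

context
  fixes C :: "('k, 'c, 'y) coalgebra_scheme" and D :: "('k, 'd, 'z) coalgebra_scheme"
  assumes C: "comult_module C" and D: "comult_module D"
begin

lemma tensor_ssum_bilinear:
  assumes X: "module K X" and \<beta>: "bilinear (tensor K C D) (tensor K C D) X \<beta>"
  shows "bilinear C D X (\<lambda>c d. ssum C X (\<lambda>c1 c2. ssum D X (\<lambda>d1 d2.
    \<beta> (tens K C D c1 d1) (tens K C D c2 d2)) d) c)"
proof (rule bilinear_iff_linear[THEN iffD2], intro conjI ballI)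
  note m = comult_module_module[OF C] comult_module_module[OF D]
  fix d assume d: "d \<in> carrier D"
  show "(\<lambda>c. ssum C X (\<lambda>c1 c2. ssum D X (\<lambda>d1 d2. \<beta> (tens K C D c1 d1) (tens K C D c2 d2)) d) c) \<in> Lin C X"
    by (intro ssum_arg_linear[OF C X] ssum_param_bilinear[OF D X d] bilinear_comp[OF \<beta>]
        tens_linear_left m)
next
  note m = comult_module_module[OF C] comult_module_module[OF D]
  fix c assume c: "c \<in> carrier C"
  show "(\<lambda>d. ssum C X (\<lambda>c1 c2. ssum D X (\<lambda>d1 d2. \<beta> (tens K C D c1 d1) (tens K C D c2 d2)) d) c) \<in> Lin D X"
    by (intro ssum_param_linear[OF C X c] ssum_arg_linear[OF D X] bilinear_comp[OF \<beta>]
        tens_linear_right m)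
qed

lemma tensor_coalgebra_comult_module: "comult_module (tensor_coalgebra C D)"
proof -
  note m = comult_module_module[OF C] comult_module_module[OF D]
  let ?CD = "tensor K C D"
  have "comult (tensor_coalgebra C D) \<in> Lin ?CD (tensor K ?CD ?CD)"
    unfolding tensor_coalgebra_def Let_def coalgebra.simps
    by (intro tensor_lift_linear tensor_ssum_bilinear bilinear_tens tensor_module m)
  thus ?thesis using m by (simp add: comult_module_def)
qed

lemma comult_tensor_coalgebra:
  assumes "c \<in> carrier C" "d \<in> carrier D"
  shows "comult (tensor_coalgebra C D) (tens K C D c d) =
    (let CD = tensor K C D; Y = tensor K CD CD in ssum C Y (\<lambda>c1 c2. ssum D Y (\<lambda>d1 d2.
       tens K CD CD (tens K C D c1 d1) (tens K C D c2 d2)) d) c)"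
proof -
  note m = comult_module_module[OF C] comult_module_module[OF D]
  show ?thesis
    unfolding tensor_coalgebra_def Let_def coalgebra.simps
    by (intro tensor_lift_tens tensor_ssum_bilinear bilinear_tens tensor_module m assms)
qed

text \<open>
  \<open>\<Delta>(c \<otimes> d) = (c\<^sub>1 \<otimes> d\<^sub>1) \<otimes> (c\<^sub>2 \<otimes> d\<^sub>2)\<close> for an arbitrary bilinear map in place of the outer tensor
  product.
\<close>

lemma ssum_tensor_coalgebra:
  assumes X: "module K X" and \<beta>: "bilinear (tensor K C D) (tensor K C D) X \<beta>"
    and c: "c \<in> carrier C" and d: "d \<in> carrier D"
  shows "ssum (tensor_coalgebra C D) X \<beta> (tens K C D c d) =
    ssum C X (\<lambda>c1 c2. ssum D X (\<lambda>d1 d2. \<beta> (tens K C D c1 d1) (tens K C D c2 d2)) d) c"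
proof -
  note m = comult_module_module[OF C] comult_module_module[OF D]
  let ?CD = "tensor K C D"
  let ?Y = "tensor K ?CD ?CD"
  have CD: "module K ?CD" and Y: "module K ?Y" using m by simp_all
  let ?B = "tensor_lift K ?CD ?CD X \<beta>"
  have B: "?B \<in> Lin ?Y X" by (rule tensor_lift_linear[OF CD CD X \<beta>])
  have "ssum (tensor_coalgebra C D) X \<beta> (tens K C D c d) =
      ?B (comult (tensor_coalgebra C D) (tens K C D c d))"
    using ssum_eq_tensor_lift[OF tensor_coalgebra_comult_module X, of \<beta>] \<beta> m c d by simp
  also have "\<dots> = ssum C X (\<lambda>c1 c2. ?B (ssum D ?Y (\<lambda>d1 d2.
      tens K ?CD ?CD (tens K C D c1 d1) (tens K C D c2 d2)) d)) c"
    unfolding comult_tensor_coalgebra[OF c d] Let_def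
    using m d D by (intro ssum_linear[OF C B Y X c]) simp
  also have "\<dots> = ssum C X (\<lambda>c1 c2. ssum D X (\<lambda>d1 d2.
      ?B (tens K ?CD ?CD (tens K C D c1 d1) (tens K C D c2 d2))) d) c"
    using m by (intro ssum_cong[OF C c] ssum_linear[OF D B Y X d]) simp
  also have "\<dots> = ssum C X (\<lambda>c1 c2. ssum D X (\<lambda>d1 d2. \<beta> (tens K C D c1 d1) (tens K C D c2 d2)) d) c"
    using m by (intro ssum_cong[OF C c] ssum_cong[OF D d] tensor_lift_tens[OF CD CD X \<beta>]) simp_all
  finally show ?thesis .
qed

end

text \<open>
  Once the sums over the components of \<open>c\<close> are separated from those over the components of \<open>d\<close>,
  coassociativity of \<open>C\<close> and of \<open>D\<close> apply independently.
\<close>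

lemma tensor_coalgebra_coassoc:
  fixes C :: "('k, 'c, 'y) coalgebra_scheme" and D :: "('k, 'd, 'z) coalgebra_scheme"
  assumes C: "coalgebra K C" and D: "coalgebra K D" and X: "module K X"
    and t: "trilinear (tensor K C D) (tensor K C D) (tensor K C D) X \<tau>"
    and c: "c \<in> carrier C" and d: "d \<in> carrier D"
  shows "ssum (tensor_coalgebra C D) X (\<lambda>x y. ssum (tensor_coalgebra C D) X (\<lambda>x1 x2. \<tau> x1 x2 y) x)
      (tens K C D c d) =
    ssum (tensor_coalgebra C D) X (\<lambda>x y. ssum (tensor_coalgebra C D) X (\<lambda>y1 y2. \<tau> x y1 y2) y)
      (tens K C D c d)"
proof -
  note cC = coalgebra_comult_module[OF C] and cD = coalgebra_comult_module[OF D]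
  note m = comult_module_module[OF cC] comult_module_module[OF cD]
  let ?T = "tensor_coalgebra C D" and ?e = "tens K C D"
  note cT = tensor_coalgebra_comult_module[OF cC cD]
  note tl = tens_linear_left[OF m] and tr = tens_linear_right[OF m]
  have t': "trilinear ?T ?T ?T X \<tau>" using t by (simp add: trilinear_def)
  have cl: "\<tau> (?e x u) (?e y v) (?e z w) \<in> carrier X"
    if "x \<in> carrier C" "y \<in> carrier C" "z \<in> carrier C" "u \<in> carrier D" "v \<in> carrier D" "w \<in> carrier D"
    for x y z u v w
    by (rule trilinear_closed[OF t]) (use that m in auto)
  have "ssum ?T X (\<lambda>x y. ssum ?T X (\<lambda>x1 x2. \<tau> x1 x2 y) x) (?e c d) =
    ssum C X (\<lambda>c1 c2. ssum D X (\<lambda>d1 d2. ssum ?T X (\<lambda>x1 x2. \<tau> x1 x2 (?e c2 d2)) (?e c1 d1)) d) c"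
    using ssum_left_bilinear[OF cT X t'] by (intro ssum_tensor_coalgebra[OF cC cD X _ c d]) simp
  also have "\<dots> = ssum C X (\<lambda>c1 c2. ssum D X (\<lambda>d1 d2. ssum C X (\<lambda>x y. ssum D X (\<lambda>u v.
      \<tau> (?e x u) (?e y v) (?e c2 d2)) d1) c1) d) c"
    using m by (intro ssum_cong[OF cC c] ssum_cong[OF cD d] ssum_tensor_coalgebra[OF cC cD X]
        trilinear_bilinear_left[OF t]) simp_all
  also have "\<dots> = ssum C X (\<lambda>c1 c2. ssum C X (\<lambda>x y. ssum D X (\<lambda>d1 d2. ssum D X (\<lambda>u v.
      \<tau> (?e x u) (?e y v) (?e c2 d2)) d1) d) c1) c"
    using cl by (intro ssum_cong[OF cC c] ssum_swap[OF cD cC X d] ssum_closed[OF cD X]) simp_all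
  also have "\<dots> = ssum C X (\<lambda>c1 c2. ssum C X (\<lambda>x y. ssum D X (\<lambda>d1 d2. ssum D X (\<lambda>u v.
      \<tau> (?e x d1) (?e y u) (?e c2 v)) d2) d) c1) c"
    by (intro ssum_cong[OF cC c] ssum_cong[OF cC] ssum_coassoc[OF D X d] trilinear_comp[OF t] tr)
  also have "\<dots> = ssum C X (\<lambda>c1 c2. ssum C X (\<lambda>x y. ssum D X (\<lambda>d1 d2. ssum D X (\<lambda>u v.
      \<tau> (?e c1 d1) (?e x u) (?e y v)) d2) d) c2) c"
    by (intro ssum_coassoc[OF C X c] ssum_param_trilinear[OF cD X] d trilinear_comp[OF t] tl)
  also have "\<dots> = ssum C X (\<lambda>c1 c2. ssum D X (\<lambda>d1 d2. ssum C X (\<lambda>x y. ssum D X (\<lambda>u v.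
      \<tau> (?e c1 d1) (?e x u) (?e y v)) d2) c2) d) c"
    using cl by (intro ssum_cong[OF cC c] ssum_swap[OF cC cD X _ d] ssum_closed[OF cD X]) simp_all
  also have "\<dots> = ssum C X (\<lambda>c1 c2. ssum D X (\<lambda>d1 d2. ssum ?T X (\<lambda>y1 y2. \<tau> (?e c1 d1) y1 y2) (?e c2 d2)) d) c"
    using m by (intro ssum_cong[OF cC c] ssum_cong[OF cD d] ssum_tensor_coalgebra[OF cC cD X, symmetric]
        trilinear_bilinear_right[OF t]) simp_all
  also have "\<dots> = ssum ?T X (\<lambda>x y. ssum ?T X (\<lambda>y1 y2. \<tau> x y1 y2) y) (?e c d)"
    using ssum_right_bilinear[OF cT X t'] by (intro ssum_tensor_coalgebra[OF cC cD X _ c d, symmetric]) simp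
  finally show ?thesis .
qed

lemma counit_tensor_coalgebra:
  fixes C :: "('k, 'c, 'y) coalgebra_scheme" and D :: "('k, 'd, 'z) coalgebra_scheme"
  assumes C: "coalgebra K C" and D: "coalgebra K D"
  shows "counit (tensor_coalgebra C D) \<in> Lin (tensor K C D) (ground_module K)"
    and "c \<in> carrier C \<Longrightarrow> d \<in> carrier D \<Longrightarrow>
      counit (tensor_coalgebra C D) (tens K C D c d) = counit C c \<otimes> counit D d"
proof -
  note cC = coalgebra_comult_module[OF C] and cD = coalgebra_comult_module[OF D]
  note m = comult_module_module[OF cC] comult_module_module[OF cD]
  note l = linear_add[OF counit_linear[OF C]] linear_add[OF counit_linear[OF D]]
    linear_smult[OF counit_linear[OF C]] linear_smult[OF counit_linear[OF D]]
  have b: "bilinear C D (ground_module K) (\<lambda>c d. counit C c \<otimes> counit D d)"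
    by (rule bilinearI) (auto simp: l counit_closed[OF C] counit_closed[OF D] l_distr r_distr m_ac)
  show "counit (tensor_coalgebra C D) \<in> Lin (tensor K C D) (ground_module K)"
    "c \<in> carrier C \<Longrightarrow> d \<in> carrier D \<Longrightarrow>
      counit (tensor_coalgebra C D) (tens K C D c d) = counit C c \<otimes> counit D d"
    unfolding tensor_coalgebra_def Let_def coalgebra.simps
    by (rule tensor_lift_linear[OF m _ b] tensor_lift_tens[OF m _ b]; simp)+
qed

lemma tensor_coalgebra_coalgebra:
  fixes C :: "('k, 'c, 'y) coalgebra_scheme" and D :: "('k, 'd, 'z) coalgebra_scheme"
  assumes C: "coalgebra K C" and D: "coalgebra K D"
  shows "coalgebra K (tensor_coalgebra C D)"
proof (rule coalgebraI)
  note cC = coalgebra_comult_module[OF C] and cD = coalgebra_comult_module[OF D]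
  note m = comult_module_module[OF cC] comult_module_module[OF cD]
  let ?T = "tensor_coalgebra C D" and ?e = "tens K C D" and ?CD = "tensor K C D"
  note cT = tensor_coalgebra_comult_module[OF cC cD]
  let ?Y = "tensor K ?CD (tensor K ?CD ?CD)"
  let ?t = "\<lambda>x y z. tens K ?CD (tensor K ?CD ?CD) x (tens K ?CD ?CD y z)"
  have CD: "module K ?CD" and Y: "module K ?Y" using m by simp_all
  have t: "trilinear ?CD ?CD ?CD ?Y ?t" by (rule tens_tens_trilinear[OF CD CD CD])
  hence t': "trilinear ?T ?T ?T ?Y ?t" by (simp add: trilinear_def)
  note epsl = counit_tensor_coalgebra(1)[OF C D] and eps = counit_tensor_coalgebra(2)[OF C D]
  show "comult_module ?T" by (rule cT)
  show "counit ?T \<in> Lin ?T (ground_module K)" using epsl by simp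
  fix z assume "z \<in> carrier ?T"
  hence z: "z \<in> carrier ?CD" by simp
  have "ssum ?T ?Y (\<lambda>x y. ssum ?T ?Y (\<lambda>x1 x2. ?t x1 x2 y) x) z =
    ssum ?T ?Y (\<lambda>x y. ssum ?T ?Y (\<lambda>y1 y2. ?t x y1 y2) y) z"
  proof (rule tensor_linear_eqI[OF _ _ m Y _ z])
    show "ssum ?T ?Y (\<lambda>x y. ssum ?T ?Y (\<lambda>x1 x2. ?t x1 x2 y) x) \<in> Lin ?CD ?Y"
      using ssum_arg_linear[OF cT Y ssum_left_bilinear[OF cT Y t']] by simp
    show "ssum ?T ?Y (\<lambda>x y. ssum ?T ?Y (\<lambda>y1 y2. ?t x y1 y2) y) \<in> Lin ?CD ?Y"
      using ssum_arg_linear[OF cT Y ssum_right_bilinear[OF cT Y t']] by simp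
    show "ssum ?T ?Y (\<lambda>x y. ssum ?T ?Y (\<lambda>x1 x2. ?t x1 x2 y) x) (?e c d) =
      ssum ?T ?Y (\<lambda>x y. ssum ?T ?Y (\<lambda>y1 y2. ?t x y1 y2) y) (?e c d)"
      if "c \<in> carrier C" "d \<in> carrier D" for c d
      by (rule tensor_coalgebra_coassoc[OF C D Y t that])
  qed
  thus "ssum ?T (tensor K ?T (tensor K ?T ?T))
        (\<lambda>x y. ssum ?T (tensor K ?T (tensor K ?T ?T))
          (\<lambda>x1 x2. tens K ?T (tensor K ?T ?T) x1 (tens K ?T ?T x2 y)) x) z =
      ssum ?T (tensor K ?T (tensor K ?T ?T))
        (\<lambda>x y. ssum ?T (tensor K ?T (tensor K ?T ?T))
          (\<lambda>y1 y2. tens K ?T (tensor K ?T ?T) x (tens K ?T ?T y1 y2)) y) z"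
    by simp
  have b: "bilinear ?CD ?CD ?CD (\<lambda>x y. counit ?T x \<odot>\<^bsub>?CD\<^esub> y)"
    by (rule scalar_bilinear[OF CD epsl linear_id, simplified])
  have bl: "bilinear ?T ?T ?CD (\<lambda>x y. counit ?T x \<odot>\<^bsub>?CD\<^esub> y)"
    "bilinear ?T ?T ?CD (\<lambda>x y. counit ?T y \<odot>\<^bsub>?CD\<^esub> x)"
    using b bilinear_flip[OF b] by simp_all
  note ec = counit_closed[OF C] counit_closed[OF D]
  have "ssum ?T ?CD (\<lambda>x y. counit ?T x \<odot>\<^bsub>?CD\<^esub> y) z = id z"
  proof (rule tensor_linear_eqI[OF _ linear_id m CD _ z])
    show "ssum ?T ?CD (\<lambda>x y. counit ?T x \<odot>\<^bsub>?CD\<^esub> y) \<in> Lin ?CD ?CD"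
      using ssum_arg_linear[OF cT CD bl(1)] by simp
    fix c d assume c: "c \<in> carrier C" and d: "d \<in> carrier D"
    have "ssum ?T ?CD (\<lambda>x y. counit ?T x \<odot>\<^bsub>?CD\<^esub> y) (?e c d) =
      ssum C ?CD (\<lambda>c1 c2. ssum D ?CD (\<lambda>d1 d2. counit ?T (?e c1 d1) \<odot>\<^bsub>?CD\<^esub> ?e c2 d2) d) c"
      by (rule ssum_tensor_coalgebra[OF cC cD CD b c d])
    also have "\<dots> = ssum C ?CD (\<lambda>c1 c2. ssum D ?CD (\<lambda>d1 d2.
        counit C c1 \<odot>\<^bsub>?CD\<^esub> (counit D d1 \<odot>\<^bsub>?CD\<^esub> ?e c2 d2)) d) c"
      by (intro ssum_cong[OF cC c] ssum_cong[OF cD d]) (simp add: eps m ec module_smult_smult)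
    also have "\<dots> = ssum C ?CD (\<lambda>c1 c2. counit C c1 \<odot>\<^bsub>?CD\<^esub> ssum D ?CD (\<lambda>d1 d2.
        (counit D d1 \<odot>\<^bsub>?CD\<^esub> ?e c2 d2)) d) c"
      by (intro ssum_cong[OF cC c] ssum_smult[OF cD CD d]) (simp_all add: m ec)
    also have "\<dots> = ssum C ?CD (\<lambda>c1 c2. counit C c1 \<odot>\<^bsub>?CD\<^esub> ?e c2 d) c"
      by (intro ssum_cong[OF cC c] arg_cong[where f = "smult ?CD a" for a]
          ssum_counit_left[OF D CD _ d] tens_linear_right m)
    also have "\<dots> = ?e c d"
      by (rule ssum_counit_left[OF C CD tens_linear_left[OF m d] c])
    finally show "ssum ?T ?CD (\<lambda>x y. counit ?T x \<odot>\<^bsub>?CD\<^esub> y) (?e c d) = id (?e c d)" by simp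
  qed
  thus "ssum ?T ?T (\<lambda>x y. counit ?T x \<odot>\<^bsub>?T\<^esub> y) z = z" by simp
  have "ssum ?T ?CD (\<lambda>x y. counit ?T y \<odot>\<^bsub>?CD\<^esub> x) z = id z"
  proof (rule tensor_linear_eqI[OF _ linear_id m CD _ z])
    show "ssum ?T ?CD (\<lambda>x y. counit ?T y \<odot>\<^bsub>?CD\<^esub> x) \<in> Lin ?CD ?CD"
      using ssum_arg_linear[OF cT CD bl(2)] by simp
    fix c d assume c: "c \<in> carrier C" and d: "d \<in> carrier D"
    have "ssum ?T ?CD (\<lambda>x y. counit ?T y \<odot>\<^bsub>?CD\<^esub> x) (?e c d) =
      ssum C ?CD (\<lambda>c1 c2. ssum D ?CD (\<lambda>d1 d2. counit ?T (?e c2 d2) \<odot>\<^bsub>?CD\<^esub> ?e c1 d1) d) c"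
      by (rule ssum_tensor_coalgebra[OF cC cD CD bilinear_flip[OF b] c d])
    also have "\<dots> = ssum C ?CD (\<lambda>c1 c2. ssum D ?CD (\<lambda>d1 d2.
        counit C c2 \<odot>\<^bsub>?CD\<^esub> (counit D d2 \<odot>\<^bsub>?CD\<^esub> ?e c1 d1)) d) c"
      by (intro ssum_cong[OF cC c] ssum_cong[OF cD d]) (simp add: eps m ec module_smult_smult)
    also have "\<dots> = ssum C ?CD (\<lambda>c1 c2. counit C c2 \<odot>\<^bsub>?CD\<^esub> ssum D ?CD (\<lambda>d1 d2.
        (counit D d2 \<odot>\<^bsub>?CD\<^esub> ?e c1 d1)) d) c"
      by (intro ssum_cong[OF cC c] ssum_smult[OF cD CD d]) (simp_all add: m ec)
    also have "\<dots> = ssum C ?CD (\<lambda>c1 c2. counit C c2 \<odot>\<^bsub>?CD\<^esub> ?e c1 d) c"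
      by (intro ssum_cong[OF cC c] arg_cong[where f = "smult ?CD a" for a]
          ssum_counit_right[OF D CD _ d] tens_linear_right m)
    also have "\<dots> = ?e c d"
      by (rule ssum_counit_right[OF C CD tens_linear_left[OF m d] c])
    finally show "ssum ?T ?CD (\<lambda>x y. counit ?T y \<odot>\<^bsub>?CD\<^esub> x) (?e c d) = id (?e c d)" by simp
  qed
  thus "ssum ?T ?T (\<lambda>x y. counit ?T y \<odot>\<^bsub>?T\<^esub> x) z = z" by simp
qed

section \<open>The ground ring as a coalgebra\<close>

definition ground_coalgebra :: "('k, 'k) coalgebra" where
  "ground_coalgebra = \<lparr>carrier = carrier K, mult = undefined, one = undefined, zero = \<zero>, add = add K,
    smult = mult K, comult = (\<lambda>a. tens K (ground_module K) (ground_module K) a \<one>), counit = id\<rparr>"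

lemma module_eq_ground: "module_eq ground_coalgebra (ground_module K)"
  by (simp add: module_eq_def ground_coalgebra_def)

lemma counit_ground_coalgebra [simp]: "counit ground_coalgebra = id"
  by (simp add: ground_coalgebra_def)

lemmas ground_coalgebra_simps [simp] = module_eq_simps[OF module_eq_ground]

lemma ground_comult_module: "comult_module ground_coalgebra"
proof -
  have "comult ground_coalgebra = (\<lambda>a. tens K (ground_module K) (ground_module K) a \<one>)"
    by (simp add: ground_coalgebra_def)
  thus ?thesis using tens_linear_left[of "ground_module K" "ground_module K" \<one>]
    by (simp add: comult_module_def)
qed

lemma ssum_ground:
  assumes X: "module K X" and b: "bilinear (ground_module K) (ground_module K) X \<beta>" and a: "a \<in> carrier K"
  shows "ssum ground_coalgebra X \<beta> a = \<beta> a \<one>"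
proof -
  have "ssum ground_coalgebra X \<beta> a =
      tensor_lift K (ground_module K) (ground_module K) X \<beta> (comult ground_coalgebra a)"
    using ssum_eq_tensor_lift[OF ground_comult_module X, of \<beta> a] a b by simp
  also have "comult ground_coalgebra a = tens K (ground_module K) (ground_module K) a \<one>"
    by (simp add: ground_coalgebra_def)
  finally show ?thesis using tensor_lift_tens[OF _ _ X b] a by simp
qed

lemma ground_coalgebra_coalgebra: "coalgebra K ground_coalgebra"
proof (rule coalgebraI[OF ground_comult_module])
  let ?K = "ground_module K" and ?G = ground_coalgebra
  let ?Y = "tensor K ?K (tensor K ?K ?K)"
  let ?t = "\<lambda>x y z. tens K ?K (tensor K ?K ?K) x (tens K ?K ?K y z)"
  have Y: "module K ?Y" by simp
  have t: "trilinear ?K ?K ?K ?Y ?t" by (rule tens_tens_trilinear) simp_all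
  hence t': "trilinear ?G ?G ?G ?Y ?t" by (simp add: trilinear_def)
  show "counit ?G \<in> Lin ?G ?K" by (simp add: linear_id)
  fix a assume "a \<in> carrier ?G"
  hence a: "a \<in> carrier K" by simp
  have "ssum ?G ?Y (\<lambda>x y. ssum ?G ?Y (\<lambda>x1 x2. ?t x1 x2 y) x) a = ssum ?G ?Y (\<lambda>x1 x2. ?t x1 x2 \<one>) a"
    using ssum_left_bilinear[OF ground_comult_module Y t'] a by (intro ssum_ground[OF Y]) simp_all
  also have "\<dots> = ?t a \<one> \<one>"
    using a by (intro ssum_ground[OF Y] trilinear_bilinear_left[OF t]) simp_all
  finally have L: "ssum ?G ?Y (\<lambda>x y. ssum ?G ?Y (\<lambda>x1 x2. ?t x1 x2 y) x) a = ?t a \<one> \<one>" .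
  have "ssum ?G ?Y (\<lambda>x y. ssum ?G ?Y (\<lambda>y1 y2. ?t x y1 y2) y) a = ssum ?G ?Y (\<lambda>y1 y2. ?t a y1 y2) \<one>"
    using ssum_right_bilinear[OF ground_comult_module Y t'] a by (intro ssum_ground[OF Y]) simp_all
  also have "\<dots> = ?t a \<one> \<one>"
    using a by (intro ssum_ground[OF Y] trilinear_bilinear_right[OF t]) simp_all
  finally show "ssum ?G (tensor K ?G (tensor K ?G ?G))
        (\<lambda>x y. ssum ?G (tensor K ?G (tensor K ?G ?G))
          (\<lambda>x1 x2. tens K ?G (tensor K ?G ?G) x1 (tens K ?G ?G x2 y)) x) a =
      ssum ?G (tensor K ?G (tensor K ?G ?G))
        (\<lambda>x y. ssum ?G (tensor K ?G (tensor K ?G ?G))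
          (\<lambda>y1 y2. tens K ?G (tensor K ?G ?G) x (tens K ?G ?G y1 y2)) y) a"
    using L by simp
  have b: "bilinear ?K ?K ?K (\<lambda>x y. x \<otimes> y)"
    by (rule bilinearI) (auto simp: l_distr r_distr m_ac)
  have "ssum ?G ?K (\<lambda>x y. x \<otimes> y) a = a" "ssum ?G ?K (\<lambda>x y. y \<otimes> x) a = a"
    using ssum_ground[OF _ b a] ssum_ground[OF _ bilinear_flip[OF b] a] a by simp_all
  thus "ssum ?G ?G (\<lambda>x y. counit ?G x \<odot>\<^bsub>?G\<^esub> y) a = a" "ssum ?G ?G (\<lambda>x y. counit ?G y \<odot>\<^bsub>?G\<^esub> x) a = a"
    by simp_all
qed

section \<open>Quotients and copies of coalgebras\<close>

definition copy_module :: "('v \<Rightarrow> 'd) \<Rightarrow> ('k, 'v, 'y) module_scheme \<Rightarrow> ('k, 'd) module" where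
  "copy_module e V = (let r = inv_into (carrier V) e in
    \<lparr>carrier = e ` carrier V, mult = undefined, one = undefined, zero = e \<zero>\<^bsub>V\<^esub>,
     add = (\<lambda>x y. e (r x \<oplus>\<^bsub>V\<^esub> r y)), smult = (\<lambda>a x. e (a \<odot>\<^bsub>V\<^esub> r x))\<rparr>)"

lemma
  assumes V: "module K V" and e: "inj_on e (carrier V)"
  shows copy_module_module: "module K (copy_module e V)"
    and copy_module_linear: "e \<in> Lin V (copy_module e V)"
    and copy_module_carrier: "carrier (copy_module e V) = e ` carrier V"
    and copy_module_zero_iff: "\<And>x. x \<in> carrier V \<Longrightarrow> e x = \<zero>\<^bsub>copy_module e V\<^esub> \<longleftrightarrow> x = \<zero>\<^bsub>V\<^esub>"
proof -
  let ?W = "copy_module e V"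
  have s: "carrier ?W = e ` carrier V" "\<zero>\<^bsub>?W\<^esub> = e \<zero>\<^bsub>V\<^esub>"
    "\<And>x y. x \<in> carrier V \<Longrightarrow> y \<in> carrier V \<Longrightarrow> e x \<oplus>\<^bsub>?W\<^esub> e y = e (x \<oplus>\<^bsub>V\<^esub> y)"
    "\<And>a x. x \<in> carrier V \<Longrightarrow> a \<odot>\<^bsub>?W\<^esub> e x = e (a \<odot>\<^bsub>V\<^esub> x)"
    using e by (simp_all add: copy_module_def Let_def)
  show "carrier ?W = e ` carrier V" by (rule s)
  show "e \<in> Lin V ?W" by (rule linearI) (auto simp: s)
  show "e x = \<zero>\<^bsub>?W\<^esub> \<longleftrightarrow> x = \<zero>\<^bsub>V\<^esub>" if "x \<in> carrier V" for x
    using that e V by (simp add: s inj_on_eq_iff)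
  interpret V: abelian_group V by (rule module_abelian_group[OF V])
  show "module K ?W"
  proof (rule moduleI[OF is_cring])
    show "abelian_group ?W"
    proof (rule abelian_groupI)
      fix u assume "u \<in> carrier ?W"
      then obtain x where x: "x \<in> carrier V" "u = e x" by (auto simp: s)
      hence "e (\<ominus>\<^bsub>V\<^esub> x) \<oplus>\<^bsub>?W\<^esub> u = \<zero>\<^bsub>?W\<^esub>" by (simp add: s V.l_neg)
      thus "\<exists>v\<in>carrier ?W. v \<oplus>\<^bsub>?W\<^esub> u = \<zero>\<^bsub>?W\<^esub>" using x by (auto simp: s)
    qed (use V in \<open>auto simp: s module_ac\<close>)
  qed (use V in \<open>auto simp: s module_distr module_distr_left module_smult_smult\<close>)
qed

text \<open>
  The coalgebra structure on \<open>D\<close> for which the surjection \<open>p\<close> is a coalgebra map. A preimage of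
  the argument is chosen; the choice is immaterial under the condition \<open>coideal_quotient\<close> below.
\<close>

definition push_coalgebra ::
  "('k, 'v, 'y) coalgebra_scheme \<Rightarrow> ('k, 'd, 'z) module_scheme \<Rightarrow> ('v \<Rightarrow> 'd) \<Rightarrow> ('k, 'd) coalgebra" where
  "push_coalgebra C D p = (let r = inv_into (carrier C) p in
    \<lparr>carrier = carrier D, mult = undefined, one = undefined, zero = zero D, add = add D, smult = smult D,
     comult = (\<lambda>u. ssum C (tensor K D D) (\<lambda>x y. tens K D D (p x) (p y)) (r u)),
     counit = (\<lambda>u. counit C (r u))\<rparr>)"

lemma module_eq_push_coalgebra: "module_eq (push_coalgebra C D p) D"
  by (simp add: module_eq_def push_coalgebra_def Let_def)

lemmas push_coalgebra_simps [simp] = module_eq_simps[OF module_eq_push_coalgebra]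

lemma linear_factor_inv:
  assumes V: "module K V" and D: "module K D" and X: "module K X" and p: "p \<in> Lin V D"
    and g: "g \<in> Lin V X" and ker: "\<And>x. x \<in> carrier V \<Longrightarrow> p x = \<zero>\<^bsub>D\<^esub> \<Longrightarrow> g x = \<zero>\<^bsub>X\<^esub>"
    and x: "x \<in> carrier V"
  shows "g (inv_into (carrier V) p (p x)) = g x"
proof -
  let ?y = "inv_into (carrier V) p (p x)"
  have y: "?y \<in> carrier V" "p ?y = p x"
    using x by (auto intro: inv_into_into f_inv_into_f)
  hence "p (?y \<ominus>\<^bsub>V\<^esub> x) = \<zero>\<^bsub>D\<^esub>"
    using x V D linear_closed[OF p] by (simp add: linear_minus[OF p] module_minus_zero_iff)
  hence "g ?y \<ominus>\<^bsub>X\<^esub> g x = \<zero>\<^bsub>X\<^esub>"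
    using ker[of "?y \<ominus>\<^bsub>V\<^esub> x"] y x V X by (simp add: linear_minus[OF g])
  thus ?thesis using y x X linear_closed[OF g] by (simp add: module_minus_zero_iff)
qed

lemma linear_of_factor:
  assumes p: "p \<in> Lin V D" and surj: "p ` carrier V = carrier D" and V: "module K V"
    and g: "g \<in> Lin V X" and h: "\<And>x. x \<in> carrier V \<Longrightarrow> h (p x) = g x"
  shows "h \<in> Lin D X"
proof (rule linearI)
  fix u assume "u \<in> carrier D"
  then obtain x where x: "x \<in> carrier V" "u = p x" using surj by auto
  show "h u \<in> carrier X" using x by (simp add: h linear_closed[OF g])
  {
    fix a assume "a \<in> carrier K"
    thus "h (a \<odot>\<^bsub>D\<^esub> u) = a \<odot>\<^bsub>X\<^esub> h u"
      using x V by (simp add: linear_smult[OF p, symmetric] h linear_smult[OF g])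
  }
  fix v assume "v \<in> carrier D"
  then obtain y where y: "y \<in> carrier V" "v = p y" using surj by auto
  show "h (u \<oplus>\<^bsub>D\<^esub> v) = h u \<oplus>\<^bsub>X\<^esub> h v"
    using x y V by (simp add: linear_add[OF p, symmetric] h linear_add[OF g])
qed

text \<open>
  The condition on \<open>ssum\<close> expresses \<open>\<Delta>(ker p) \<subseteq> ker p \<otimes> C + C \<otimes> ker p\<close> in the form in which it is used:
  \<open>p \<otimes> p\<close> annihilates \<open>\<Delta>(ker p)\<close>.
\<close>

definition coideal_quotient where
  "coideal_quotient C D p \<longleftrightarrow> module K D \<and> p \<in> Lin C D \<and> p ` carrier C = carrier D \<and>
    (\<forall>x\<in>carrier C. p x = \<zero>\<^bsub>D\<^esub> \<longrightarrow> counit C x = \<zero> \<and>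
      ssum C (tensor K D D) (\<lambda>x y. tens K D D (p x) (p y)) x = \<zero>\<^bsub>tensor K D D\<^esub>)"

lemma coideal_quotientD:
  assumes "coideal_quotient C D p"
  shows "module K D" "p \<in> Lin C D" "p ` carrier C = carrier D"
    "\<And>x. x \<in> carrier C \<Longrightarrow> p x = \<zero>\<^bsub>D\<^esub> \<Longrightarrow> counit C x = \<zero>"
    "\<And>x. x \<in> carrier C \<Longrightarrow> p x = \<zero>\<^bsub>D\<^esub> \<Longrightarrow>
      ssum C (tensor K D D) (\<lambda>x y. tens K D D (p x) (p y)) x = \<zero>\<^bsub>tensor K D D\<^esub>"
  using assms by (simp_all add: coideal_quotient_def)

context
  fixes C :: "('k, 'c, 'y) coalgebra_scheme" and D :: "('k, 'd, 'z) module_scheme" and p :: "'c \<Rightarrow> 'd"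
  assumes C: "coalgebra K C" and q: "coideal_quotient C D p"
begin

lemma push_bilinear: "bilinear C C (tensor K D D) (\<lambda>x y. tens K D D (p x) (p y))"
  by (intro bilinear_comp[OF bilinear_tens] coideal_quotientD[OF q])

lemma comult_push:
  assumes "c \<in> carrier C"
  shows "comult (push_coalgebra C D p) (p c) = ssum C (tensor K D D) (\<lambda>x y. tens K D D (p x) (p y)) c"
proof -
  note D = coideal_quotientD(1)[OF q] and p = coideal_quotientD(2)[OF q]
    and surj = coideal_quotientD(3)[OF q] and ker_counit = coideal_quotientD(4)[OF q]
    and ker_comult = coideal_quotientD(5)[OF q]
  note cC = coalgebra_comult_module[OF C]
  have DD: "module K (tensor K D D)" using D by simp
  show ?thesis
    using linear_factor_inv[OF comult_module_module[OF cC] D DD p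
        ssum_arg_linear[OF cC DD push_bilinear] ker_comult assms]
    by (simp add: push_coalgebra_def Let_def)
qed

lemma counit_push:
  assumes "c \<in> carrier C"
  shows "counit (push_coalgebra C D p) (p c) = counit C c"
  using linear_factor_inv[OF comult_module_module[OF coalgebra_comult_module[OF C]] coideal_quotientD(1)[OF q]
      ground_module_module coideal_quotientD(2)[OF q] counit_linear[OF C] _ assms] coideal_quotientD(4)[OF q]
  by (simp add: push_coalgebra_def Let_def)

lemma push_comult_module: "comult_module (push_coalgebra C D p)"
proof -
  note D = coideal_quotientD(1)[OF q] and p = coideal_quotientD(2)[OF q]
    and surj = coideal_quotientD(3)[OF q] and ker_counit = coideal_quotientD(4)[OF q]
    and ker_comult = coideal_quotientD(5)[OF q]
  note cC = coalgebra_comult_module[OF C]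
  have DD: "module K (tensor K D D)" using D by simp
  have "comult (push_coalgebra C D p) \<in> Lin D (tensor K D D)"
    by (rule linear_of_factor[OF p surj comult_module_module[OF cC]
          ssum_arg_linear[OF cC DD push_bilinear] comult_push])
  thus ?thesis using D by (simp add: comult_module_def)
qed

lemma ssum_push:
  assumes X: "module K X" and b: "bilinear D D X \<beta>" and c: "c \<in> carrier C"
  shows "ssum (push_coalgebra C D p) X \<beta> (p c) = ssum C X (\<lambda>x y. \<beta> (p x) (p y)) c"
  by (rule ssum_of_comult[OF coalgebra_comult_module[OF C] push_comult_module X])
     (use b c in \<open>simp_all add: comult_push linear_closed[OF coideal_quotientD(2)[OF q]]\<close>)

lemma push_coalgebra_coalgebra: "coalgebra K (push_coalgebra C D p)"
proof (rule coalgebraI[OF push_comult_module])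
  note D = coideal_quotientD(1)[OF q] and p = coideal_quotientD(2)[OF q]
    and surj = coideal_quotientD(3)[OF q] and ker_counit = coideal_quotientD(4)[OF q]
    and ker_comult = coideal_quotientD(5)[OF q]
  note cC = coalgebra_comult_module[OF C]
  note m = comult_module_module[OF cC]
  let ?P = "push_coalgebra C D p"
  have pc: "\<And>x. x \<in> carrier C \<Longrightarrow> p x \<in> carrier D" by (rule linear_closed[OF p])
  let ?Y = "tensor K D (tensor K D D)"
  let ?t = "\<lambda>x y z. tens K D (tensor K D D) x (tens K D D y z)"
  have Y: "module K ?Y" using D by simp
  have t: "trilinear D D D ?Y ?t" by (rule tens_tens_trilinear[OF D D D])
  hence t': "trilinear ?P ?P ?P ?Y ?t" by (simp add: trilinear_def)
  have eps: "counit ?P \<in> Lin D (ground_module K)"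
    by (rule linear_of_factor[OF p surj m counit_linear[OF C] counit_push])
  thus "counit ?P \<in> Lin ?P (ground_module K)" by simp
  fix u assume "u \<in> carrier ?P"
  then obtain c where c: "c \<in> carrier C" "u = p c" using surj by auto
  have "ssum ?P ?Y (\<lambda>x y. ssum ?P ?Y (\<lambda>x1 x2. ?t x1 x2 y) x) u =
      ssum C ?Y (\<lambda>x y. ssum ?P ?Y (\<lambda>x1 x2. ?t x1 x2 (p y)) (p x)) c"
    unfolding c(2) using ssum_left_bilinear[OF push_comult_module Y t'] by (intro ssum_push[OF Y _ c(1)]) simp
  also have "\<dots> = ssum C ?Y (\<lambda>x y. ssum C ?Y (\<lambda>x1 x2. ?t (p x1) (p x2) (p y)) x) c"
    by (intro ssum_cong[OF cC c(1)] ssum_push[OF Y] trilinear_bilinear_left[OF t] pc)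
  also have "\<dots> = ssum C ?Y (\<lambda>x y. ssum C ?Y (\<lambda>y1 y2. ?t (p x) (p y1) (p y2)) y) c"
    by (rule ssum_coassoc[OF C Y c(1) trilinear_comp[OF t p p p]])
  also have "\<dots> = ssum C ?Y (\<lambda>x y. ssum ?P ?Y (\<lambda>y1 y2. ?t (p x) y1 y2) (p y)) c"
    by (intro ssum_cong[OF cC c(1)] ssum_push[OF Y, symmetric] trilinear_bilinear_right[OF t] pc)
  also have "\<dots> = ssum ?P ?Y (\<lambda>x y. ssum ?P ?Y (\<lambda>y1 y2. ?t x y1 y2) y) u"
    unfolding c(2) using ssum_right_bilinear[OF push_comult_module Y t']
    by (intro ssum_push[OF Y _ c(1), symmetric]) simp
  finally show "ssum ?P (tensor K ?P (tensor K ?P ?P))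
        (\<lambda>x y. ssum ?P (tensor K ?P (tensor K ?P ?P))
          (\<lambda>x1 x2. tens K ?P (tensor K ?P ?P) x1 (tens K ?P ?P x2 y)) x) u =
      ssum ?P (tensor K ?P (tensor K ?P ?P))
        (\<lambda>x y. ssum ?P (tensor K ?P (tensor K ?P ?P))
          (\<lambda>y1 y2. tens K ?P (tensor K ?P ?P) x (tens K ?P ?P y1 y2)) y) u"
    by simp
  have b: "bilinear D D D (\<lambda>x y. counit ?P x \<odot>\<^bsub>D\<^esub> y)"
    using scalar_bilinear[OF D _ linear_id, of "counit ?P"] eps by simp
  have "ssum ?P D (\<lambda>x y. counit ?P x \<odot>\<^bsub>D\<^esub> y) u = ssum C D (\<lambda>x y. counit ?P (p x) \<odot>\<^bsub>D\<^esub> p y) c"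
    unfolding c(2) by (rule ssum_push[OF D b c(1)])
  also have "\<dots> = ssum C D (\<lambda>x y. counit C x \<odot>\<^bsub>D\<^esub> p y) c"
    by (rule ssum_cong[OF cC c(1)]) (simp add: counit_push)
  also have "\<dots> = u" unfolding c(2) by (rule ssum_counit_left[OF C D p c(1)])
  finally show "ssum ?P ?P (\<lambda>x y. counit ?P x \<odot>\<^bsub>?P\<^esub> y) u = u" by simp
  have "ssum ?P D (\<lambda>x y. counit ?P y \<odot>\<^bsub>D\<^esub> x) u = ssum C D (\<lambda>x y. counit ?P (p y) \<odot>\<^bsub>D\<^esub> p x) c"
    unfolding c(2) by (rule ssum_push[OF D bilinear_flip[OF b] c(1)])
  also have "\<dots> = ssum C D (\<lambda>x y. counit C y \<odot>\<^bsub>D\<^esub> p x) c"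
    by (rule ssum_cong[OF cC c(1)]) (simp add: counit_push)
  also have "\<dots> = u" unfolding c(2) by (rule ssum_counit_right[OF C D p c(1)])
  finally show "ssum ?P ?P (\<lambda>x y. counit ?P y \<odot>\<^bsub>?P\<^esub> x) u = u" by simp
qed

lemma push_coalgebra_hom: "p \<in> coalgebra_homs K C (push_coalgebra C D p)"
  by (rule coalgebra_homsI[OF coalgebra_comult_module[OF C]])
     (use coideal_quotientD(1,2)[OF q] in \<open>simp_all add: comult_push counit_push\<close>)

text \<open>
  A coalgebra map that factors through \<open>p\<close> as a function has a coalgebra map as second factor,
  since \<open>p\<close> is a surjective coalgebra map.
\<close>

lemma hom_of_factor:
  assumes M: "comult_module M" and h: "\<And>c. c \<in> carrier C \<Longrightarrow> h (p c) = g c" and g: "g \<in> coalgebra_homs K C M"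
  shows "h \<in> coalgebra_homs K (push_coalgebra C D p) M"
proof (rule coalgebra_homsI[OF push_comult_module comult_module_module[OF M]])
  note D = coideal_quotientD(1)[OF q] and p = coideal_quotientD(2)[OF q]
    and surj = coideal_quotientD(3)[OF q] and ker_counit = coideal_quotientD(4)[OF q]
    and ker_comult = coideal_quotientD(5)[OF q]
  note cC = coalgebra_comult_module[OF C]
  note mM = comult_module_module[OF M]
  have MM: "module K (tensor K M M)" using mM by simp
  have gl: "g \<in> Lin C M" using g by (simp add: coalgebra_homs_def)
  have hl: "h \<in> Lin D M" by (rule linear_of_factor[OF p surj comult_module_module[OF cC] gl h])
  thus "h \<in> Lin (push_coalgebra C D p) M" by simp
  fix u assume "u \<in> carrier (push_coalgebra C D p)"
  then obtain c where c: "c \<in> carrier C" "u = p c" using surj by auto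
  show "counit M (h u) = counit (push_coalgebra C D p) u"
    using g c by (simp add: h counit_push coalgebra_homs_def)
  have "comult M (h u) = ssum C (tensor K M M) (\<lambda>x y. tens K M M (g x) (g y)) c"
    using g c h tensor_map_comult[OF cC mM gl] by (simp add: coalgebra_homs_def)
  also have "\<dots> = ssum C (tensor K M M) (\<lambda>x y. tens K M M (h (p x)) (h (p y))) c"
    by (rule ssum_cong[OF cC c(1)]) (simp add: h)
  also have "\<dots> = ssum (push_coalgebra C D p) (tensor K M M) (\<lambda>x y. tens K M M (h x) (h y)) u"
    unfolding c(2) by (intro ssum_push[OF MM _ c(1), symmetric] bilinear_comp[OF bilinear_tens] mM hl)
  finally show "comult M (h u) = \<dots>" .
qed

end

lemma coideal_quotient_inj:
  assumes C: "coalgebra K C" and i: "inj_on i (carrier C)"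
  shows "coideal_quotient C (copy_module i C) i"
proof -
  note cC = coalgebra_comult_module[OF C]
  note mC = comult_module_module[OF cC]
  let ?D = "copy_module i C"
  note D = copy_module_module[OF mC i] and p = copy_module_linear[OF mC i]
  have DD: "module K (tensor K ?D ?D)" using D by simp
  have b: "bilinear C C (tensor K ?D ?D) (\<lambda>x y. tens K ?D ?D (i x) (i y))"
    by (rule bilinear_comp[OF bilinear_tens[OF D D] p p])
  show ?thesis
    using D p copy_module_zero_iff[OF mC i] linear_zero[OF counit_linear[OF C] mC]
      linear_zero[OF ssum_arg_linear[OF cC DD b] mC DD]
    by (simp add: coideal_quotient_def copy_module_carrier[OF mC i])
qed

lemma coalgebra_homs_comp:
  assumes C: "comult_module C" and D: "comult_module D" and E: "comult_module E"
    and g: "g \<in> coalgebra_homs K C D" and h: "h \<in> coalgebra_homs K D E"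
  shows "(\<lambda>c. h (g c)) \<in> coalgebra_homs K C E"
proof (rule coalgebra_homsI[OF C comult_module_module[OF E]])
  note m = comult_module_module[OF C] comult_module_module[OF D] comult_module_module[OF E]
  have EE: "module K (tensor K E E)" using m by simp
  have gl: "g \<in> Lin C D" and hl: "h \<in> Lin D E" using g h by (simp_all add: coalgebra_homs_def)
  show "(\<lambda>c. h (g c)) \<in> Lin C E" by (rule linear_comp[OF gl hl])
  fix c assume c: "c \<in> carrier C"
  have gc: "g c \<in> carrier D" by (rule linear_closed[OF gl c])
  show "counit E (h (g c)) = counit C c" using g h c gc by (simp add: coalgebra_homs_def)
  have "comult E (h (g c)) = ssum D (tensor K E E) (\<lambda>x y. tens K E E (h x) (h y)) (g c)"
    using h gc tensor_map_comult[OF D m(3) hl] by (simp add: coalgebra_homs_def)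
  also have "\<dots> = ssum C (tensor K E E) (\<lambda>x y. tens K E E (h (g x)) (h (g y))) c"
    by (intro ssum_hom[OF C D EE _ g c] bilinear_comp[OF bilinear_tens] m hl)
  finally show "comult E (h (g c)) = \<dots>" .
qed

section \<open>Measurings\<close>

text \<open>
  Measurings refer to the multiplications of \<open>A\<close> and \<open>B\<close> only through their bilinearity. This common
  generalisation covers commutative algebras in the sense of \<^locale>\<open>algebra\<close> as well as bialgebras.
\<close>

definition mult_algebra where
  "mult_algebra A \<longleftrightarrow> module K A \<and> bilinear A A A (mult A)"

lemma mult_algebra_module: "mult_algebra A \<Longrightarrow> module K A"
  by (simp add: mult_algebra_def)

lemma
  assumes "mult_algebra A"
  shows mult_closed: "x \<in> carrier A \<Longrightarrow> y \<in> carrier A \<Longrightarrow> x \<otimes>\<^bsub>A\<^esub> y \<in> carrier A"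
    and mult_linear_left: "y \<in> carrier A \<Longrightarrow> (\<lambda>x. x \<otimes>\<^bsub>A\<^esub> y) \<in> Lin A A"
    and mult_linear_right: "x \<in> carrier A \<Longrightarrow> (\<lambda>y. x \<otimes>\<^bsub>A\<^esub> y) \<in> Lin A A"
  using assms bilinear_linear_left[of A A A "mult A"] bilinear_linear_right[of A A A "mult A"]
  by (auto simp: mult_algebra_def bilinear_def)

lemma measuring_bilinear:
  assumes "module K C" "module K B" "mult_algebra A" "\<psi> \<in> Lin (tensor K C B) A"
    "b \<in> carrier B" "b' \<in> carrier B"
  shows "bilinear C C A (\<lambda>x y. \<psi> (tens K C B x b) \<otimes>\<^bsub>A\<^esub> \<psi> (tens K C B y b'))"
  by (rule bilinear_comp[OF _ bilinear_linear_left[OF bilinear_of_tensor[OF assms(4,1,2)] assms(5)]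
        bilinear_linear_left[OF bilinear_of_tensor[OF assms(4,1,2)] assms(6)]])
     (use assms(3) in \<open>simp add: mult_algebra_def\<close>)

lemma measuring_iff:
  assumes C: "comult_module C" and B: "module K B" and A: "mult_algebra A"
  shows "measuring K C B A \<psi> \<longleftrightarrow> \<psi> \<in> Lin (tensor K C B) A \<and>
     (\<forall>c\<in>carrier C. \<forall>b\<in>carrier B. \<forall>b'\<in>carrier B. \<psi> (tens K C B c (b \<otimes>\<^bsub>B\<^esub> b')) =
          ssum C A (\<lambda>c1 c2. \<psi> (tens K C B c1 b) \<otimes>\<^bsub>A\<^esub> \<psi> (tens K C B c2 b')) c) \<and>
     (\<forall>c\<in>carrier C. \<psi> (tens K C B c \<one>\<^bsub>B\<^esub>) = counit C c \<odot>\<^bsub>A\<^esub> \<one>\<^bsub>A\<^esub>)"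
proof -
  have "sweedler K C A (\<lambda>c1 c2. \<psi> (tens K C B c1 b) \<otimes>\<^bsub>A\<^esub> \<psi> (tens K C B c2 b')) c =
    ssum C A (\<lambda>c1 c2. \<psi> (tens K C B c1 b) \<otimes>\<^bsub>A\<^esub> \<psi> (tens K C B c2 b')) c"
    if "\<psi> \<in> Lin (tensor K C B) A" "c \<in> carrier C" "b \<in> carrier B" "b' \<in> carrier B" for c b b'
    using A by (intro sweedler_eq_ssum[OF C] measuring_bilinear[OF comult_module_module[OF C] B A] that)
       (simp add: mult_algebra_def)
  thus ?thesis unfolding measuring_def by auto
qed

text \<open>
  A measuring that vanishes on the kernel of \<open>p\<close> is constant on its fibres. The induced map is again
  a measuring because the comultiplication of the image is computed from preimages.
\<close>

lemma measuring_push: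
  assumes C: "coalgebra K C" and q: "coideal_quotient C D p"
    and multB: "mult_algebra B" and oneB: "\<one>\<^bsub>B\<^esub> \<in> carrier B"
    and A: "mult_algebra A" and f: "measuring K C B A f"
    and ker_f: "\<And>x b. x \<in> carrier C \<Longrightarrow> p x = \<zero>\<^bsub>D\<^esub> \<Longrightarrow> b \<in> carrier B \<Longrightarrow> f (tens K C B x b) = \<zero>\<^bsub>A\<^esub>"
  shows "\<exists>f'. measuring K (push_coalgebra C D p) B A f' \<and>
    (\<forall>c\<in>carrier C. \<forall>b\<in>carrier B. f' (tens K D B (p c) b) = f (tens K C B c b))"
proof -
  note cC = coalgebra_comult_module[OF C]
  note mC = comult_module_module[OF cC]
  let ?P = "push_coalgebra C D p"
  note mA = mult_algebra_module[OF A] and B = mult_algebra_module[OF multB]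
  note D = coideal_quotientD(1)[OF q] and p = coideal_quotientD(2)[OF q]
    and surj = coideal_quotientD(3)[OF q]
  note push = C q
  note cP = push_comult_module[OF push]
  have fl: "f \<in> Lin (tensor K C B) A" using f by (simp add: measuring_def)
  note fb = bilinear_of_tensor[OF fl mC B]
  define g where "g = (\<lambda>u b. f (tens K C B (inv_into (carrier C) p u) b))"
  have g: "g (p c) b = f (tens K C B c b)" if "c \<in> carrier C" "b \<in> carrier B" for c b
    unfolding g_def
    by (rule linear_factor_inv[OF mC D mA p bilinear_linear_left[OF fb that(2)] _ that(1)])
       (rule ker_f[OF _ _ that(2)])
  have gb: "bilinear D B A g"
  proof (rule bilinear_iff_linear[THEN iffD2], intro conjI ballI)
    show "(\<lambda>u. g u b) \<in> Lin D A" if b: "b \<in> carrier B" for b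
      by (rule linear_of_factor[OF p surj mC bilinear_linear_left[OF fb b] g[OF _ b]])
    show "g u \<in> Lin B A" if "u \<in> carrier D" for u
      unfolding g_def
      by (rule bilinear_linear_right[OF fb]) (use that surj in \<open>auto intro: inv_into_into\<close>)
  qed
  define f' where "f' = tensor_lift K D B A g"
  have f'l: "f' \<in> Lin (tensor K D B) A" unfolding f'_def by (rule tensor_lift_linear[OF D B mA gb])
  have f': "f' (tens K D B (p c) b) = f (tens K C B c b)" if "c \<in> carrier C" "b \<in> carrier B" for c b
    unfolding f'_def using tensor_lift_tens[OF D B mA gb] that linear_closed[OF p] by (simp add: g)
  have "measuring K ?P B A f'"
    unfolding measuring_iff[OF cP B A]
  proof (intro conjI ballI)
    show "f' \<in> Lin (tensor K ?P B) A" using f'l by simp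
    fix u assume "u \<in> carrier ?P"
    then obtain c where c: "c \<in> carrier C" "u = p c" using surj by auto
    show "f' (tens K ?P B u \<one>\<^bsub>B\<^esub>) = counit ?P u \<odot>\<^bsub>A\<^esub> \<one>\<^bsub>A\<^esub>"
      using f c oneB by (simp add: f' counit_push[OF push] measuring_iff[OF cC B A])
    fix b b' assume b: "b \<in> carrier B" "b' \<in> carrier B"
    have "f' (tens K ?P B u (b \<otimes>\<^bsub>B\<^esub> b')) = f (tens K C B c (b \<otimes>\<^bsub>B\<^esub> b'))"
      using c b mult_closed[OF multB b] by (simp add: f')
    also have "\<dots> = ssum C A (\<lambda>c1 c2. f (tens K C B c1 b) \<otimes>\<^bsub>A\<^esub> f (tens K C B c2 b')) c"
      using f c b by (simp add: measuring_iff[OF cC B A])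
    also have "\<dots> = ssum C A (\<lambda>c1 c2. f' (tens K D B (p c1) b) \<otimes>\<^bsub>A\<^esub> f' (tens K D B (p c2) b')) c"
      by (rule ssum_cong[OF cC c(1)]) (simp add: f' b)
    also have "\<dots> = ssum ?P A (\<lambda>u1 u2. f' (tens K D B u1 b) \<otimes>\<^bsub>A\<^esub> f' (tens K D B u2 b')) u"
      unfolding c(2)
      by (rule ssum_push[OF push mA measuring_bilinear[OF D B A f'l b] c(1), symmetric])
    finally show "f' (tens K ?P B u (b \<otimes>\<^bsub>B\<^esub> b')) =
        ssum ?P A (\<lambda>u1 u2. f' (tens K ?P B u1 b) \<otimes>\<^bsub>A\<^esub> f' (tens K ?P B u2 b')) u"
      by simp
  qed
  with f' show ?thesis by blast
qed

section \<open>Algebras and bialgebras\<close>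

lemma algebra_mult_algebra: "algebra K A \<Longrightarrow> mult_algebra A"
  unfolding mult_algebra_def
proof
  assume A: "algebra K A"
  then interpret A: algebra K A .
  show m: "module K A" by (rule A.module)
  show "bilinear A A A (mult A)"
  proof (rule bilinearI)
    fix a x y assume *: "a \<in> carrier K" "x \<in> carrier A" "y \<in> carrier A"
    have "x \<otimes>\<^bsub>A\<^esub> (a \<odot>\<^bsub>A\<^esub> y) = (a \<odot>\<^bsub>A\<^esub> y) \<otimes>\<^bsub>A\<^esub> x" using * m by (intro A.m_comm) simp_all
    also have "\<dots> = a \<odot>\<^bsub>A\<^esub> (y \<otimes>\<^bsub>A\<^esub> x)" using * by (intro A.smult_assoc2)
    also have "y \<otimes>\<^bsub>A\<^esub> x = x \<otimes>\<^bsub>A\<^esub> y" using * by (intro A.m_comm)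
    finally show "x \<otimes>\<^bsub>A\<^esub> (a \<odot>\<^bsub>A\<^esub> y) = a \<odot>\<^bsub>A\<^esub> (x \<otimes>\<^bsub>A\<^esub> y)" .
  qed (simp_all add: A.l_distr A.r_distr A.smult_assoc2)
qed

lemma assoc_algebra_mult_algebra: "assoc_algebra K A \<Longrightarrow> mult_algebra A"
  unfolding mult_algebra_def
proof
  assume A: "assoc_algebra K A"
  then interpret A: assoc_algebra K A .
  show m: "module K A" by unfold_locales
  show "bilinear A A A (mult A)"
    by (rule bilinearI) (auto simp: A.l_distr A.r_distr A.smult_mult_left A.smult_mult_right)
qed

lemma ssum_mult_right:
  assumes "mult_algebra A" "comult_module C" "c \<in> carrier C" "a \<in> carrier A"
    "\<And>x y. x \<in> carrier C \<Longrightarrow> y \<in> carrier C \<Longrightarrow> \<beta> x y \<in> carrier A"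
  shows "ssum C A \<beta> c \<otimes>\<^bsub>A\<^esub> a = ssum C A (\<lambda>x y. \<beta> x y \<otimes>\<^bsub>A\<^esub> a) c"
  using assms by (intro ssum_linear[where h = "\<lambda>x. x \<otimes>\<^bsub>A\<^esub> a"] mult_linear_left mult_algebra_module)

lemma ssum_mult_left:
  assumes "mult_algebra A" "comult_module C" "c \<in> carrier C" "a \<in> carrier A"
    "\<And>x y. x \<in> carrier C \<Longrightarrow> y \<in> carrier C \<Longrightarrow> \<beta> x y \<in> carrier A"
  shows "a \<otimes>\<^bsub>A\<^esub> ssum C A \<beta> c = ssum C A (\<lambda>x y. a \<otimes>\<^bsub>A\<^esub> \<beta> x y) c"
  using assms by (intro ssum_linear[where h = "\<lambda>x. a \<otimes>\<^bsub>A\<^esub> x"] mult_linear_right mult_algebra_module)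

lemma ssum_mult_ssum:
  assumes A: "mult_algebra A" and C: "comult_module C" and D: "comult_module D"
    and c: "c \<in> carrier C" and d: "d \<in> carrier D"
    and \<beta>: "\<And>x y. x \<in> carrier C \<Longrightarrow> y \<in> carrier C \<Longrightarrow> \<beta> x y \<in> carrier A"
    and \<gamma>: "\<And>x y. x \<in> carrier D \<Longrightarrow> y \<in> carrier D \<Longrightarrow> \<gamma> x y \<in> carrier A"
  shows "ssum C A \<beta> c \<otimes>\<^bsub>A\<^esub> ssum D A \<gamma> d =
    ssum C A (\<lambda>x y. ssum D A (\<lambda>u v. \<beta> x y \<otimes>\<^bsub>A\<^esub> \<gamma> u v) d) c"
proof -
  note m = mult_algebra_module[OF A]
  have "ssum C A \<beta> c \<otimes>\<^bsub>A\<^esub> ssum D A \<gamma> d = ssum C A (\<lambda>x y. \<beta> x y \<otimes>\<^bsub>A\<^esub> ssum D A \<gamma> d) c"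
    using \<gamma> m D d by (intro ssum_mult_right[OF A C c _ \<beta>]) auto
  also have "\<dots> = ssum C A (\<lambda>x y. ssum D A (\<lambda>u v. \<beta> x y \<otimes>\<^bsub>A\<^esub> \<gamma> u v) d) c"
    using \<beta> \<gamma> by (intro ssum_cong[OF C c] ssum_mult_left[OF A D d])
  finally show ?thesis .
qed

text \<open>
  The counterpart of \<open>ssum_of_comult\<close> for a comultiplication given by a double sum, the shape
  that multiplicativity of \<open>\<Delta>\<close> produces.
\<close>

lemma ssum_of_comult2:
  assumes C: "comult_module C" and E: "comult_module E" and D: "comult_module D" and X: "module K X"
    and \<beta>: "bilinear D D X \<beta>" and c: "c \<in> carrier C" and e: "e \<in> carrier E" and d: "d \<in> carrier D"
    and m: "\<And>x y. x \<in> carrier C \<Longrightarrow> y \<in> carrier E \<Longrightarrow> m x y \<in> carrier D"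
    and eq: "comult D d = ssum C (tensor K D D) (\<lambda>x1 x2. ssum E (tensor K D D)
      (\<lambda>y1 y2. tens K D D (m x1 y1) (m x2 y2)) e) c"
  shows "ssum D X \<beta> d = ssum C X (\<lambda>x1 x2. ssum E X (\<lambda>y1 y2. \<beta> (m x1 y1) (m x2 y2)) e) c"
proof -
  note mD = comult_module_module[OF D]
  have DD: "module K (tensor K D D)" using mD by simp
  let ?B = "tensor_lift K D D X \<beta>"
  note B = tensor_lift_linear[OF mD mD X \<beta>]
  have "ssum D X \<beta> d = ssum C X (\<lambda>x1 x2. ?B (ssum E (tensor K D D)
      (\<lambda>y1 y2. tens K D D (m x1 y1) (m x2 y2)) e)) c"
    unfolding ssum_eq_tensor_lift[OF D X \<beta> d] eq
    using mD m e E by (intro ssum_linear[OF C B DD X c]) simp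
  also have "\<dots> = ssum C X (\<lambda>x1 x2. ssum E X (\<lambda>y1 y2. ?B (tens K D D (m x1 y1) (m x2 y2))) e) c"
    using mD m by (intro ssum_cong[OF C c] ssum_linear[OF E B DD X e]) simp
  also have "\<dots> = ssum C X (\<lambda>x1 x2. ssum E X (\<lambda>y1 y2. \<beta> (m x1 y1) (m x2 y2)) e) c"
    using m by (intro ssum_cong[OF C c] ssum_cong[OF E e] tensor_lift_tens[OF mD mD X \<beta>])
  finally show ?thesis .
qed

lemma sweedler_sweedler_product:
  assumes C: "comult_module C" and m: "bilinear C C C m" and X: "module K X" and \<beta>: "bilinear C C X \<beta>"
    and x: "x \<in> carrier C" and y: "y \<in> carrier C"
  shows "sweedler K C X (\<lambda>x1 x2. sweedler K C X (\<lambda>y1 y2. \<beta> (m x1 y1) (m x2 y2)) y) x =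
    ssum C X (\<lambda>x1 x2. ssum C X (\<lambda>y1 y2. \<beta> (m x1 y1) (m x2 y2)) y) x"
proof -
  have "sweedler K C X (\<lambda>x1 x2. sweedler K C X (\<lambda>y1 y2. \<beta> (m x1 y1) (m x2 y2)) y) x =
    sweedler K C X (\<lambda>x1 x2. ssum C X (\<lambda>y1 y2. \<beta> (m x1 y1) (m x2 y2)) y) x"
    by (intro sweedler_cong sweedler_eq_ssum[OF C X y] bilinear_comp[OF \<beta>] bilinear_linear_right[OF m])
  also have "\<dots> = ssum C X (\<lambda>x1 x2. ssum C X (\<lambda>y1 y2. \<beta> (m x1 y1) (m x2 y2)) y) x"
    by (intro sweedler_eq_ssum[OF C X x] ssum_param_bilinear[OF C X y] bilinear_comp[OF \<beta>]
        bilinear_linear_left[OF m])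
  finally show ?thesis .
qed

lemma bialgebraI:
  assumes B: "assoc_algebra K B" and C: "coalgebra K B"
    and "\<And>x y. x \<in> carrier B \<Longrightarrow> y \<in> carrier B \<Longrightarrow> comult B (x \<otimes>\<^bsub>B\<^esub> y) =
        ssum B (tensor K B B) (\<lambda>x1 x2. ssum B (tensor K B B)
          (\<lambda>y1 y2. tens K B B (x1 \<otimes>\<^bsub>B\<^esub> y1) (x2 \<otimes>\<^bsub>B\<^esub> y2)) y) x"
    and "comult B \<one>\<^bsub>B\<^esub> = tens K B B \<one>\<^bsub>B\<^esub> \<one>\<^bsub>B\<^esub>"
    and "\<And>x y. x \<in> carrier B \<Longrightarrow> y \<in> carrier B \<Longrightarrow> counit B (x \<otimes>\<^bsub>B\<^esub> y) = counit B x \<otimes> counit B y"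
    and "counit B \<one>\<^bsub>B\<^esub> = \<one>"
  shows "bialgebra K B"
proof -
  note cB = coalgebra_comult_module[OF C]
  note mB = comult_module_module[OF cB]
  have m: "bilinear B B B (mult B)" using assoc_algebra_mult_algebra[OF B] by (simp add: mult_algebra_def)
  have BB: "module K (tensor K B B)" using mB by simp
  show ?thesis
    using assms sweedler_sweedler_product[OF cB m BB bilinear_tens[OF mB mB]]
    by (simp add: bialgebra_def bialgebra_axioms_def)
qed

context
  fixes B :: "('k, 'b, 'y) coalgebra_scheme"
  assumes B: "bialgebra K B"
begin

lemma bialgebra_coalgebra: "coalgebra K B"
  using B by (simp add: bialgebra_def)

lemma bialgebra_mult_algebra: "mult_algebra B"
  by (rule assoc_algebra_mult_algebra) (use B in \<open>simp add: bialgebra_def\<close>)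

lemma bialgebra_one_closed: "\<one>\<^bsub>B\<^esub> \<in> carrier B"
proof -
  interpret B: bialgebra K B by (rule B)
  show ?thesis by (rule B.one_closed)
qed

lemma bialgebra_one:
  assumes "x \<in> carrier B"
  shows "\<one>\<^bsub>B\<^esub> \<otimes>\<^bsub>B\<^esub> x = x" "x \<otimes>\<^bsub>B\<^esub> \<one>\<^bsub>B\<^esub> = x"
proof -
  interpret B: bialgebra K B by (rule B)
  show "\<one>\<^bsub>B\<^esub> \<otimes>\<^bsub>B\<^esub> x = x" "x \<otimes>\<^bsub>B\<^esub> \<one>\<^bsub>B\<^esub> = x"
    by (rule B.l_one[OF assms], rule B.r_one[OF assms])
qed

lemma bialgebra_assoc:
  assumes "x \<in> carrier B" "y \<in> carrier B" "z \<in> carrier B"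
  shows "(x \<otimes>\<^bsub>B\<^esub> y) \<otimes>\<^bsub>B\<^esub> z = x \<otimes>\<^bsub>B\<^esub> (y \<otimes>\<^bsub>B\<^esub> z)"
proof -
  interpret B: bialgebra K B by (rule B)
  show ?thesis by (rule B.m_assoc[OF assms])
qed

lemma bialgebra_comult_mult:
  assumes "x \<in> carrier B" "y \<in> carrier B"
  shows "comult B (x \<otimes>\<^bsub>B\<^esub> y) = ssum B (tensor K B B) (\<lambda>x1 x2. ssum B (tensor K B B)
          (\<lambda>y1 y2. tens K B B (x1 \<otimes>\<^bsub>B\<^esub> y1) (x2 \<otimes>\<^bsub>B\<^esub> y2)) y) x"
proof -
  note cB = coalgebra_comult_module[OF bialgebra_coalgebra]
  note mB = comult_module_module[OF cB]
  have m: "bilinear B B B (mult B)" using bialgebra_mult_algebra by (simp add: mult_algebra_def)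
  have BB: "module K (tensor K B B)" using mB by simp
  show ?thesis
    using bialgebra.comult_mult[OF B assms] sweedler_sweedler_product[OF cB m BB bilinear_tens[OF mB mB] assms]
    by simp
qed

lemma bialgebra_ssum_mult:
  assumes X: "module K X" and \<beta>: "bilinear B B X \<beta>" and x: "x \<in> carrier B" and y: "y \<in> carrier B"
  shows "ssum B X \<beta> (x \<otimes>\<^bsub>B\<^esub> y) = ssum B X (\<lambda>x1 x2. ssum B X (\<lambda>y1 y2. \<beta> (x1 \<otimes>\<^bsub>B\<^esub> y1) (x2 \<otimes>\<^bsub>B\<^esub> y2)) y) x"
proof -
  note cB = coalgebra_comult_module[OF bialgebra_coalgebra]
  note mc = mult_closed[OF bialgebra_mult_algebra]
  show ?thesis
    by (rule ssum_of_comult2[OF cB cB cB X \<beta> x y mc[OF x y] mc bialgebra_comult_mult[OF x y]])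
qed

lemma bialgebra_ssum_one:
  assumes X: "module K X" and \<beta>: "bilinear B B X \<beta>"
  shows "ssum B X \<beta> \<one>\<^bsub>B\<^esub> = \<beta> \<one>\<^bsub>B\<^esub> \<one>\<^bsub>B\<^esub>"
proof -
  note cB = coalgebra_comult_module[OF bialgebra_coalgebra]
  note mB = comult_module_module[OF cB]
  show ?thesis
    unfolding ssum_eq_tensor_lift[OF cB X \<beta> bialgebra_one_closed] bialgebra.comult_one[OF B]
    by (rule tensor_lift_tens[OF mB mB X \<beta> bialgebra_one_closed bialgebra_one_closed])
qed

end

lemma measures_right_iff:
  assumes T: "comult_module T" and N: "module K N" and A: "mult_algebra A"
  shows "measures_right K N T A \<psi> \<longleftrightarrow> \<psi> \<in> Lin (tensor K N T) A \<and>
     (\<forall>n\<in>carrier N. \<forall>m\<in>carrier N. \<forall>t\<in>carrier T. \<psi> (tens K N T (n \<otimes>\<^bsub>N\<^esub> m) t) =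
          ssum T A (\<lambda>t1 t2. \<psi> (tens K N T n t1) \<otimes>\<^bsub>A\<^esub> \<psi> (tens K N T m t2)) t) \<and>
     (\<forall>t\<in>carrier T. \<psi> (tens K N T \<one>\<^bsub>N\<^esub> t) = counit T t \<odot>\<^bsub>A\<^esub> \<one>\<^bsub>A\<^esub>)"
proof -
  note mT = comult_module_module[OF T]
  have "sweedler K T A (\<lambda>t1 t2. \<psi> (tens K N T n t1) \<otimes>\<^bsub>A\<^esub> \<psi> (tens K N T m t2)) t =
    ssum T A (\<lambda>t1 t2. \<psi> (tens K N T n t1) \<otimes>\<^bsub>A\<^esub> \<psi> (tens K N T m t2)) t"
    if \<psi>: "\<psi> \<in> Lin (tensor K N T) A" and "t \<in> carrier T" "n \<in> carrier N" "m \<in> carrier N" for n m t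
  proof (rule sweedler_eq_ssum[OF T mult_algebra_module[OF A] that(2)])
    show "bilinear T T A (\<lambda>t1 t2. \<psi> (tens K N T n t1) \<otimes>\<^bsub>A\<^esub> \<psi> (tens K N T m t2))"
      by (rule bilinear_comp[OF _ bilinear_linear_right[OF bilinear_of_tensor[OF \<psi> N mT] that(3)]
            bilinear_linear_right[OF bilinear_of_tensor[OF \<psi> N mT] that(4)]])
         (use A in \<open>simp add: mult_algebra_def\<close>)
  qed
  thus ?thesis unfolding measures_right_def by auto
qed

text \<open>
  Adding a multiplication and a unit to a coalgebra leaves everything unchanged that depends on the
  coalgebra structure alone.
\<close>

lemma module_eq_update: "module_eq (M\<lparr>mult := m, one := e\<rparr>) M"
  by (simp add: module_eq_def)

lemmas update_simps [simp] = module_eq_simps[OF module_eq_update]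

lemma update_coalgebra_simps [simp]:
  fixes M :: "('k, 'm, 'q) coalgebra_scheme"
  shows "ssum (M\<lparr>mult := m, one := e\<rparr>) X \<beta> c = ssum M X \<beta> c"
    "sweedler K (M\<lparr>mult := m, one := e\<rparr>) X \<beta> c = sweedler K M X \<beta> c"
    "sweedler K D (M\<lparr>mult := m, one := e\<rparr>) \<gamma> d = sweedler K D M \<gamma> d"
    "comult_module (M\<lparr>mult := m, one := e\<rparr>) = comult_module M"
  by (simp_all add: sweedler_def ssum_def coprod_def comult_module_def)

lemma coalgebra_update [simp]:
  fixes M :: "('k, 'm, 'q) coalgebra_scheme"
  shows "coalgebra K (M\<lparr>mult := m, one := e\<rparr>) = coalgebra K M"
  by (simp add: coalgebra_def coalgebra_axioms_def)

text \<open>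
  Four exchanges of adjacent sums move the sums over \<open>d\<close> and \<open>e\<close> to the outside.
\<close>

lemma ssum_swap2:
  assumes "comult_module B" "comult_module C" "comult_module D" "comult_module E" "module K X"
    "b \<in> carrier B" "c \<in> carrier C" "d \<in> carrier D" "e \<in> carrier E"
    "\<And>b1 b2 c1 c2 d1 d2 e1 e2. b1 \<in> carrier B \<Longrightarrow> b2 \<in> carrier B \<Longrightarrow> c1 \<in> carrier C \<Longrightarrow> c2 \<in> carrier C \<Longrightarrow>
      d1 \<in> carrier D \<Longrightarrow> d2 \<in> carrier D \<Longrightarrow> e1 \<in> carrier E \<Longrightarrow> e2 \<in> carrier E \<Longrightarrow>
      F b1 b2 c1 c2 d1 d2 e1 e2 \<in> carrier X"
  shows "ssum B X (\<lambda>b1 b2. ssum C X (\<lambda>c1 c2. ssum D X (\<lambda>d1 d2. ssum E X (\<lambda>e1 e2.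
      F b1 b2 c1 c2 d1 d2 e1 e2) e) d) c) b =
    ssum D X (\<lambda>d1 d2. ssum E X (\<lambda>e1 e2. ssum B X (\<lambda>b1 b2. ssum C X (\<lambda>c1 c2.
      F b1 b2 c1 c2 d1 d2 e1 e2) c) b) e) d"
proof -
  note * = assms(10)
  note cl = ssum_closed[OF assms(1,5)] ssum_closed[OF assms(2,5)] ssum_closed[OF assms(3,5)] ssum_closed[OF assms(4,5)]
  have "ssum B X (\<lambda>b1 b2. ssum C X (\<lambda>c1 c2. ssum D X (\<lambda>d1 d2. ssum E X (\<lambda>e1 e2.
      F b1 b2 c1 c2 d1 d2 e1 e2) e) d) c) b =
    ssum B X (\<lambda>b1 b2. ssum D X (\<lambda>d1 d2. ssum C X (\<lambda>c1 c2. ssum E X (\<lambda>e1 e2.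
      F b1 b2 c1 c2 d1 d2 e1 e2) e) c) d) b"
    by (intro ssum_cong[OF assms(1,6)] ssum_swap[OF assms(2,3,5,7,8)] cl * assms(6-9))
  also have "\<dots> = ssum D X (\<lambda>d1 d2. ssum B X (\<lambda>b1 b2. ssum C X (\<lambda>c1 c2. ssum E X (\<lambda>e1 e2.
      F b1 b2 c1 c2 d1 d2 e1 e2) e) c) b) d"
    by (intro ssum_swap[OF assms(1,3,5,6,8)] cl * assms(6-9))
  also have "\<dots> = ssum D X (\<lambda>d1 d2. ssum B X (\<lambda>b1 b2. ssum E X (\<lambda>e1 e2. ssum C X (\<lambda>c1 c2.
      F b1 b2 c1 c2 d1 d2 e1 e2) c) e) b) d"
    by (intro ssum_cong[OF assms(3,8)] ssum_cong[OF assms(1,6)] ssum_swap[OF assms(2,4,5,7,9)] cl * assms(6-9))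
  also have "\<dots> = ssum D X (\<lambda>d1 d2. ssum E X (\<lambda>e1 e2. ssum B X (\<lambda>b1 b2. ssum C X (\<lambda>c1 c2.
      F b1 b2 c1 c2 d1 d2 e1 e2) c) b) e) d"
    by (intro ssum_cong[OF assms(3,8)] ssum_swap[OF assms(1,4,5,6,9)] cl * assms(6-9))
  finally show ?thesis .
qed

section \<open>Antipodes\<close>

text \<open>
  \<open>f = f * (g * h) = (f * g) * h = h\<close> in the convolution algebra of linear maps from \<open>C\<close> to \<open>H\<close>.
\<close>

lemma convolution_inverse_unique:
  assumes C: "coalgebra K C" and H: "bialgebra K H"
    and f: "f \<in> Lin C H" and g: "g \<in> Lin C H" and h: "h \<in> Lin C H"
    and fg: "\<And>c. c \<in> carrier C \<Longrightarrow> ssum C H (\<lambda>x y. f x \<otimes>\<^bsub>H\<^esub> g y) c = counit C c \<odot>\<^bsub>H\<^esub> \<one>\<^bsub>H\<^esub>"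
    and gh: "\<And>c. c \<in> carrier C \<Longrightarrow> ssum C H (\<lambda>x y. g x \<otimes>\<^bsub>H\<^esub> h y) c = counit C c \<odot>\<^bsub>H\<^esub> \<one>\<^bsub>H\<^esub>"
    and c: "c \<in> carrier C"
  shows "f c = h c"
proof -
  note cC = coalgebra_comult_module[OF C]
  note mA = bialgebra_mult_algebra[OF H]
  note mH = mult_algebra_module[OF mA]
  note b = mA[unfolded mult_algebra_def, THEN conjunct2]
  note fc = linear_closed[OF f] and gc = linear_closed[OF g] and hc = linear_closed[OF h]
  note sl = linear_smult[OF mult_linear_left[OF mA]] and sr = linear_smult[OF mult_linear_right[OF mA]]
  note one = bialgebra_one_closed[OF H] bialgebra_one[OF H]
  note mc = mult_closed[OF mA]
  have t: "trilinear C C C H (\<lambda>x y z. (f x \<otimes>\<^bsub>H\<^esub> g y) \<otimes>\<^bsub>H\<^esub> h z)"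
  proof (rule trilinearI)
    show "bilinear C C H (\<lambda>x y. (f x \<otimes>\<^bsub>H\<^esub> g y) \<otimes>\<^bsub>H\<^esub> h z)" if "z \<in> carrier C" for z
      by (rule bilinear_linear[OF bilinear_comp[OF b f g] mult_linear_left[OF mA hc[OF that]]])
    show "bilinear C C H (\<lambda>y z. (f x \<otimes>\<^bsub>H\<^esub> g y) \<otimes>\<^bsub>H\<^esub> h z)" if "x \<in> carrier C" for x
      by (rule bilinear_comp[OF b linear_comp[OF g mult_linear_right[OF mA fc[OF that]]] h])
  qed
  have "f c = ssum C H (\<lambda>x y. counit C y \<odot>\<^bsub>H\<^esub> f x) c"
    by (rule ssum_counit_right[OF C mH f c, symmetric])
  also have "\<dots> = ssum C H (\<lambda>x y. f x \<otimes>\<^bsub>H\<^esub> ssum C H (\<lambda>u v. g u \<otimes>\<^bsub>H\<^esub> h v) y) c"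
    by (rule ssum_cong[OF cC c]) (simp add: gh sr fc one counit_closed[OF C])
  also have "\<dots> = ssum C H (\<lambda>x y. ssum C H (\<lambda>u v. (f x \<otimes>\<^bsub>H\<^esub> g u) \<otimes>\<^bsub>H\<^esub> h v) y) c"
    by (rule ssum_cong[OF cC c])
       (simp add: ssum_mult_left[OF mA cC] fc gc hc mc bialgebra_assoc[OF H] cong: ssum_cong[OF cC])
  also have "\<dots> = ssum C H (\<lambda>x y. ssum C H (\<lambda>u v. (f u \<otimes>\<^bsub>H\<^esub> g v) \<otimes>\<^bsub>H\<^esub> h y) x) c"
    by (rule ssum_coassoc[OF C mH c t, symmetric])
  also have "\<dots> = ssum C H (\<lambda>x y. ssum C H (\<lambda>u v. f u \<otimes>\<^bsub>H\<^esub> g v) x \<otimes>\<^bsub>H\<^esub> h y) c"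
    by (rule ssum_cong[OF cC c]) (simp add: ssum_mult_right[OF mA cC] fc gc hc mc)
  also have "\<dots> = ssum C H (\<lambda>x y. counit C x \<odot>\<^bsub>H\<^esub> h y) c"
    by (rule ssum_cong[OF cC c]) (simp add: fg sl hc one counit_closed[OF C])
  also have "\<dots> = h c" by (rule ssum_counit_left[OF C mH h c])
  finally show ?thesis .
qed

definition is_antipode where
  "is_antipode H S \<longleftrightarrow> S \<in> Lin H H \<and> (\<forall>x\<in>carrier H.
    ssum H H (\<lambda>x1 x2. S x1 \<otimes>\<^bsub>H\<^esub> x2) x = counit H x \<odot>\<^bsub>H\<^esub> \<one>\<^bsub>H\<^esub> \<and>
    ssum H H (\<lambda>x1 x2. x1 \<otimes>\<^bsub>H\<^esub> S x2) x = counit H x \<odot>\<^bsub>H\<^esub> \<one>\<^bsub>H\<^esub>)"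

lemma hopf_algebra_iff: "hopf_algebra K H \<longleftrightarrow> bialgebra K H \<and> (\<exists>S. is_antipode H S)"
proof -
  have "sweedler K H H (\<lambda>x1 x2. S x1 \<otimes>\<^bsub>H\<^esub> x2) x = ssum H H (\<lambda>x1 x2. S x1 \<otimes>\<^bsub>H\<^esub> x2) x \<and>
    sweedler K H H (\<lambda>x1 x2. x1 \<otimes>\<^bsub>H\<^esub> S x2) x = ssum H H (\<lambda>x1 x2. x1 \<otimes>\<^bsub>H\<^esub> S x2) x"
    if H: "bialgebra K H" and S: "S \<in> Lin H H" and x: "x \<in> carrier H" for S x
  proof -
    note mA = bialgebra_mult_algebra[OF H]
    note b = mA[unfolded mult_algebra_def, THEN conjunct2]
    note eq = sweedler_eq_ssum[OF coalgebra_comult_module[OF bialgebra_coalgebra[OF H]] mult_algebra_module[OF mA] x]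
    show ?thesis
      using eq[OF bilinear_comp[OF b S linear_id]] eq[OF bilinear_comp[OF b linear_id S]] by simp
  qed
  note eq = this
  show ?thesis
    unfolding hopf_algebra_def hopf_algebra_axioms_def is_antipode_def Bex_def
    by (intro conj_cong iff_exI ball_cong refl) (simp_all add: eq)
qed

lemma antipode_one:
  assumes H: "bialgebra K H" and S: "is_antipode H S"
  shows "S \<one>\<^bsub>H\<^esub> = \<one>\<^bsub>H\<^esub>"
proof -
  note mA = bialgebra_mult_algebra[OF H]
  note b = mA[unfolded mult_algebra_def, THEN conjunct2]
  have Sl: "S \<in> Lin H H" using S by (simp add: is_antipode_def)
  note one = bialgebra_one_closed[OF H]
  have "S \<one>\<^bsub>H\<^esub> \<otimes>\<^bsub>H\<^esub> \<one>\<^bsub>H\<^esub> = counit H \<one>\<^bsub>H\<^esub> \<odot>\<^bsub>H\<^esub> \<one>\<^bsub>H\<^esub>"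
    using S one bialgebra_ssum_one[OF H mult_algebra_module[OF mA] bilinear_comp[OF b Sl linear_id]]
    by (simp add: is_antipode_def)
  thus ?thesis
    using bialgebra.counit_one[OF H] one mult_algebra_module[OF mA] bialgebra_one[OF H] linear_closed[OF Sl]
    by simp
qed

text \<open>
  In the convolution algebra of linear maps from \<open>H \<otimes> H\<close> to \<open>H\<close>, the map \<open>x \<otimes> y \<mapsto> S(x y)\<close> is a left
  inverse of the multiplication and \<open>x \<otimes> y \<mapsto> S(y) S(x)\<close> is a right inverse.
\<close>

lemma antipode_mult:
  assumes H: "bialgebra K H" and S: "is_antipode H S" and x: "x \<in> carrier H" and y: "y \<in> carrier H"
  shows "S (x \<otimes>\<^bsub>H\<^esub> y) = S y \<otimes>\<^bsub>H\<^esub> S x"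
proof -
  note cH' = bialgebra_coalgebra[OF H]
  note cH = coalgebra_comult_module[OF cH']
  note mA = bialgebra_mult_algebra[OF H]
  note m = mult_algebra_module[OF mA]
  note b = mA[unfolded mult_algebra_def, THEN conjunct2]
  have Sl: "S \<in> Lin H H" using S by (simp add: is_antipode_def)
  note Sc = linear_closed[OF Sl] and mc = mult_closed[OF mA] and ec = counit_closed[OF cH']
  note one = bialgebra_one_closed[OF H] bialgebra_one[OF H]
  note sl = linear_smult[OF mult_linear_left[OF mA]] and sr = linear_smult[OF mult_linear_right[OF mA]]
  let ?C = "tensor_coalgebra H H" and ?HH = "tensor K H H"
  have HH: "module K ?HH" using m by simp
  note C = tensor_coalgebra_coalgebra[OF cH' cH']
  note eC = counit_tensor_coalgebra[OF cH' cH']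
  define \<mu> where "\<mu> = tensor_lift K H H H (mult H)"
  have \<mu>l: "\<mu> \<in> Lin ?HH H" and \<mu>: "\<And>x y. x \<in> carrier H \<Longrightarrow> y \<in> carrier H \<Longrightarrow> \<mu> (tens K H H x y) = x \<otimes>\<^bsub>H\<^esub> y"
    unfolding \<mu>_def by (rule tensor_lift_linear[OF m m m b], rule tensor_lift_tens[OF m m m b])
  have b': "bilinear H H H (\<lambda>x y. S y \<otimes>\<^bsub>H\<^esub> S x)" by (rule bilinear_flip[OF bilinear_comp[OF b Sl Sl]])
  define \<nu> where "\<nu> = tensor_lift K H H H (\<lambda>x y. S y \<otimes>\<^bsub>H\<^esub> S x)"
  have \<nu>l: "\<nu> \<in> Lin ?HH H" and \<nu>: "\<And>x y. x \<in> carrier H \<Longrightarrow> y \<in> carrier H \<Longrightarrow> \<nu> (tens K H H x y) = S y \<otimes>\<^bsub>H\<^esub> S x"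
    unfolding \<nu>_def by (rule tensor_lift_linear[OF m m m b'], rule tensor_lift_tens[OF m m m b'])
  have S\<mu>l: "(\<lambda>z. S (\<mu> z)) \<in> Lin ?HH H" by (rule linear_comp[OF \<mu>l Sl])
  have "(\<lambda>a. a \<odot>\<^bsub>H\<^esub> \<one>\<^bsub>H\<^esub>) \<in> Lin (ground_module K) H"
    by (rule linearI) (simp_all add: m one module_distr_left module_smult_smult)
  from linear_comp[OF eC(1) this] have el: "(\<lambda>z. counit ?C z \<odot>\<^bsub>H\<^esub> \<one>\<^bsub>H\<^esub>) \<in> Lin ?HH H" .
  have Sr: "ssum H H (\<lambda>x1 x2. x1 \<otimes>\<^bsub>H\<^esub> S x2) x = counit H x \<odot>\<^bsub>H\<^esub> \<one>\<^bsub>H\<^esub>"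
    "ssum H H (\<lambda>x1 x2. S x1 \<otimes>\<^bsub>H\<^esub> x2) x = counit H x \<odot>\<^bsub>H\<^esub> \<one>\<^bsub>H\<^esub>" if "x \<in> carrier H" for x
    using S that by (simp_all add: is_antipode_def)
  \<comment> \<open>\<open>S \<circ> \<mu>\<close> is left inverse to \<open>\<mu>\<close>.\<close>
  have 1: "ssum ?C H (\<lambda>z w. S (\<mu> z) \<otimes>\<^bsub>H\<^esub> \<mu> w) z = counit ?C z \<odot>\<^bsub>H\<^esub> \<one>\<^bsub>H\<^esub>" if z: "z \<in> carrier ?HH" for z
  proof (rule tensor_linear_eqI[OF _ el m m m _ z])
    note bb = bilinear_comp[OF b S\<mu>l \<mu>l]
    show "ssum ?C H (\<lambda>z w. S (\<mu> z) \<otimes>\<^bsub>H\<^esub> \<mu> w) \<in> Lin ?HH H"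
      using ssum_arg_linear[OF tensor_coalgebra_comult_module[OF cH cH] m] bb by simp
    fix x y assume x: "x \<in> carrier H" and y: "y \<in> carrier H"
    have "ssum ?C H (\<lambda>z w. S (\<mu> z) \<otimes>\<^bsub>H\<^esub> \<mu> w) (tens K H H x y) =
      ssum H H (\<lambda>x1 x2. ssum H H (\<lambda>y1 y2. S (\<mu> (tens K H H x1 y1)) \<otimes>\<^bsub>H\<^esub> \<mu> (tens K H H x2 y2)) y) x"
      by (rule ssum_tensor_coalgebra[OF cH cH m bb x y])
    also have "\<dots> = ssum H H (\<lambda>x1 x2. ssum H H (\<lambda>y1 y2. S (x1 \<otimes>\<^bsub>H\<^esub> y1) \<otimes>\<^bsub>H\<^esub> (x2 \<otimes>\<^bsub>H\<^esub> y2)) y) x"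
      by (intro ssum_cong[OF cH x] ssum_cong[OF cH y]) (simp add: \<mu>)
    also have "\<dots> = ssum H H (\<lambda>x1 x2. S x1 \<otimes>\<^bsub>H\<^esub> x2) (x \<otimes>\<^bsub>H\<^esub> y)"
      using bialgebra_ssum_mult[OF H m bilinear_comp[OF b Sl linear_id] x y] by simp
    also have "\<dots> = counit ?C (tens K H H x y) \<odot>\<^bsub>H\<^esub> \<one>\<^bsub>H\<^esub>"
      using x y by (simp add: Sr mc eC(2) bialgebra.counit_mult[OF H])
    finally show "ssum ?C H (\<lambda>z w. S (\<mu> z) \<otimes>\<^bsub>H\<^esub> \<mu> w) (tens K H H x y) = \<dots>" .
  qed
  \<comment> \<open>\<open>\<nu>\<close> is right inverse to \<open>\<mu>\<close>: in \<open>x\<^sub>1 y\<^sub>1 S(y\<^sub>2) S(x\<^sub>2)\<close> the inner product collapses first.\<close>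
  have 2: "ssum ?C H (\<lambda>z w. \<mu> z \<otimes>\<^bsub>H\<^esub> \<nu> w) z = counit ?C z \<odot>\<^bsub>H\<^esub> \<one>\<^bsub>H\<^esub>" if z: "z \<in> carrier ?HH" for z
  proof (rule tensor_linear_eqI[OF _ el m m m _ z])
    note bb = bilinear_comp[OF b \<mu>l \<nu>l]
    show "ssum ?C H (\<lambda>z w. \<mu> z \<otimes>\<^bsub>H\<^esub> \<nu> w) \<in> Lin ?HH H"
      using ssum_arg_linear[OF tensor_coalgebra_comult_module[OF cH cH] m] bb by simp
    fix x y assume x: "x \<in> carrier H" and y: "y \<in> carrier H"
    have inner: "ssum H H (\<lambda>y1 y2. \<mu> (tens K H H x1 y1) \<otimes>\<^bsub>H\<^esub> \<nu> (tens K H H x2 y2)) y =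
        counit H y \<odot>\<^bsub>H\<^esub> (x1 \<otimes>\<^bsub>H\<^esub> S x2)" if x1: "x1 \<in> carrier H" and x2: "x2 \<in> carrier H" for x1 x2
    proof -
      have "ssum H H (\<lambda>y1 y2. \<mu> (tens K H H x1 y1) \<otimes>\<^bsub>H\<^esub> \<nu> (tens K H H x2 y2)) y =
          ssum H H (\<lambda>y1 y2. (x1 \<otimes>\<^bsub>H\<^esub> (y1 \<otimes>\<^bsub>H\<^esub> S y2)) \<otimes>\<^bsub>H\<^esub> S x2) y"
        by (rule ssum_cong[OF cH y]) (simp add: \<mu> \<nu> bialgebra_assoc[OF H] mc Sc x1 x2)
      also have "\<dots> = (x1 \<otimes>\<^bsub>H\<^esub> ssum H H (\<lambda>y1 y2. y1 \<otimes>\<^bsub>H\<^esub> S y2) y) \<otimes>\<^bsub>H\<^esub> S x2"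
        by (simp add: ssum_mult_left[OF mA cH] ssum_mult_right[OF mA cH] mc Sc x1 x2 y)
      also have "\<dots> = counit H y \<odot>\<^bsub>H\<^esub> (x1 \<otimes>\<^bsub>H\<^esub> S x2)"
        using x1 x2 y by (simp add: Sr sl sr one ec Sc mc)
      finally show ?thesis .
    qed
    have "ssum ?C H (\<lambda>z w. \<mu> z \<otimes>\<^bsub>H\<^esub> \<nu> w) (tens K H H x y) =
      ssum H H (\<lambda>x1 x2. ssum H H (\<lambda>y1 y2. \<mu> (tens K H H x1 y1) \<otimes>\<^bsub>H\<^esub> \<nu> (tens K H H x2 y2)) y) x"
      by (rule ssum_tensor_coalgebra[OF cH cH m bb x y])
    also have "\<dots> = ssum H H (\<lambda>x1 x2. counit H y \<odot>\<^bsub>H\<^esub> (x1 \<otimes>\<^bsub>H\<^esub> S x2)) x"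
      by (rule ssum_cong[OF cH x inner])
    also have "\<dots> = counit H y \<odot>\<^bsub>H\<^esub> ssum H H (\<lambda>x1 x2. x1 \<otimes>\<^bsub>H\<^esub> S x2) x"
      by (rule ssum_smult[OF cH m x ec[OF y]]) (simp add: mc Sc)
    also have "\<dots> = counit ?C (tens K H H x y) \<odot>\<^bsub>H\<^esub> \<one>\<^bsub>H\<^esub>"
      using x y by (simp add: Sr eC(2) ec m one module_smult_smult[symmetric] m_comm)
    finally show "ssum ?C H (\<lambda>z w. \<mu> z \<otimes>\<^bsub>H\<^esub> \<nu> w) (tens K H H x y) = \<dots>" .
  qed
  have "S (\<mu> (tens K H H x y)) = \<nu> (tens K H H x y)"
    by (rule convolution_inverse_unique[OF C H, where g = \<mu>])
       (use S\<mu>l \<mu>l \<nu>l 1 2 m x y in simp_all)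
  thus ?thesis using x y by (simp add: \<mu> \<nu>)
qed

section \<open>Encoding tensors by lists\<close>

text \<open>
  A tensor is recovered from a list of pairs representing it. Such a list is encoded by listing all
  first components and then all second components.
\<close>

lemma ex_inj_tensor:
  assumes V: "module K V"
  shows "\<exists>i :: ('v \<times> 'v \<Rightarrow> 'k) set \<Rightarrow> ('k + 'v + 'n) list. inj_on i (carrier (tensor K V V))"
proof -
  define c :: "('v \<times> 'v) list \<Rightarrow> ('k + 'v + 'n) list"
    where "c = (\<lambda>ps. map (\<lambda>p. Inr (Inl (fst p))) ps @ map (\<lambda>p. Inr (Inl (snd p))) ps)"
  have c: "ps = qs" if "c ps = c qs" for ps qs
  proof -
    have "length (c ps) = length (c qs)" using that by simp
    hence len: "length ps = length qs" by (simp add: c_def)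
    with that have "map (Inr \<circ> Inl \<circ> fst) ps = (map (Inr \<circ> Inl \<circ> fst) qs :: ('k + 'v + 'n) list)"
      "map (Inr \<circ> Inl \<circ> snd) ps = (map (Inr \<circ> Inl \<circ> snd) qs :: ('k + 'v + 'n) list)"
      by (simp_all add: c_def comp_def)
    with len show "ps = qs"
      by (auto simp: list_eq_iff_nth_eq prod_eq_iff)
  qed
  define s where "s = (\<lambda>ps. lsum (tensor K V V) (\<lambda>(v, w). tens K V V v w) ps)"
  have "\<forall>z\<in>carrier (tensor K V V). \<exists>ps. z = s ps"
    unfolding s_def using tensor_decomposition[OF V V] by fast
  then obtain r where r: "\<And>z. z \<in> carrier (tensor K V V) \<Longrightarrow> z = s (r z)"
    by (auto simp: bchoice_iff)
  have "inj_on (\<lambda>z. c (r z)) (carrier (tensor K V V))"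
  proof (rule inj_onI)
    fix y z assume y: "y \<in> carrier (tensor K V V)" and z: "z \<in> carrier (tensor K V V)" and "c (r y) = c (r z)"
    hence "r y = r z" by (intro c)
    thus "y = z" by (subst r[OF y], subst r[OF z]) simp
  qed
  thus ?thesis by (rule exI[of "\<lambda>i. inj_on i (carrier (tensor K V V))"])
qed

end

section \<open>The universal measuring coalgebra\<close>

text \<open>
  Universality is assumed for coalgebras whose carrier lies in the type \<open>'u\<close>. The injection \<open>iM\<close>
  guarantees room for a copy of \<open>M\<close> itself and of each of its quotients.
\<close>

locale universal_coalgebra = ground_ring K
  for K :: "('k, 'x) ring_scheme" (structure) +
  fixes B :: "('k, 'b, 'y) module_scheme" and A :: "('k, 'a, 'z) module_scheme"
    and M :: "('k, 'm, 'q) coalgebra_scheme" and \<theta> :: "('m \<times> 'b \<Rightarrow> 'k) set \<Rightarrow> 'a"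
    and iM :: "'m \<Rightarrow> 'u"
  assumes multB: "mult_algebra B" and oneB: "\<one>\<^bsub>B\<^esub> \<in> carrier B" and multA: "mult_algebra A"
    and univ: "universal_measuring TYPE('u) K B A M \<theta>"
    and iM: "inj_on iM (carrier M)"
begin

lemmas mB = mult_algebra_module[OF multB]
lemmas mA = mult_algebra_module[OF multA]

lemma coalgM: "coalgebra K M"
  using univ by (simp add: universal_measuring_def)

lemmas cM = coalgebra_comult_module[OF coalgM]
lemmas mM = comult_module_module[OF cM]

lemma \<theta>_measuring: "measuring K M B A \<theta>"
  using univ by (simp add: universal_measuring_def)

lemma \<theta>_linear: "\<theta> \<in> Lin (tensor K M B) A"
  using \<theta>_measuring by (simp add: measuring_def)

definition ev where "ev m b = \<theta> (tens K M B m b)"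

lemma ev_bilinear: "bilinear M B A ev"
  unfolding ev_def[abs_def] by (rule bilinear_of_tensor[OF \<theta>_linear mM mB])

lemma ev_closed [simp]: "m \<in> carrier M \<Longrightarrow> b \<in> carrier B \<Longrightarrow> ev m b \<in> carrier A"
  by (rule bilinear_closed[OF ev_bilinear])

lemma ev_mult: "m \<in> carrier M \<Longrightarrow> b \<in> carrier B \<Longrightarrow> c \<in> carrier B \<Longrightarrow>
    ev m (b \<otimes>\<^bsub>B\<^esub> c) = ssum M A (\<lambda>m1 m2. ev m1 b \<otimes>\<^bsub>A\<^esub> ev m2 c) m"
  using \<theta>_measuring by (simp add: measuring_iff[OF cM mB multA] ev_def)

lemma ev_one: "m \<in> carrier M \<Longrightarrow> ev m \<one>\<^bsub>B\<^esub> = counit M m \<odot>\<^bsub>A\<^esub> \<one>\<^bsub>A\<^esub>"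
  using \<theta>_measuring by (simp add: measuring_iff[OF cM mB multA] ev_def)

lemma universal_ex1:
  fixes C :: "('k, 'u) coalgebra"
  assumes "coalgebra K C" "measuring K C B A f"
  shows "\<exists>!h. h \<in> extensional (carrier C) \<and> h \<in> coalgebra_homs K C M \<and>
              (\<forall>z\<in>carrier (tensor K C B). f z = \<theta> (tensor_map K C B M B h id z))"
  using univ assms by (simp add: universal_measuring_def)

text \<open>
  Both sides are linear on \<open>C \<otimes> B\<close>, so agreement on pure tensors suffices.
\<close>

lemma induced_iff:
  assumes C: "comult_module C" and f: "f \<in> Lin (tensor K C B) A" and h: "h \<in> coalgebra_homs K C M"
  shows "(\<forall>z\<in>carrier (tensor K C B). f z = \<theta> (tensor_map K C B M B h id z)) \<longleftrightarrow>
    (\<forall>c\<in>carrier C. \<forall>b\<in>carrier B. ev (h c) b = f (tens K C B c b))"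
proof -
  note mC = comult_module_module[OF C]
  have hl: "h \<in> Lin C M" using h by (simp add: coalgebra_homs_def)
  note tl = tensor_map_linear[OF mC mB mM mB hl linear_id]
  note tt = tensor_map_tens[OF mC mB mM mB hl linear_id]
  show ?thesis
  proof (intro iffI ballI)
    fix c b assume "\<forall>z\<in>carrier (tensor K C B). f z = \<theta> (tensor_map K C B M B h id z)"
      "c \<in> carrier C" "b \<in> carrier B"
    thus "ev (h c) b = f (tens K C B c b)" using mC mB by (simp add: tt ev_def)
  next
    fix z assume *: "\<forall>c\<in>carrier C. \<forall>b\<in>carrier B. ev (h c) b = f (tens K C B c b)"
      and z: "z \<in> carrier (tensor K C B)"
    show "f z = \<theta> (tensor_map K C B M B h id z)"
      by (rule tensor_linear_eqI[OF f linear_comp[OF tl \<theta>_linear] mC mB mA _ z])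
         (use * in \<open>simp add: tt ev_def\<close>)
  qed
qed

text \<open>
  The quotient \<open>D\<close> lives in the type for which universality is assumed, and the coalgebra \<open>C\<close> may have
  any type. The induced map is defined on \<open>D\<close>, hence its composite with \<open>p\<close> annihilates the kernel
  of \<open>p\<close>.
\<close>

lemma ex_hom_quotient:
  fixes C :: "('k, 'c, 'w) coalgebra_scheme" and D :: "('k, 'u) module"
  assumes C: "coalgebra K C" and f: "measuring K C B A f" and q: "coideal_quotient C D p"
    and ker_f: "\<And>x b. x \<in> carrier C \<Longrightarrow> p x = \<zero>\<^bsub>D\<^esub> \<Longrightarrow> b \<in> carrier B \<Longrightarrow> f (tens K C B x b) = \<zero>\<^bsub>A\<^esub>"
  shows "\<exists>h\<in>coalgebra_homs K C M. (\<forall>c\<in>carrier C. \<forall>b\<in>carrier B. ev (h c) b = f (tens K C B c b)) \<and>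
    (\<forall>c\<in>carrier C. p c = \<zero>\<^bsub>D\<^esub> \<longrightarrow> h c = \<zero>\<^bsub>M\<^esub>)"
proof -
  note D = coideal_quotientD(1)[OF q] and p = coideal_quotientD(2)[OF q]
  let ?P = "push_coalgebra C D p"
  obtain f' where f': "measuring K ?P B A f'"
    "\<And>c b. c \<in> carrier C \<Longrightarrow> b \<in> carrier B \<Longrightarrow> f' (tens K D B (p c) b) = f (tens K C B c b)"
    using measuring_push[OF C q multB oneB multA f ker_f] by blast
  obtain h where h: "h \<in> coalgebra_homs K ?P M"
    "\<forall>z\<in>carrier (tensor K ?P B). f' z = \<theta> (tensor_map K ?P B M B h id z)"
    using universal_ex1[OF push_coalgebra_coalgebra[OF C q] f'(1)] by blast
  have "f' \<in> Lin (tensor K ?P B) A" using f'(1) by (simp add: measuring_def)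
  note * = induced_iff[OF push_comult_module[OF C q] this h(1), THEN iffD1, OF h(2)]
  have hl: "h \<in> Lin D M" using h(1) by (simp add: coalgebra_homs_def)
  show ?thesis
  proof (intro bexI[of _ "\<lambda>c. h (p c)"] conjI ballI impI)
    show "(\<lambda>c. h (p c)) \<in> coalgebra_homs K C M"
      by (rule coalgebra_homs_comp[OF coalgebra_comult_module[OF C] push_comult_module[OF C q] cM
            push_coalgebra_hom[OF C q] h(1)])
    show "ev (h (p c)) b = f (tens K C B c b)" if "c \<in> carrier C" "b \<in> carrier B" for c b
      using * that linear_closed[OF p] by (simp add: f'(2))
    show "h (p c) = \<zero>\<^bsub>M\<^esub>" if "p c = \<zero>\<^bsub>D\<^esub>" for c
      using that linear_zero[OF hl D mM] by simp
  qed
qed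

lemma measuring_kernel_inj:
  assumes C: "coalgebra K C" and f: "measuring K C B A f" and i: "inj_on i (carrier C)"
    and "x \<in> carrier C" "i x = \<zero>\<^bsub>copy_module i C\<^esub>" "b \<in> carrier B"
  shows "f (tens K C B x b) = \<zero>\<^bsub>A\<^esub>"
proof -
  note mC = comult_module_module[OF coalgebra_comult_module[OF C]]
  have fl: "f \<in> Lin (tensor K C B) A" using f by (simp add: measuring_def)
  show ?thesis
    using linear_zero[OF bilinear_linear_left[OF bilinear_of_tensor[OF fl mC mB] assms(6)] mC mA]
      copy_module_zero_iff[OF mC i] assms(4,5) by simp
qed

lemma ex_hom:
  fixes C :: "('k, 'c, 'w) coalgebra_scheme" and i :: "'c \<Rightarrow> 'u"
  assumes C: "coalgebra K C" and f: "measuring K C B A f" and i: "inj_on i (carrier C)"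
  shows "\<exists>h\<in>coalgebra_homs K C M. \<forall>c\<in>carrier C. \<forall>b\<in>carrier B. ev (h c) b = f (tens K C B c b)"
  using ex_hom_quotient[OF C f coideal_quotient_inj[OF C i] measuring_kernel_inj[OF C f i]] by blast

text \<open>
  Uniqueness in the universal property, transported along the copy of \<open>M\<close> in the type \<open>'u\<close>.
\<close>

lemma endomorphism_eq:
  assumes g: "g \<in> coalgebra_homs K M M" and h: "h \<in> coalgebra_homs K M M"
    and gev: "\<And>x b. x \<in> carrier M \<Longrightarrow> b \<in> carrier B \<Longrightarrow> ev (g x) b = ev x b"
    and hev: "\<And>x b. x \<in> carrier M \<Longrightarrow> b \<in> carrier B \<Longrightarrow> ev (h x) b = ev x b"
    and x: "x \<in> carrier M"
  shows "g x = h x"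
proof -
  let ?D = "copy_module iM M" and ?P = "push_coalgebra M (copy_module iM M) iM"
  note q = coideal_quotient_inj[OF coalgM iM]
  note car = copy_module_carrier[OF mM iM]
  obtain f' where f': "measuring K ?P B A f'"
    "\<And>x b. x \<in> carrier M \<Longrightarrow> b \<in> carrier B \<Longrightarrow> f' (tens K ?D B (iM x) b) = ev x b"
    using measuring_push[OF coalgM q multB oneB multA \<theta>_measuring measuring_kernel_inj[OF coalgM \<theta>_measuring iM]]
    unfolding ev_def by blast
  have f'l: "f' \<in> Lin (tensor K ?P B) A" using f'(1) by (simp add: measuring_def)
  let ?t = "\<lambda>e. restrict (\<lambda>u. e (inv_into (carrier M) iM u)) (carrier ?D)"
  have *: "?t e \<in> extensional (carrier ?P) \<and> ?t e \<in> coalgebra_homs K ?P M \<and>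
      (\<forall>z\<in>carrier (tensor K ?P B). f' z = \<theta> (tensor_map K ?P B M B (?t e) id z))"
    if e: "e \<in> coalgebra_homs K M M"
      and eev: "\<And>x b. x \<in> carrier M \<Longrightarrow> b \<in> carrier B \<Longrightarrow> ev (e x) b = ev x b" for e
  proof -
    have te: "?t e (iM x) = e x" if "x \<in> carrier M" for x
      using that iM by (simp add: car)
    have "?t e \<in> coalgebra_homs K ?P M" by (rule hom_of_factor[OF coalgM q cM te e])
    moreover from induced_iff[OF push_comult_module[OF coalgM q] f'l this]
    have "\<forall>z\<in>carrier (tensor K ?P B). f' z = \<theta> (tensor_map K ?P B M B (?t e) id z)"
      using f'(2) eev iM by (auto simp: car)
    ultimately show ?thesis by simp
  qed
  have ex1_eq: "a = b" if "\<exists>!x. P x" "P a" "P b" for P and a b :: "'u \<Rightarrow> 'm"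
    using that by blast
  have "?t g = ?t h"
    by (rule ex1_eq[OF universal_ex1[OF push_coalgebra_coalgebra[OF coalgM q] f'(1)] *[OF g gev] *[OF h hev]])
  from fun_cong[OF this, of "iM x"] show ?thesis
    using x iM by (simp add: car)
qed

text \<open>
  Let \<open>J\<close> be the span of the differences \<open>a - b\<close> of related elements. Counit, values of \<open>\<theta>\<close> and the
  image of the comultiplication in \<open>M/J \<otimes> M/J\<close> vanish on \<open>J\<close>, because they agree on related
  elements; for the last one this is the step hypothesis, applied to the bilinear map
  \<open>x \<otimes> y \<mapsto> p(x) \<otimes> p(y)\<close> for the projection \<open>p\<close> to \<open>M/J\<close>, which identifies related elements. Thus \<open>J\<close> is
  a coideal annihilated by \<open>\<theta>\<close>, and the map induced on \<open>M/J\<close> shows \<open>J = 0\<close>. The type of \<open>X\<close> is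
  the one of \<open>M/J \<otimes> M/J\<close>, with \<open>M/J\<close> copied into \<open>'u\<close>.
\<close>

lemma coinduct:
  assumes R: "R a b"
    and Rcl: "\<And>a b. R a b \<Longrightarrow> a \<in> carrier M \<and> b \<in> carrier M"
    and Rcounit: "\<And>a b. R a b \<Longrightarrow> counit M a = counit M b"
    and Rev: "\<And>a b t. R a b \<Longrightarrow> t \<in> carrier B \<Longrightarrow> ev a t = ev b t"
    and Rcomult: "\<And>(X :: ('k, ('u \<times> 'u \<Rightarrow> 'k) set) module) \<beta> a b. module K X \<Longrightarrow> bilinear M M X \<beta> \<Longrightarrow>
      (\<And>a b c. R a b \<Longrightarrow> c \<in> carrier M \<Longrightarrow> \<beta> a c = \<beta> b c) \<Longrightarrow>
      (\<And>a b c. R a b \<Longrightarrow> c \<in> carrier M \<Longrightarrow> \<beta> c a = \<beta> c b) \<Longrightarrow>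
      R a b \<Longrightarrow> ssum M X \<beta> a = ssum M X \<beta> b"
  shows "a = b"
proof -
  define S where "S = {a \<ominus>\<^bsub>M\<^esub> b | a b. R a b}"
  define J where "J = module_span K M S"
  have S: "S \<subseteq> carrier M" using Rcl mM by (auto simp: S_def)
  have J: "submodule J K M" unfolding J_def by (rule module_span_submodule[OF mM S])
  have JI: "a \<ominus>\<^bsub>M\<^esub> b \<in> J" if "R a b" for a b
    unfolding J_def by (rule subsetD[OF module_span_subset]) (use that in \<open>auto simp: S_def\<close>)
  \<comment> \<open>A linear map that agrees on related elements vanishes on \<open>J\<close>.\<close>
  have JD: "g x = \<zero>\<^bsub>X\<^esub>"
    if g: "g \<in> Lin M X" and X: "module K X" and eq: "\<And>a b. R a b \<Longrightarrow> g a = g b" and x: "x \<in> J"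
    for g x and X :: "('k, 'v, 'w) module_scheme"
  proof -
    have "S \<subseteq> {x \<in> carrier M. g x = \<zero>\<^bsub>X\<^esub>}"
      using S Rcl eq linear_closed[OF g] linear_minus[OF g mM X] module_minus_zero_iff[OF X]
      by (auto simp: S_def)
    from module_span_least[OF kernel_submodule[OF g mM X] this] show ?thesis
      using x by (auto simp: J_def)
  qed
  let ?Q = "Quot M J"
  \<comment> \<open>Representatives of cosets embed the quotient into the type \<open>'u\<close>.\<close>
  define e where "e = (\<lambda>Z. iM (SOME x. x \<in> carrier M \<and> Z = J +>\<^bsub>M\<^esub> x))"
  have e: "inj_on e (carrier ?Q)"
  proof (rule inj_onI)
    fix Y Z assume YZ: "Y \<in> carrier ?Q" "Z \<in> carrier ?Q" "e Y = e Z"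
    let ?r = "\<lambda>Z. SOME x. x \<in> carrier M \<and> Z = J +>\<^bsub>M\<^esub> x"
    have r: "?r Z \<in> carrier M \<and> Z = J +>\<^bsub>M\<^esub> ?r Z" if "Z \<in> carrier ?Q" for Z
      by (rule someI_ex) (use that in \<open>auto simp: quotient_carrier\<close>)
    have "?r Y = ?r Z" using YZ(3) r[OF YZ(1)] r[OF YZ(2)] iM unfolding e_def inj_on_def by blast
    thus "Y = Z" using r[OF YZ(1)] r[OF YZ(2)] by metis
  qed
  note Q = quotient_module_module[OF mM J]
  let ?D = "copy_module e ?Q"
  define p where "p = (\<lambda>x. e (J +>\<^bsub>M\<^esub> x))"
  have D: "module K ?D" by (rule copy_module_module[OF Q e])
  have DD: "module K (tensor K ?D ?D)" using D by simp
  have p: "p \<in> Lin M ?D" unfolding p_def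
    by (rule linear_comp[OF coset_linear[OF mM J] copy_module_linear[OF Q e]])
  have surj: "p ` carrier M = carrier ?D"
    by (simp add: p_def copy_module_carrier[OF Q e] quotient_carrier image_image)
  have p0: "p x = \<zero>\<^bsub>?D\<^esub> \<longleftrightarrow> x \<in> J" if "x \<in> carrier M" for x
    unfolding p_def using copy_module_zero_iff[OF Q e] coset_zero_iff[OF mM J that] that
    by (simp add: quotient_carrier)
  have pR: "p a = p b" if "R a b" for a b
    using p0[of "a \<ominus>\<^bsub>M\<^esub> b"] JI[OF that] Rcl[OF that] mM D linear_closed[OF p]
    by (simp add: linear_minus[OF p] module_minus_zero_iff)
  let ?\<beta> = "\<lambda>x y. tens K ?D ?D (p x) (p y)"
  have \<beta>: "bilinear M M (tensor K ?D ?D) ?\<beta>" by (rule bilinear_comp[OF bilinear_tens[OF D D] p p])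
  have "coideal_quotient M ?D p"
    unfolding coideal_quotient_def
  proof (intro conjI D p surj ballI impI)
    fix x assume x: "x \<in> carrier M" "p x = \<zero>\<^bsub>?D\<^esub>"
    hence xJ: "x \<in> J" using p0 by simp
    show "counit M x = \<zero>"
      using JD[OF counit_linear[OF coalgM] ground_module_module Rcounit xJ] by simp
    show "ssum M (tensor K ?D ?D) ?\<beta> x = \<zero>\<^bsub>tensor K ?D ?D\<^esub>"
      by (rule JD[OF ssum_arg_linear[OF cM DD \<beta>] DD Rcomult[OF DD \<beta>] xJ]) (simp_all add: pR)
  qed
  moreover have "\<theta> (tens K M B x t) = \<zero>\<^bsub>A\<^esub>" if "x \<in> carrier M" "p x = \<zero>\<^bsub>?D\<^esub>" "t \<in> carrier B" for x t
    using JD[OF bilinear_linear_left[OF ev_bilinear that(3)] mA Rev] that p0 by (simp add: ev_def)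
  ultimately obtain h where h: "h \<in> coalgebra_homs K M M"
    "\<And>x t. x \<in> carrier M \<Longrightarrow> t \<in> carrier B \<Longrightarrow> ev (h x) t = ev x t"
    "\<And>x. x \<in> carrier M \<Longrightarrow> p x = \<zero>\<^bsub>?D\<^esub> \<Longrightarrow> h x = \<zero>\<^bsub>M\<^esub>"
    using ex_hom_quotient[OF coalgM \<theta>_measuring] unfolding ev_def by blast
  have id: "(\<lambda>x. x) \<in> coalgebra_homs K M M"
    by (rule coalgebra_homsI[OF cM mM]) (use linear_id[of M] in \<open>simp_all add: id_def comult_eq_ssum[OF cM]\<close>)
  have hx: "h x = x" if "x \<in> carrier M" for x
    by (rule endomorphism_eq[OF h(1) id h(2) refl that])
  have ab': "a \<in> carrier M" "b \<in> carrier M" using Rcl[OF R] by auto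
  have "a \<ominus>\<^bsub>M\<^esub> b = \<zero>\<^bsub>M\<^esub>"
    using h(3)[of "a \<ominus>\<^bsub>M\<^esub> b"] hx[of "a \<ominus>\<^bsub>M\<^esub> b"] p0 JI[OF R] ab' mM by simp
  thus ?thesis using module_minus_zero_iff[OF mM] ab' by simp
qed

text \<open>
  The pairs \<open>g(n)\<close>, \<open>h(n)\<close> are closed under comultiplication since \<open>g\<close> and \<open>h\<close> are coalgebra maps.
\<close>

lemma hom_eqI:
  assumes N: "comult_module N" and g: "g \<in> coalgebra_homs K N M" and h: "h \<in> coalgebra_homs K N M"
    and ev: "\<And>n t. n \<in> carrier N \<Longrightarrow> t \<in> carrier B \<Longrightarrow> ev (g n) t = ev (h n) t" and n: "n \<in> carrier N"
  shows "g n = h n"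
proof (rule coinduct[where R = "\<lambda>a b. \<exists>n\<in>carrier N. a = g n \<and> b = h n"])
  let ?R = "\<lambda>a b. \<exists>n\<in>carrier N. a = g n \<and> b = h n"
  have gl: "g \<in> Lin N M" and hl: "h \<in> Lin N M" using g h by (simp_all add: coalgebra_homs_def)
  show "?R (g n) (h n)" using n by blast
  fix a b assume "?R a b"
  then obtain n where n: "n \<in> carrier N" and a: "a = g n" and b: "b = h n" by blast
  show "a \<in> carrier M \<and> b \<in> carrier M" using n by (simp add: a b linear_closed[OF gl] linear_closed[OF hl])
  show "counit M a = counit M b" using g h n by (simp add: a b coalgebra_homs_def)
  show "ev a t = ev b t" if "t \<in> carrier B" for t using ev[OF n that] by (simp add: a b)
  fix X :: "('k, ('u \<times> 'u \<Rightarrow> 'k) set) module" and \<beta>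
  assume X: "module K X" and \<beta>: "bilinear M M X \<beta>"
    and l: "\<And>a b c. ?R a b \<Longrightarrow> c \<in> carrier M \<Longrightarrow> \<beta> a c = \<beta> b c"
    and r: "\<And>a b c. ?R a b \<Longrightarrow> c \<in> carrier M \<Longrightarrow> \<beta> c a = \<beta> c b"
  have "\<beta> (g x) (g y) = \<beta> (h x) (h y)" if "x \<in> carrier N" "y \<in> carrier N" for x y
    using l[of "g x" "h x" "g y"] r[of "g y" "h y" "h x"] that linear_closed[OF gl] linear_closed[OF hl] by auto
  thus "ssum M X \<beta> a = ssum M X \<beta> b"
    unfolding a b ssum_hom[OF N cM X \<beta> g n] ssum_hom[OF N cM X \<beta> h n] by (rule ssum_cong[OF N n])
qed

end

section \<open>The product and the unit\<close>

text \<open>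
  The two further injections allow the universal property to be applied to the coalgebras \<open>K\<close> and
  \<open>M \<otimes> M\<close>, which give rise to the unit and the product.
\<close>

locale bialgebra_measuring = universal_coalgebra K T A M \<theta> iM
  for K :: "('k, 'x) ring_scheme" (structure)
    and T :: "('k, 't, 'y) coalgebra_scheme" and A :: "('k, 'a, 'z) module_scheme"
    and M :: "('k, 'm) coalgebra" and \<theta> :: "('m \<times> 't \<Rightarrow> 'k) set \<Rightarrow> 'a"
    and iM :: "'m \<Rightarrow> 'u" +
  fixes iK :: "'k \<Rightarrow> 'u" and iMM :: "('m \<times> 'm \<Rightarrow> 'k) set \<Rightarrow> 'u"
  assumes T: "bialgebra K T" and A: "algebra K A"
    and iK: "inj_on iK (carrier K)" and iMM: "inj_on iMM (carrier (tensor K M M))"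
begin

lemmas coalgT = bialgebra_coalgebra[OF T]
lemmas cT = coalgebra_comult_module[OF coalgT]
lemmas mT = mB
lemmas oneT = oneB
lemmas multT_closed = mult_closed[OF multB]

lemma mA_closed [simp]: "x \<in> carrier A \<Longrightarrow> y \<in> carrier A \<Longrightarrow> x \<otimes>\<^bsub>A\<^esub> y \<in> carrier A"
  by (rule mult_closed[OF multA])

lemma A_one_closed [simp]: "\<one>\<^bsub>A\<^esub> \<in> carrier A"
proof -
  interpret A: algebra K A by (rule A)
  show ?thesis by (rule A.one_closed)
qed

lemma A_simps:
  "x \<in> carrier A \<Longrightarrow> y \<in> carrier A \<Longrightarrow> x \<otimes>\<^bsub>A\<^esub> y = y \<otimes>\<^bsub>A\<^esub> x"
  "x \<in> carrier A \<Longrightarrow> y \<in> carrier A \<Longrightarrow> z \<in> carrier A \<Longrightarrow>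
    (x \<otimes>\<^bsub>A\<^esub> y) \<otimes>\<^bsub>A\<^esub> z = x \<otimes>\<^bsub>A\<^esub> (y \<otimes>\<^bsub>A\<^esub> z)"
  "x \<in> carrier A \<Longrightarrow> y \<in> carrier A \<Longrightarrow> z \<in> carrier A \<Longrightarrow>
    x \<otimes>\<^bsub>A\<^esub> (y \<otimes>\<^bsub>A\<^esub> z) = y \<otimes>\<^bsub>A\<^esub> (x \<otimes>\<^bsub>A\<^esub> z)"
  "x \<in> carrier A \<Longrightarrow> \<one>\<^bsub>A\<^esub> \<otimes>\<^bsub>A\<^esub> x = x" "x \<in> carrier A \<Longrightarrow> x \<otimes>\<^bsub>A\<^esub> \<one>\<^bsub>A\<^esub> = x"
proof -
  interpret A: algebra K A by (rule A)
  show "x \<in> carrier A \<Longrightarrow> y \<in> carrier A \<Longrightarrow> x \<otimes>\<^bsub>A\<^esub> y = y \<otimes>\<^bsub>A\<^esub> x"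
    "x \<in> carrier A \<Longrightarrow> y \<in> carrier A \<Longrightarrow> z \<in> carrier A \<Longrightarrow>
    (x \<otimes>\<^bsub>A\<^esub> y) \<otimes>\<^bsub>A\<^esub> z = x \<otimes>\<^bsub>A\<^esub> (y \<otimes>\<^bsub>A\<^esub> z)"
    "x \<in> carrier A \<Longrightarrow> y \<in> carrier A \<Longrightarrow> z \<in> carrier A \<Longrightarrow>
    x \<otimes>\<^bsub>A\<^esub> (y \<otimes>\<^bsub>A\<^esub> z) = y \<otimes>\<^bsub>A\<^esub> (x \<otimes>\<^bsub>A\<^esub> z)"
    "x \<in> carrier A \<Longrightarrow> \<one>\<^bsub>A\<^esub> \<otimes>\<^bsub>A\<^esub> x = x" "x \<in> carrier A \<Longrightarrow> x \<otimes>\<^bsub>A\<^esub> \<one>\<^bsub>A\<^esub> = x"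
    by (simp_all add: A.m_ac)
qed

lemma A_smult_mult:
  assumes "a \<in> carrier K" "x \<in> carrier A" "y \<in> carrier A"
  shows "(a \<odot>\<^bsub>A\<^esub> x) \<otimes>\<^bsub>A\<^esub> y = a \<odot>\<^bsub>A\<^esub> (x \<otimes>\<^bsub>A\<^esub> y)" "x \<otimes>\<^bsub>A\<^esub> (a \<odot>\<^bsub>A\<^esub> y) = a \<odot>\<^bsub>A\<^esub> (x \<otimes>\<^bsub>A\<^esub> y)"
  using linear_smult[OF mult_linear_left[OF multA assms(3)] assms(1,2)]
    linear_smult[OF mult_linear_right[OF multA assms(2)] assms(1,3)] by simp_all

lemma mult_ev_bilinear_M: "t \<in> carrier T \<Longrightarrow> s \<in> carrier T \<Longrightarrow> bilinear M M A (\<lambda>x y. ev x t \<otimes>\<^bsub>A\<^esub> ev y s)"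
  using measuring_bilinear[OF mM mT multA \<theta>_linear] by (simp add: ev_def)

lemma A_mult_bilinear: "bilinear A A A (mult A)"
  using multA by (simp add: mult_algebra_def)

lemma mult_ev_bilinear_T: "x \<in> carrier M \<Longrightarrow> y \<in> carrier M \<Longrightarrow> bilinear T T A (\<lambda>t s. ev x t \<otimes>\<^bsub>A\<^esub> ev y s)"
  by (rule bilinear_comp[OF A_mult_bilinear bilinear_linear_right[OF ev_bilinear] bilinear_linear_right[OF ev_bilinear]])

text \<open>
  A coalgebra map \<open>M \<otimes> M \<rightarrow> M\<close>, and likewise a coalgebra map \<open>K \<rightarrow> M\<close> given by the image \<open>e\<close> of the
  unit of \<open>K\<close>, with the values on \<open>T\<close> that a structure measured by \<open>T\<close> must have. The bialgebra
  axioms for \<open>M\<close> that relate product and comultiplication are built in; associativity and the unit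
  laws are consequences.
\<close>

definition is_product where
  "is_product m \<longleftrightarrow> bilinear M M M m \<and>
    (\<forall>x\<in>carrier M. \<forall>y\<in>carrier M.
      comult M (m x y) = ssum M (tensor K M M) (\<lambda>x1 x2. ssum M (tensor K M M)
        (\<lambda>y1 y2. tens K M M (m x1 y1) (m x2 y2)) y) x \<and>
      counit M (m x y) = counit M x \<otimes> counit M y \<and>
      (\<forall>t\<in>carrier T. ev (m x y) t = ssum T A (\<lambda>t1 t2. ev x t1 \<otimes>\<^bsub>A\<^esub> ev y t2) t))"

definition is_unit where
  "is_unit e \<longleftrightarrow> e \<in> carrier M \<and> comult M e = tens K M M e e \<and> counit M e = \<one> \<and>
    (\<forall>t\<in>carrier T. ev e t = counit T t \<odot>\<^bsub>A\<^esub> \<one>\<^bsub>A\<^esub>)"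

lemma convolution_trilinear: "trilinear M M T A (\<lambda>x y. ssum T A (\<lambda>t1 t2. ev x t1 \<otimes>\<^bsub>A\<^esub> ev y t2))"
proof (rule trilinearI)
  show "bilinear M M A (\<lambda>x y. ssum T A (\<lambda>t1 t2. ev x t1 \<otimes>\<^bsub>A\<^esub> ev y t2) t)" if "t \<in> carrier T" for t
    by (rule ssum_param_bilinear[OF cT mA that mult_ev_bilinear_M])
  show "bilinear M T A (\<lambda>y. ssum T A (\<lambda>t1 t2. ev x t1 \<otimes>\<^bsub>A\<^esub> ev y t2))" if x: "x \<in> carrier M" for x
  proof (rule ssum_right_bilinear[OF cT mA trilinearI])
    show "bilinear M T A (\<lambda>y t1. ev x t1 \<otimes>\<^bsub>A\<^esub> ev y t2)" if "t2 \<in> carrier T" for t2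
      by (rule bilinear_flip[OF bilinear_comp[OF A_mult_bilinear bilinear_linear_right[OF ev_bilinear x]
            bilinear_linear_left[OF ev_bilinear that]]])
    show "bilinear T T A (\<lambda>t1 t2. ev x t1 \<otimes>\<^bsub>A\<^esub> ev y t2)" if "y \<in> carrier M" for y
      by (rule mult_ev_bilinear_T[OF x that])
  qed
qed

text \<open>
  Multiplicativity of the comultiplication of \<open>T\<close> and of \<open>\<theta>\<close> in \<open>T\<close> gives four factors
  \<open>x\<^sub>1(t\<^sub>1) x\<^sub>2(s\<^sub>1) y\<^sub>1(t\<^sub>2) y\<^sub>2(s\<^sub>2)\<close>; regrouping them needs commutativity of \<open>A\<close>.
\<close>

lemma convolution_mult:
  assumes x: "x \<in> carrier M" and y: "y \<in> carrier M" and t: "t \<in> carrier T" and s: "s \<in> carrier T"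
  shows "ssum T A (\<lambda>u v. ev x u \<otimes>\<^bsub>A\<^esub> ev y v) (t \<otimes>\<^bsub>T\<^esub> s) =
    ssum M A (\<lambda>x1 x2. ssum M A (\<lambda>y1 y2. ssum T A (\<lambda>t1 t2. ev x1 t1 \<otimes>\<^bsub>A\<^esub> ev y1 t2) t \<otimes>\<^bsub>A\<^esub>
      ssum T A (\<lambda>s1 s2. ev x2 s1 \<otimes>\<^bsub>A\<^esub> ev y2 s2) s) y) x"
proof -
  have "ssum T A (\<lambda>u v. ev x u \<otimes>\<^bsub>A\<^esub> ev y v) (t \<otimes>\<^bsub>T\<^esub> s) =
      ssum T A (\<lambda>t1 t2. ssum T A (\<lambda>s1 s2. ev x (t1 \<otimes>\<^bsub>T\<^esub> s1) \<otimes>\<^bsub>A\<^esub> ev y (t2 \<otimes>\<^bsub>T\<^esub> s2)) s) t"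
    by (rule bialgebra_ssum_mult[OF T mA mult_ev_bilinear_T[OF x y] t s])
  also have "\<dots> = ssum T A (\<lambda>t1 t2. ssum T A (\<lambda>s1 s2. ssum M A (\<lambda>x1 x2. ssum M A (\<lambda>y1 y2.
      (ev x1 t1 \<otimes>\<^bsub>A\<^esub> ev x2 s1) \<otimes>\<^bsub>A\<^esub> (ev y1 t2 \<otimes>\<^bsub>A\<^esub> ev y2 s2)) y) x) s) t"
    by (intro ssum_cong[OF cT t] ssum_cong[OF cT s])
       (simp add: ev_mult x y ssum_mult_ssum[OF multA cM cM x y])
  also have "\<dots> = ssum M A (\<lambda>x1 x2. ssum M A (\<lambda>y1 y2. ssum T A (\<lambda>t1 t2. ssum T A (\<lambda>s1 s2.
      (ev x1 t1 \<otimes>\<^bsub>A\<^esub> ev x2 s1) \<otimes>\<^bsub>A\<^esub> (ev y1 t2 \<otimes>\<^bsub>A\<^esub> ev y2 s2)) s) t) y) x"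
    by (rule ssum_swap2[OF cT cT cM cM mA t s x y]) simp
  also have "\<dots> = ssum M A (\<lambda>x1 x2. ssum M A (\<lambda>y1 y2. ssum T A (\<lambda>t1 t2. ssum T A (\<lambda>s1 s2.
      (ev x1 t1 \<otimes>\<^bsub>A\<^esub> ev y1 t2) \<otimes>\<^bsub>A\<^esub> (ev x2 s1 \<otimes>\<^bsub>A\<^esub> ev y2 s2)) s) t) y) x"
    by (intro ssum_cong[OF cM x] ssum_cong[OF cM y] ssum_cong[OF cT t] ssum_cong[OF cT s])
       (simp add: A_simps(2,3))
  also have "\<dots> = ssum M A (\<lambda>x1 x2. ssum M A (\<lambda>y1 y2. ssum T A (\<lambda>t1 t2. ev x1 t1 \<otimes>\<^bsub>A\<^esub> ev y1 t2) t \<otimes>\<^bsub>A\<^esub>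
      ssum T A (\<lambda>s1 s2. ev x2 s1 \<otimes>\<^bsub>A\<^esub> ev y2 s2) s) y) x"
    by (intro ssum_cong[OF cM x] ssum_cong[OF cM y] ssum_mult_ssum[OF multA cT cT t s, symmetric]) simp_all
  finally show ?thesis .
qed

text \<open>
  By \<open>convolution_mult\<close>, \<open>(x \<otimes> y) \<otimes> t \<mapsto> x(t\<^sub>1) y(t\<^sub>2)\<close> is a measuring; its induced coalgebra map is
  the product.
\<close>

lemma ex_product: "\<exists>m. is_product m"
proof -
  let ?MM = "tensor K M M" and ?C = "tensor_coalgebra M M"
  have MM: "module K ?MM" using mM by simp
  note cC = tensor_coalgebra_comult_module[OF cM cM]
  obtain F where Fl: "F \<in> Lin (tensor K ?MM T) A"
    and F: "\<And>x y t. x \<in> carrier M \<Longrightarrow> y \<in> carrier M \<Longrightarrow> t \<in> carrier T \<Longrightarrow>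
      F (tens K ?MM T (tens K M M x y) t) = ssum T A (\<lambda>t1 t2. ev x t1 \<otimes>\<^bsub>A\<^esub> ev y t2) t"
    using trilinear_lift_left[OF mM mM mT mA convolution_trilinear] by blast
  note Fb = bilinear_of_tensor[OF Fl MM mT]
  note FFb = measuring_bilinear[OF MM mT multA Fl]
  have "measuring K ?C T A F"
    unfolding measuring_iff[OF cC mT multA] tensor_coalgebra_simps
  proof (intro conjI ballI Fl)
    fix z assume z: "z \<in> carrier ?MM"
    {
      fix t s assume t: "t \<in> carrier T" and s: "s \<in> carrier T"
      show "F (tens K ?MM T z (t \<otimes>\<^bsub>T\<^esub> s)) =
        ssum ?C A (\<lambda>z1 z2. F (tens K ?MM T z1 t) \<otimes>\<^bsub>A\<^esub> F (tens K ?MM T z2 s)) z"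
      proof (rule tensor_linear_eqI[OF _ _ mM mM mA _ z])
        show "(\<lambda>z. F (tens K ?MM T z (t \<otimes>\<^bsub>T\<^esub> s))) \<in> Lin ?MM A"
          by (rule bilinear_linear_left[OF Fb multT_closed[OF t s]])
        show "ssum ?C A (\<lambda>z1 z2. F (tens K ?MM T z1 t) \<otimes>\<^bsub>A\<^esub> F (tens K ?MM T z2 s)) \<in> Lin ?MM A"
          using ssum_arg_linear[OF cC mA] FFb[OF t s] by simp
        fix x y assume x: "x \<in> carrier M" and y: "y \<in> carrier M"
        have "F (tens K ?MM T (tens K M M x y) (t \<otimes>\<^bsub>T\<^esub> s)) =
          ssum M A (\<lambda>x1 x2. ssum M A (\<lambda>y1 y2. ssum T A (\<lambda>t1 t2. ev x1 t1 \<otimes>\<^bsub>A\<^esub> ev y1 t2) t \<otimes>\<^bsub>A\<^esub>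
            ssum T A (\<lambda>s1 s2. ev x2 s1 \<otimes>\<^bsub>A\<^esub> ev y2 s2) s) y) x"
          using F[OF x y multT_closed[OF t s]] convolution_mult[OF x y t s] by simp
        also have "\<dots> = ssum M A (\<lambda>x1 x2. ssum M A (\<lambda>y1 y2. F (tens K ?MM T (tens K M M x1 y1) t) \<otimes>\<^bsub>A\<^esub>
            F (tens K ?MM T (tens K M M x2 y2) s)) y) x"
          by (intro ssum_cong[OF cM x] ssum_cong[OF cM y]) (simp add: F t s)
        also have "\<dots> = ssum ?C A (\<lambda>z1 z2. F (tens K ?MM T z1 t) \<otimes>\<^bsub>A\<^esub> F (tens K ?MM T z2 s)) (tens K M M x y)"
          by (rule ssum_tensor_coalgebra[OF cM cM mA FFb[OF t s] x y, symmetric])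
        finally show "F (tens K ?MM T (tens K M M x y) (t \<otimes>\<^bsub>T\<^esub> s)) = \<dots>" .
      qed
    }
    show "F (tens K ?MM T z \<one>\<^bsub>T\<^esub>) = counit ?C z \<odot>\<^bsub>A\<^esub> \<one>\<^bsub>A\<^esub>"
    proof (rule tensor_linear_eqI[OF _ _ mM mM mA _ z])
      show "(\<lambda>z. F (tens K ?MM T z \<one>\<^bsub>T\<^esub>)) \<in> Lin ?MM A" by (rule bilinear_linear_left[OF Fb oneT])
      have "(\<lambda>a. a \<odot>\<^bsub>A\<^esub> \<one>\<^bsub>A\<^esub>) \<in> Lin (ground_module K) A"
        by (rule linearI) (simp_all add: mA module_distr_left module_smult_smult)
      thus "(\<lambda>z. counit ?C z \<odot>\<^bsub>A\<^esub> \<one>\<^bsub>A\<^esub>) \<in> Lin ?MM A"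
        by (rule linear_comp[OF counit_tensor_coalgebra(1)[OF coalgM coalgM]])
      fix x y assume x: "x \<in> carrier M" and y: "y \<in> carrier M"
      have "F (tens K ?MM T (tens K M M x y) \<one>\<^bsub>T\<^esub>) = ev x \<one>\<^bsub>T\<^esub> \<otimes>\<^bsub>A\<^esub> ev y \<one>\<^bsub>T\<^esub>"
        using F[OF x y oneT] bialgebra_ssum_one[OF T mA mult_ev_bilinear_T[OF x y]] by simp
      also have "\<dots> = counit ?C (tens K M M x y) \<odot>\<^bsub>A\<^esub> \<one>\<^bsub>A\<^esub>"
        using x y by (simp add: ev_one counit_tensor_coalgebra(2)[OF coalgM coalgM] A_smult_mult A_simps(4)
            counit_closed[OF coalgM] mA module_smult_smult module_smult_comm[OF mA, of "counit M y"])
      finally show "F (tens K ?MM T (tens K M M x y) \<one>\<^bsub>T\<^esub>) = \<dots>" .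
    qed
  qed
  then obtain h where h: "h \<in> coalgebra_homs K ?C M"
    and hF: "\<And>z t. z \<in> carrier ?MM \<Longrightarrow> t \<in> carrier T \<Longrightarrow> ev (h z) t = F (tens K ?MM T z t)"
    using ex_hom[OF tensor_coalgebra_coalgebra[OF coalgM coalgM], of F iMM] iMM
    by (auto simp: ev_def)
  have hl: "h \<in> Lin ?MM M" using h by (simp add: coalgebra_homs_def)
  have "is_product (\<lambda>x y. h (tens K M M x y))"
    unfolding is_product_def
  proof (intro conjI ballI)
    show "bilinear M M M (\<lambda>x y. h (tens K M M x y))" by (rule bilinear_of_tensor[OF hl mM mM])
    fix x y assume x: "x \<in> carrier M" and y: "y \<in> carrier M"
    have xy: "tens K M M x y \<in> carrier ?MM" using x y mM by simp
    have "comult M (h (tens K M M x y)) = ssum ?C ?MM (\<lambda>z1 z2. tens K M M (h z1) (h z2)) (tens K M M x y)"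
      using h xy tensor_map_comult[OF cC mM, of h] hl by (simp add: coalgebra_homs_def)
    also have "\<dots> = ssum M ?MM (\<lambda>x1 x2. ssum M ?MM (\<lambda>y1 y2.
        tens K M M (h (tens K M M x1 y1)) (h (tens K M M x2 y2))) y) x"
      by (rule ssum_tensor_coalgebra[OF cM cM MM bilinear_comp[OF bilinear_tens[OF mM mM] hl hl] x y])
    finally show "comult M (h (tens K M M x y)) = \<dots>" .
    show "counit M (h (tens K M M x y)) = counit M x \<otimes> counit M y"
      using h xy x y counit_tensor_coalgebra(2)[OF coalgM coalgM] by (simp add: coalgebra_homs_def)
    show "ev (h (tens K M M x y)) t = ssum T A (\<lambda>t1 t2. ev x t1 \<otimes>\<^bsub>A\<^esub> ev y t2) t" if "t \<in> carrier T" for t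
      using hF[OF xy that] F[OF x y that] by simp
  qed
  thus ?thesis by blast
qed

lemma counit_one_bilinear: "bilinear (ground_module K) T A (\<lambda>a t. (a \<otimes> counit T t) \<odot>\<^bsub>A\<^esub> \<one>\<^bsub>A\<^esub>)"
  by (rule bilinearI)
     (simp_all add: counit_closed[OF coalgT] linear_add[OF counit_linear[OF coalgT]] mA l_distr r_distr
       linear_smult[OF counit_linear[OF coalgT]] module_distr_left module_smult_smult[symmetric] m_ac)

lemma ex_unit: "\<exists>e. is_unit e"
proof -
  let ?K = "ground_module K" and ?G = "ground_coalgebra"
  note eT = counit_closed[OF coalgT]
  define F where "F = tensor_lift K ?K T A (\<lambda>a t. (a \<otimes> counit T t) \<odot>\<^bsub>A\<^esub> \<one>\<^bsub>A\<^esub>)"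
  have K: "module K ?K" by simp
  note Fl = tensor_lift_linear[OF K mT mA counit_one_bilinear, folded F_def]
  note F = tensor_lift_tens[OF K mT mA counit_one_bilinear, folded F_def, simplified]
  have "measuring K ?G T A F"
    unfolding measuring_iff[OF ground_comult_module mT multA] ground_coalgebra_simps
      ground_module_simps counit_ground_coalgebra
  proof (intro conjI ballI Fl)
    fix a assume a: "a \<in> carrier K"
    show "F (tens K ?K T a \<one>\<^bsub>T\<^esub>) = id a \<odot>\<^bsub>A\<^esub> \<one>\<^bsub>A\<^esub>"
      using bialgebra.counit_one[OF T] a oneT by (simp add: F)
    fix t s assume t: "t \<in> carrier T" and s: "s \<in> carrier T"
    have "ssum ?G A (\<lambda>c1 c2. F (tens K ?K T c1 t) \<otimes>\<^bsub>A\<^esub> F (tens K ?K T c2 s)) a =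
        F (tens K ?K T a t) \<otimes>\<^bsub>A\<^esub> F (tens K ?K T \<one> s)"
      by (rule ssum_ground[OF mA measuring_bilinear[OF K mT multA Fl t s] a])
    also have "\<dots> = F (tens K ?K T a (t \<otimes>\<^bsub>T\<^esub> s))"
      using a t s eT by (simp add: F multT_closed bialgebra.counit_mult[OF T] A_smult_mult A_simps(4) mA
          module_smult_smult[symmetric] m_ac)
    finally show "F (tens K ?K T a (t \<otimes>\<^bsub>T\<^esub> s)) =
        ssum ?G A (\<lambda>c1 c2. F (tens K ?K T c1 t) \<otimes>\<^bsub>A\<^esub> F (tens K ?K T c2 s)) a"
      by simp
  qed
  then obtain h where h: "h \<in> coalgebra_homs K ?G M"
    and hF: "\<And>a t. a \<in> carrier K \<Longrightarrow> t \<in> carrier T \<Longrightarrow> ev (h a) t = F (tens K ?K T a t)"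
    using ex_hom[OF ground_coalgebra_coalgebra, of F iK] iK by (auto simp: ev_def)
  have hl: "h \<in> Lin ?K M" using h by (simp add: coalgebra_homs_def)
  have MM: "module K (tensor K M M)" using mM by simp
  have "is_unit (h \<one>)"
    unfolding is_unit_def
  proof (intro conjI ballI)
    show "h \<one> \<in> carrier M" using linear_closed[OF hl] by simp
    have "comult M (h \<one>) = ssum ?G (tensor K M M) (\<lambda>x y. tens K M M (h x) (h y)) \<one>"
      using h tensor_map_comult[OF ground_comult_module mM, of h] hl by (simp add: coalgebra_homs_def)
    also have "\<dots> = tens K M M (h \<one>) (h \<one>)"
      by (rule ssum_ground[OF MM bilinear_comp[OF bilinear_tens[OF mM mM] hl hl] one_closed])
    finally show "comult M (h \<one>) = tens K M M (h \<one>) (h \<one>)" .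
    show "counit M (h \<one>) = \<one>" using h by (simp add: coalgebra_homs_def)
    show "ev (h \<one>) t = counit T t \<odot>\<^bsub>A\<^esub> \<one>\<^bsub>A\<^esub>" if "t \<in> carrier T" for t
      using hF[OF one_closed that] that eT by (simp add: F)
  qed
  thus ?thesis by blast
qed

section \<open>The bialgebra structure\<close>

context
  fixes m assumes m: "is_product m"
begin

lemma product_bilinear: "bilinear M M M m"
  using m by (simp add: is_product_def)

lemma product_closed: "x \<in> carrier M \<Longrightarrow> y \<in> carrier M \<Longrightarrow> m x y \<in> carrier M"
  by (rule bilinear_closed[OF product_bilinear])

lemma product_counit: "x \<in> carrier M \<Longrightarrow> y \<in> carrier M \<Longrightarrow> counit M (m x y) = counit M x \<otimes> counit M y"
  using m by (simp add: is_product_def)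

lemma product_ev: "x \<in> carrier M \<Longrightarrow> y \<in> carrier M \<Longrightarrow> t \<in> carrier T \<Longrightarrow>
    ev (m x y) t = ssum T A (\<lambda>t1 t2. ev x t1 \<otimes>\<^bsub>A\<^esub> ev y t2) t"
  using m by (simp add: is_product_def)

lemma product_ssum:
  assumes X: "module K X" and \<beta>: "bilinear M M X \<beta>" and x: "x \<in> carrier M" and y: "y \<in> carrier M"
  shows "ssum M X \<beta> (m x y) = ssum M X (\<lambda>x1 x2. ssum M X (\<lambda>y1 y2. \<beta> (m x1 y1) (m x2 y2)) y) x"
  by (rule ssum_of_comult2[OF cM cM cM X \<beta> x y product_closed[OF x y] product_closed])
     (use m x y in \<open>simp_all add: is_product_def\<close>)

end

context
  fixes e assumes e: "is_unit e"
begin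

lemma unit_closed: "e \<in> carrier M"
  using e by (simp add: is_unit_def)

lemma unit_counit: "counit M e = \<one>"
  using e by (simp add: is_unit_def)

lemma unit_ev: "t \<in> carrier T \<Longrightarrow> ev e t = counit T t \<odot>\<^bsub>A\<^esub> \<one>\<^bsub>A\<^esub>"
  using e by (simp add: is_unit_def)

lemma unit_ssum:
  assumes X: "module K X" and \<beta>: "bilinear M M X \<beta>"
  shows "ssum M X \<beta> e = \<beta> e e"
  using ssum_eq_tensor_lift[OF cM X \<beta> unit_closed] tensor_lift_tens[OF mM mM X \<beta> unit_closed unit_closed] e
  by (simp add: is_unit_def)

end

text \<open>
  For two products, the pairs of values on the same arguments are closed under comultiplication:
  \<open>\<Delta>\<close> of the product of \<open>x\<close> and \<open>y\<close> consists of the products of \<open>x\<^sub>1\<close>, \<open>y\<^sub>1\<close> and of \<open>x\<^sub>2\<close>, \<open>y\<^sub>2\<close>.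
\<close>

lemma product_unique:
  assumes m: "is_product m" and m': "is_product m'" and x: "x \<in> carrier M" and y: "y \<in> carrier M"
  shows "m x y = m' x y"
proof (rule coinduct[where R = "\<lambda>a b. \<exists>x\<in>carrier M. \<exists>y\<in>carrier M. a = m x y \<and> b = m' x y"])
  fix X :: "('k, ('u \<times> 'u \<Rightarrow> 'k) set) module" and \<beta> a b
  let ?R = "\<lambda>a b. \<exists>x\<in>carrier M. \<exists>y\<in>carrier M. a = m x y \<and> b = m' x y"
  assume X: "module K X" and \<beta>: "bilinear M M X \<beta>" and "?R a b"
    and l: "\<And>a b c. ?R a b \<Longrightarrow> c \<in> carrier M \<Longrightarrow> \<beta> a c = \<beta> b c"
    and r: "\<And>a b c. ?R a b \<Longrightarrow> c \<in> carrier M \<Longrightarrow> \<beta> c a = \<beta> c b"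
  then obtain x y where xy: "x \<in> carrier M" "y \<in> carrier M" "a = m x y" "b = m' x y" by blast
  have "\<beta> (m x1 y1) (m x2 y2) = \<beta> (m' x1 y1) (m' x2 y2)"
    if *: "x1 \<in> carrier M" "x2 \<in> carrier M" "y1 \<in> carrier M" "y2 \<in> carrier M" for x1 x2 y1 y2
  proof -
    have "\<beta> (m x1 y1) (m x2 y2) = \<beta> (m' x1 y1) (m x2 y2)"
      by (rule l) (use * product_closed[OF m] in blast)+
    also have "\<dots> = \<beta> (m' x1 y1) (m' x2 y2)"
      by (rule r) (use * product_closed[OF m'] in blast)+
    finally show ?thesis .
  qed
  thus "ssum M X \<beta> a = ssum M X \<beta> b"
    unfolding xy(3,4) product_ssum[OF m X \<beta> xy(1,2)] product_ssum[OF m' X \<beta> xy(1,2)]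
    by (intro ssum_cong[OF cM] xy(1,2))
qed (use x y product_closed[OF m] product_closed[OF m'] product_counit[OF m] product_counit[OF m']
    product_ev[OF m] product_ev[OF m'] in auto)

lemma unit_unique:
  assumes e: "is_unit e" and e': "is_unit e'"
  shows "e = e'"
proof (rule coinduct[where R = "\<lambda>a b. a = e \<and> b = e'"])
  fix X :: "('k, ('u \<times> 'u \<Rightarrow> 'k) set) module" and \<beta> a b
  assume X: "module K X" and \<beta>: "bilinear M M X \<beta>" and ab: "a = e \<and> b = e'"
    and l: "\<And>a b c. a = e \<and> b = e' \<Longrightarrow> c \<in> carrier M \<Longrightarrow> \<beta> a c = \<beta> b c"
    and r: "\<And>a b c. a = e \<and> b = e' \<Longrightarrow> c \<in> carrier M \<Longrightarrow> \<beta> c a = \<beta> c b"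
  have "\<beta> e e = \<beta> e' e'"
    using l[of e e' e] r[of e e' e'] unit_closed[OF e] unit_closed[OF e'] by simp
  thus "ssum M X \<beta> a = ssum M X \<beta> b"
    using ab by (simp add: unit_ssum[OF e X \<beta>] unit_ssum[OF e' X \<beta>])
qed (simp_all add: unit_closed unit_counit unit_ev e e')

lemma product_ssum_left:
  assumes m: "is_product m" and X: "module K X" and \<beta>: "bilinear M M X \<beta>"
    and x: "x \<in> carrier M" and y: "y \<in> carrier M" and z: "z \<in> carrier M"
  shows "ssum M X \<beta> (m (m x y) z) = ssum M X (\<lambda>x1 x2. ssum M X (\<lambda>y1 y2. ssum M X (\<lambda>z1 z2.
    \<beta> (m (m x1 y1) z1) (m (m x2 y2) z2)) z) y) x"
  unfolding product_ssum[OF m X \<beta> product_closed[OF m x y] z]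
  by (intro product_ssum[OF m X _ x y] ssum_param_bilinear[OF cM X z] bilinear_comp[OF \<beta>]
      bilinear_linear_left[OF product_bilinear[OF m]])

lemma product_ssum_right:
  assumes m: "is_product m" and X: "module K X" and \<beta>: "bilinear M M X \<beta>"
    and x: "x \<in> carrier M" and y: "y \<in> carrier M" and z: "z \<in> carrier M"
  shows "ssum M X \<beta> (m x (m y z)) = ssum M X (\<lambda>x1 x2. ssum M X (\<lambda>y1 y2. ssum M X (\<lambda>z1 z2.
    \<beta> (m x1 (m y1 z1)) (m x2 (m y2 z2))) z) y) x"
  unfolding product_ssum[OF m X \<beta> x product_closed[OF m y z]]
  by (intro ssum_cong[OF cM x] product_ssum[OF m X _ y z] bilinear_comp[OF \<beta>]
      bilinear_linear_right[OF product_bilinear[OF m]])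

lemma mult_mult_ev_trilinear:
  assumes x: "x \<in> carrier M" and y: "y \<in> carrier M" and z: "z \<in> carrier M"
  shows "trilinear T T T A (\<lambda>t1 t2 t3. (ev x t1 \<otimes>\<^bsub>A\<^esub> ev y t2) \<otimes>\<^bsub>A\<^esub> ev z t3)"
proof (rule trilinearI)
  note l = bilinear_linear_right[OF ev_bilinear]
  show "bilinear T T A (\<lambda>t1 t2. (ev x t1 \<otimes>\<^bsub>A\<^esub> ev y t2) \<otimes>\<^bsub>A\<^esub> ev z t3)" if "t3 \<in> carrier T" for t3
    by (rule bilinear_linear[OF mult_ev_bilinear_T[OF x y] mult_linear_left[OF multA ev_closed[OF z that]]])
  show "bilinear T T A (\<lambda>t2 t3. (ev x t1 \<otimes>\<^bsub>A\<^esub> ev y t2) \<otimes>\<^bsub>A\<^esub> ev z t3)" if "t1 \<in> carrier T" for t1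
    by (rule bilinear_comp[OF A_mult_bilinear linear_comp[OF l[OF y] mult_linear_right[OF multA ev_closed[OF x that]]] l[OF z]])
qed

text \<open>
  Both bracketings take the value \<open>x(t\<^sub>1) y(t\<^sub>2) z(t\<^sub>3)\<close> at \<open>t\<close> by coassociativity of \<open>T\<close>, and their
  comultiplications have the same shape by \<open>product_ssum_left\<close> and \<open>product_ssum_right\<close>.
\<close>

lemma product_assoc:
  assumes m: "is_product m" and x: "x \<in> carrier M" and y: "y \<in> carrier M" and z: "z \<in> carrier M"
  shows "m (m x y) z = m x (m y z)"
proof (rule coinduct[where R = "\<lambda>a b. \<exists>x\<in>carrier M. \<exists>y\<in>carrier M. \<exists>z\<in>carrier M.
    a = m (m x y) z \<and> b = m x (m y z)"])
  let ?R = "\<lambda>a b. \<exists>x\<in>carrier M. \<exists>y\<in>carrier M. \<exists>z\<in>carrier M. a = m (m x y) z \<and> b = m x (m y z)"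
  note cl = product_closed[OF m]
  show "?R (m (m x y) z) (m x (m y z))" using x y z by blast
  fix a b assume "?R a b"
  then obtain x y z where ab: "a = m (m x y) z" "b = m x (m y z)"
    and x: "x \<in> carrier M" and y: "y \<in> carrier M" and z: "z \<in> carrier M" by blast
  show "a \<in> carrier M \<and> b \<in> carrier M" using x y z by (simp add: ab cl)
  show "counit M a = counit M b"
    using x y z by (simp add: ab cl product_counit[OF m] counit_closed[OF coalgM] m_assoc)
  {
    fix t assume t: "t \<in> carrier T"
    have "ev a t = ssum T A (\<lambda>t1 t2. ssum T A (\<lambda>u v. (ev x u \<otimes>\<^bsub>A\<^esub> ev y v) \<otimes>\<^bsub>A\<^esub> ev z t2) t1) t"
      unfolding ab product_ev[OF m cl[OF x y] z t]
      by (intro ssum_cong[OF cT t]) (simp add: product_ev[OF m x y] ssum_mult_right[OF multA cT] x y z)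
    also have "\<dots> = ssum T A (\<lambda>t1 t2. ssum T A (\<lambda>u v. (ev x t1 \<otimes>\<^bsub>A\<^esub> ev y u) \<otimes>\<^bsub>A\<^esub> ev z v) t2) t"
      by (rule ssum_coassoc[OF coalgT mA t mult_mult_ev_trilinear[OF x y z]])
    also have "\<dots> = ssum T A (\<lambda>t1 t2. ssum T A (\<lambda>u v. ev x t1 \<otimes>\<^bsub>A\<^esub> (ev y u \<otimes>\<^bsub>A\<^esub> ev z v)) t2) t"
      by (intro ssum_cong[OF cT t] ssum_cong[OF cT]) (simp_all add: A_simps(2) x y z)
    also have "\<dots> = ev b t"
      unfolding ab product_ev[OF m x cl[OF y z] t]
      by (intro ssum_cong[OF cT t]) (simp add: product_ev[OF m y z] ssum_mult_left[OF multA cT] x y z)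
    finally show "ev a t = ev b t" .
  }
  fix X :: "('k, ('u \<times> 'u \<Rightarrow> 'k) set) module" and \<beta>
  assume X: "module K X" and \<beta>: "bilinear M M X \<beta>"
    and l: "\<And>a b c. ?R a b \<Longrightarrow> c \<in> carrier M \<Longrightarrow> \<beta> a c = \<beta> b c"
    and r: "\<And>a b c. ?R a b \<Longrightarrow> c \<in> carrier M \<Longrightarrow> \<beta> c a = \<beta> c b"
  have "\<beta> (m (m x1 y1) z1) (m (m x2 y2) z2) = \<beta> (m x1 (m y1 z1)) (m x2 (m y2 z2))"
    if *: "x1 \<in> carrier M" "x2 \<in> carrier M" "y1 \<in> carrier M" "y2 \<in> carrier M"
      "z1 \<in> carrier M" "z2 \<in> carrier M" for x1 x2 y1 y2 z1 z2
  proof -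
    have "\<beta> (m (m x1 y1) z1) (m (m x2 y2) z2) = \<beta> (m x1 (m y1 z1)) (m (m x2 y2) z2)"
      by (rule l) (use * cl in blast)+
    also have "\<dots> = \<beta> (m x1 (m y1 z1)) (m x2 (m y2 z2))"
      by (rule r) (use * cl in blast)+
    finally show ?thesis .
  qed
  thus "ssum M X \<beta> a = ssum M X \<beta> b"
    unfolding ab product_ssum_left[OF m X \<beta> x y z] product_ssum_right[OF m X \<beta> x y z]
    by (intro ssum_cong[OF cM] x y z)
qed

lemma unit_product:
  assumes m: "is_product m" and e: "is_unit e" and x: "x \<in> carrier M"
  shows "m e x = x" "m x e = x"
proof -
  note cl = product_closed[OF m] and ec = unit_closed[OF e]
  note cs = counit_closed[OF coalgM] counit_closed[OF coalgT]
  show "m e x = x"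
  proof (rule coinduct[where R = "\<lambda>a b. b \<in> carrier M \<and> a = m e b"])
    let ?R = "\<lambda>a b. b \<in> carrier M \<and> a = m e b"
    fix a b assume R: "?R a b"
    hence b: "b \<in> carrier M" and a: "a = m e b" by auto
    show "a \<in> carrier M \<and> b \<in> carrier M" by (simp add: a b cl ec)
    show "counit M a = counit M b" by (simp add: a b product_counit[OF m] ec unit_counit[OF e] cs)
    {
      fix t assume t: "t \<in> carrier T"
      have "ev a t = ssum T A (\<lambda>t1 t2. counit T t1 \<odot>\<^bsub>A\<^esub> ev b t2) t"
        unfolding a product_ev[OF m ec b t]
        by (intro ssum_cong[OF cT t]) (simp add: unit_ev[OF e] A_smult_mult cs b A_simps(4))
      also have "\<dots> = ev b t"
        by (rule ssum_counit_left[OF coalgT mA bilinear_linear_right[OF ev_bilinear b] t])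
      finally show "ev a t = ev b t" .
    }
    fix X :: "('k, ('u \<times> 'u \<Rightarrow> 'k) set) module" and \<beta>
    assume X: "module K X" and \<beta>: "bilinear M M X \<beta>"
      and l: "\<And>a b c. ?R a b \<Longrightarrow> c \<in> carrier M \<Longrightarrow> \<beta> a c = \<beta> b c"
      and r: "\<And>a b c. ?R a b \<Longrightarrow> c \<in> carrier M \<Longrightarrow> \<beta> c a = \<beta> c b"
    have "ssum M X \<beta> a = ssum M X (\<lambda>e1 e2. ssum M X (\<lambda>b1 b2. \<beta> (m e1 b1) (m e2 b2)) b) e"
      unfolding a by (rule product_ssum[OF m X \<beta> ec b])
    also have "\<dots> = ssum M X (\<lambda>b1 b2. \<beta> (m e b1) (m e b2)) b"
      by (intro unit_ssum[OF e X] ssum_param_bilinear[OF cM X b] bilinear_comp[OF \<beta>]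
          bilinear_linear_left[OF product_bilinear[OF m]])
    also have "\<dots> = ssum M X \<beta> b"
      using l r cl ec by (intro ssum_cong[OF cM b]) simp
    finally show "ssum M X \<beta> a = ssum M X \<beta> b" .
  qed (use x in simp)
  show "m x e = x"
  proof (rule coinduct[where R = "\<lambda>a b. b \<in> carrier M \<and> a = m b e"])
    let ?R = "\<lambda>a b. b \<in> carrier M \<and> a = m b e"
    fix a b assume R: "?R a b"
    hence b: "b \<in> carrier M" and a: "a = m b e" by auto
    show "a \<in> carrier M \<and> b \<in> carrier M" by (simp add: a b cl ec)
    show "counit M a = counit M b" by (simp add: a b product_counit[OF m] ec unit_counit[OF e] cs)
    {
      fix t assume t: "t \<in> carrier T"
      have "ev a t = ssum T A (\<lambda>t1 t2. counit T t2 \<odot>\<^bsub>A\<^esub> ev b t1) t"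
        unfolding a product_ev[OF m b ec t]
        by (intro ssum_cong[OF cT t]) (simp add: unit_ev[OF e] A_smult_mult cs b A_simps(5))
      also have "\<dots> = ev b t"
        by (rule ssum_counit_right[OF coalgT mA bilinear_linear_right[OF ev_bilinear b] t])
      finally show "ev a t = ev b t" .
    }
    fix X :: "('k, ('u \<times> 'u \<Rightarrow> 'k) set) module" and \<beta>
    assume X: "module K X" and \<beta>: "bilinear M M X \<beta>"
      and l: "\<And>a b c. ?R a b \<Longrightarrow> c \<in> carrier M \<Longrightarrow> \<beta> a c = \<beta> b c"
      and r: "\<And>a b c. ?R a b \<Longrightarrow> c \<in> carrier M \<Longrightarrow> \<beta> c a = \<beta> c b"
    have "ssum M X \<beta> a = ssum M X (\<lambda>b1 b2. ssum M X (\<lambda>e1 e2. \<beta> (m b1 e1) (m b2 e2)) e) b"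
      unfolding a by (rule product_ssum[OF m X \<beta> b ec])
    also have "\<dots> = ssum M X (\<lambda>b1 b2. \<beta> (m b1 e) (m b2 e)) b"
      by (intro ssum_cong[OF cM b] unit_ssum[OF e X] bilinear_comp[OF \<beta>]
          bilinear_linear_right[OF product_bilinear[OF m]])
    also have "\<dots> = ssum M X \<beta> b"
      using l r cl ec by (intro ssum_cong[OF cM b]) simp
    finally show "ssum M X \<beta> a = ssum M X \<beta> b" .
  qed (use x in simp)
qed

text \<open>
  Together with the converse below, this reduces the statements about algebra structures on \<open>M\<close> to
  the predicates \<open>is_product\<close> and \<open>is_unit\<close>.
\<close>

lemma structure_of_product:
  assumes m: "is_product m" and e: "is_unit e"
  shows "bialgebra K (M\<lparr>mult := m, one := e\<rparr>)" "measures_right K (M\<lparr>mult := m, one := e\<rparr>) T A \<theta>"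
proof -
  let ?M = "M\<lparr>mult := m, one := e\<rparr>"
  note cl = product_closed[OF m] and ec = unit_closed[OF e]
  note b = product_bilinear[OF m]
  have mM': "module K ?M" using mM by simp
  have ring: "ring ?M"
  proof (rule ringI)
    show "abelian_group ?M" by (rule module_abelian_group[OF mM'])
    show "Group.monoid ?M"
      by (rule Group.monoidI) (simp_all add: cl ec product_assoc[OF m] unit_product[OF m e])
  qed (simp_all add: bilinear_add_left[OF b] bilinear_add_right[OF b])
  have alg: "assoc_algebra K ?M"
    by (intro assoc_algebra.intro mM' ring assoc_algebra_axioms.intro)
       (simp_all add: bilinear_smult_left[OF b] bilinear_smult_right[OF b])
  show "bialgebra K ?M"
    by (rule bialgebraI[OF alg])
       (use m e coalgM in \<open>simp_all add: is_product_def is_unit_def\<close>)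
  show "measures_right K ?M T A \<theta>"
    unfolding measures_right_iff[OF cT mM' multA]
    using \<theta>_linear product_ev[OF m] unit_ev[OF e] by (simp add: ev_def)
qed

lemma product_of_structure:
  assumes B: "bialgebra K (M\<lparr>mult := m, one := e\<rparr>)" and r: "measures_right K (M\<lparr>mult := m, one := e\<rparr>) T A \<theta>"
  shows "is_product m" "is_unit e"
proof -
  let ?M = "M\<lparr>mult := m, one := e\<rparr>"
  have mM': "module K ?M" using mM by simp
  note r = r[unfolded measures_right_iff[OF cT mM' multA]]
  show "is_product m"
    unfolding is_product_def
    using bialgebra_mult_algebra[OF B] bialgebra_comult_mult[OF B] bialgebra.counit_mult[OF B] r
    by (simp add: mult_algebra_def ev_def)
  show "is_unit e"
    unfolding is_unit_def
    using bialgebra_one_closed[OF B] bialgebra.comult_one[OF B] bialgebra.counit_one[OF B] r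
    by (simp add: ev_def)
qed

lemma ex1_structure: "\<exists>!s. measured_bialgebra_structure K T A M \<theta> s"
proof -
  obtain m e where m: "is_product m" and e: "is_unit e" using ex_product ex_unit by blast
  \<comment> \<open>The bialgebra axioms determine a product only on the carrier; \<open>m0\<close> is its extensional version.\<close>
  define m0 where "m0 = (\<lambda>x\<in>carrier M. \<lambda>y\<in>carrier M. m x y)"
  have m0: "is_product m0"
  proof -
    have eq: "m0 x y = m x y" if "x \<in> carrier M" "y \<in> carrier M" for x y using that by (simp add: m0_def)
    have "bilinear M M M m0" using bilinear_cong[OF mM mM, of m0 m M] eq product_bilinear[OF m] by blast
    moreover have "ssum M (tensor K M M) (\<lambda>x1 x2. ssum M (tensor K M M) (\<lambda>y1 y2. tens K M M (m0 x1 y1) (m0 x2 y2)) y) x =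
      ssum M (tensor K M M) (\<lambda>x1 x2. ssum M (tensor K M M) (\<lambda>y1 y2. tens K M M (m x1 y1) (m x2 y2)) y) x"
      if "x \<in> carrier M" "y \<in> carrier M" for x y
      by (intro ssum_cong[OF cM that(1)] ssum_cong[OF cM that(2)]) (simp add: eq)
    ultimately show ?thesis using m by (simp add: is_product_def eq)
  qed
  show ?thesis
  proof (rule ex1I)
    show "measured_bialgebra_structure K T A M \<theta> (m0, e)"
      unfolding measured_bialgebra_structure_def prod.case
    proof (intro conjI structure_of_product[OF m0 e])
      show "m0 \<in> carrier M \<rightarrow>\<^sub>E carrier M \<rightarrow>\<^sub>E carrier M"
        using product_closed[OF m] by (auto simp: m0_def)
    qed
    fix s assume s: "measured_bialgebra_structure K T A M \<theta> s"
    obtain m' e' where s': "s = (m', e')" by (cases s)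
    note s = s[unfolded s' measured_bialgebra_structure_def prod.case]
    from s have m': "is_product m'" and e': "is_unit e'" and ext: "m' \<in> carrier M \<rightarrow>\<^sub>E carrier M \<rightarrow>\<^sub>E carrier M"
      using product_of_structure by blast+
    have "m' x = m0 x" for x
    proof (cases "x \<in> carrier M")
      case True
      have "m' x y = m0 x y" if "y \<in> carrier M" for y by (rule product_unique[OF m' m0 True that])
      moreover have "m' x \<in> extensional (carrier M)" "m0 x \<in> extensional (carrier M)"
        using True ext by (auto simp: PiE_iff m0_def)
      ultimately show ?thesis by (intro extensionalityI[of _ "carrier M"])
    next
      case False
      thus ?thesis using PiE_arb[OF ext False] by (simp add: m0_def)
    qed
    thus "s = (m0, e)" using unit_unique[OF e' e] by (simp add: s' fun_eq_iff)
  qed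
qed

section \<open>Universality among bimeasurings\<close>

text \<open>
  The pairs \<open>h(n n')\<close>, \<open>h(n) h(n')\<close> are closed under comultiplication, because \<open>h\<close> and the product of
  \<open>M\<close> are coalgebra maps and the comultiplication of \<open>N\<close> is multiplicative.
\<close>

lemma hom_product:
  assumes m: "is_product m" and N: "bialgebra K N" and h: "h \<in> coalgebra_homs K N M"
    and ev: "\<And>n n' t. n \<in> carrier N \<Longrightarrow> n' \<in> carrier N \<Longrightarrow> t \<in> carrier T \<Longrightarrow>
      ev (h (n \<otimes>\<^bsub>N\<^esub> n')) t = ssum T A (\<lambda>t1 t2. ev (h n) t1 \<otimes>\<^bsub>A\<^esub> ev (h n') t2) t"
    and n: "n \<in> carrier N" and n': "n' \<in> carrier N"
  shows "h (n \<otimes>\<^bsub>N\<^esub> n') = m (h n) (h n')"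
proof (rule coinduct[where R = "\<lambda>a b. \<exists>n\<in>carrier N. \<exists>n'\<in>carrier N. a = h (n \<otimes>\<^bsub>N\<^esub> n') \<and> b = m (h n) (h n')"])
  let ?R = "\<lambda>a b. \<exists>n\<in>carrier N. \<exists>n'\<in>carrier N. a = h (n \<otimes>\<^bsub>N\<^esub> n') \<and> b = m (h n) (h n')"
  note cN = coalgebra_comult_module[OF bialgebra_coalgebra[OF N]]
  note nc = mult_closed[OF bialgebra_mult_algebra[OF N]] and mc = product_closed[OF m]
  have hl: "h \<in> Lin N M" using h by (simp add: coalgebra_homs_def)
  note hc = linear_closed[OF hl]
  note mb = product_bilinear[OF m]
  show "?R (h (n \<otimes>\<^bsub>N\<^esub> n')) (m (h n) (h n'))" using n n' by blast
  fix a b assume "?R a b"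
  then obtain n n' where n: "n \<in> carrier N" and n': "n' \<in> carrier N"
    and a: "a = h (n \<otimes>\<^bsub>N\<^esub> n')" and b: "b = m (h n) (h n')" by blast
  show "a \<in> carrier M \<and> b \<in> carrier M" using n n' by (simp add: a b nc mc hc)
  show "counit M a = counit M b"
    using h n n' by (simp add: a b nc hc product_counit[OF m] coalgebra_homs_def bialgebra.counit_mult[OF N])
  show "ev a t = ev b t" if "t \<in> carrier T" for t
    using ev[OF n n' that] n n' that by (simp add: a b product_ev[OF m] hc)
  fix X :: "('k, ('u \<times> 'u \<Rightarrow> 'k) set) module" and \<beta>
  assume X: "module K X" and \<beta>: "bilinear M M X \<beta>"
    and l: "\<And>a b c. ?R a b \<Longrightarrow> c \<in> carrier M \<Longrightarrow> \<beta> a c = \<beta> b c"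
    and r: "\<And>a b c. ?R a b \<Longrightarrow> c \<in> carrier M \<Longrightarrow> \<beta> c a = \<beta> c b"
  have eq: "\<beta> (h (x1 \<otimes>\<^bsub>N\<^esub> y1)) (h (x2 \<otimes>\<^bsub>N\<^esub> y2)) = \<beta> (m (h x1) (h y1)) (m (h x2) (h y2))"
    if *: "x1 \<in> carrier N" "x2 \<in> carrier N" "y1 \<in> carrier N" "y2 \<in> carrier N" for x1 x2 y1 y2
  proof -
    have "\<beta> (h (x1 \<otimes>\<^bsub>N\<^esub> y1)) (h (x2 \<otimes>\<^bsub>N\<^esub> y2)) = \<beta> (m (h x1) (h y1)) (h (x2 \<otimes>\<^bsub>N\<^esub> y2))"
      by (rule l) (use * nc hc in blast)+
    also have "\<dots> = \<beta> (m (h x1) (h y1)) (m (h x2) (h y2))"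
      by (rule r) (use * mc hc in blast)+
    finally show ?thesis .
  qed
  have "ssum M X \<beta> a = ssum N X (\<lambda>x y. \<beta> (h x) (h y)) (n \<otimes>\<^bsub>N\<^esub> n')"
    unfolding a by (rule ssum_hom[OF cN cM X \<beta> h nc[OF n n']])
  also have "\<dots> = ssum N X (\<lambda>x1 x2. ssum N X (\<lambda>y1 y2. \<beta> (h (x1 \<otimes>\<^bsub>N\<^esub> y1)) (h (x2 \<otimes>\<^bsub>N\<^esub> y2))) n') n"
    by (rule bialgebra_ssum_mult[OF N X bilinear_comp[OF \<beta> hl hl] n n'])
  also have "\<dots> = ssum N X (\<lambda>x1 x2. ssum N X (\<lambda>y1 y2. \<beta> (m (h x1) (h y1)) (m (h x2) (h y2))) n') n"
    by (intro ssum_cong[OF cN n] ssum_cong[OF cN n'] eq)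
  also have "\<dots> = ssum N X (\<lambda>x1 x2. ssum M X (\<lambda>y1 y2. \<beta> (m (h x1) y1) (m (h x2) y2)) (h n')) n"
    by (intro ssum_cong[OF cN n] ssum_hom[OF cN cM X _ h n', symmetric] bilinear_comp[OF \<beta>]
        bilinear_linear_right[OF mb] hc)
  also have "\<dots> = ssum M X (\<lambda>x1 x2. ssum M X (\<lambda>y1 y2. \<beta> (m x1 y1) (m x2 y2)) (h n')) (h n)"
    by (intro ssum_hom[OF cN cM X _ h n, symmetric] ssum_param_bilinear[OF cM X hc[OF n']] bilinear_comp[OF \<beta>]
        bilinear_linear_left[OF mb])
  also have "\<dots> = ssum M X \<beta> b"
    unfolding b by (rule product_ssum[OF m X \<beta> hc[OF n] hc[OF n'], symmetric])
  finally show "ssum M X \<beta> a = ssum M X \<beta> b" .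
qed

text \<open>
  The image of the unit of \<open>N\<close> is grouplike, hence a unit in the sense of \<open>is_unit\<close>, and the unit is
  unique.
\<close>

lemma hom_unit:
  assumes e: "is_unit e" and N: "bialgebra K N" and h: "h \<in> coalgebra_homs K N M"
    and ev: "\<And>t. t \<in> carrier T \<Longrightarrow> ev (h \<one>\<^bsub>N\<^esub>) t = counit T t \<odot>\<^bsub>A\<^esub> \<one>\<^bsub>A\<^esub>"
  shows "h \<one>\<^bsub>N\<^esub> = e"
proof (rule unit_unique[OF _ e])
  note cN = coalgebra_comult_module[OF bialgebra_coalgebra[OF N]]
  note n1 = bialgebra_one_closed[OF N]
  have hl: "h \<in> Lin N M" using h by (simp add: coalgebra_homs_def)
  have MM: "module K (tensor K M M)" using mM by simp
  have "comult M (h \<one>\<^bsub>N\<^esub>) = ssum N (tensor K M M) (\<lambda>x y. tens K M M (h x) (h y)) \<one>\<^bsub>N\<^esub>"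
    using h n1 tensor_map_comult[OF cN mM hl] by (simp add: coalgebra_homs_def)
  also have "\<dots> = tens K M M (h \<one>\<^bsub>N\<^esub>) (h \<one>\<^bsub>N\<^esub>)"
    by (rule bialgebra_ssum_one[OF N MM bilinear_comp[OF bilinear_tens[OF mM mM] hl hl]])
  finally show "is_unit (h \<one>\<^bsub>N\<^esub>)"
    using h n1 ev linear_closed[OF hl n1] bialgebra.counit_one[OF N]
    by (simp add: is_unit_def coalgebra_homs_def)
qed

lemma universal_bimeasuring_structure:
  fixes iN :: "'n \<Rightarrow> 'u"
  assumes m: "is_product m" and e: "is_unit e" and iN: "inj iN"
  shows "universal_bimeasuring TYPE('n) K T A (M\<lparr>mult := m, one := e\<rparr>) \<theta>"
  unfolding universal_bimeasuring_def
proof (intro conjI allI impI)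
  let ?M = "M\<lparr>mult := m, one := e\<rparr>"
  show "bialgebra K ?M" by (rule structure_of_product[OF m e])
  have "measuring K ?M T A \<theta>" using \<theta>_measuring by (simp add: measuring_def)
  thus "bimeasuring K ?M T A \<theta>"
    unfolding bimeasuring_def using structure_of_product(2)[OF m e] by blast
  fix N :: "('k, 'n) coalgebra" and f
  assume "bialgebra K N \<and> bimeasuring K N T A f"
  hence N: "bialgebra K N" and f: "measuring K N T A f" "measures_right K N T A f"
    by (auto simp: bimeasuring_def)
  note cN = coalgebra_comult_module[OF bialgebra_coalgebra[OF N]]
  note mN = comult_module_module[OF cN]
  note n1 = bialgebra_one_closed[OF N]
  note fr = f(2)[unfolded measures_right_iff[OF cT mN multA]]
  have fl: "f \<in> Lin (tensor K N T) A" using f by (simp add: measuring_def)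
  have homs: "coalgebra_homs K N ?M = coalgebra_homs K N M"
    by (simp add: coalgebra_homs_def tensor_map_def)
  have tm: "tensor_map K N T ?M T = tensor_map K N T M T"
    by (simp add: tensor_map_def fun_eq_iff)
  have iff: "(\<forall>z\<in>carrier (tensor K N T). f z = \<theta> (tensor_map K N T ?M T h id z)) \<longleftrightarrow>
    (\<forall>n\<in>carrier N. \<forall>t\<in>carrier T. ev (h n) t = f (tens K N T n t))" if "h \<in> coalgebra_homs K N M" for h
    unfolding tm by (rule induced_iff[OF cN fl that])
  obtain h where h: "h \<in> coalgebra_homs K N M"
    and hf: "\<And>n t. n \<in> carrier N \<Longrightarrow> t \<in> carrier T \<Longrightarrow> ev (h n) t = f (tens K N T n t)"
    using ex_hom[OF bialgebra_coalgebra[OF N] f(1), of iN] iN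
    by (auto simp: ev_def inj_on_def)
  define g where "g = restrict h (carrier N)"
  have hl: "h \<in> Lin N M" using h by (simp add: coalgebra_homs_def)
  have gl: "g \<in> Lin N M"
    using hl mN by (auto simp: g_def linear_maps_def)
  have g: "g \<in> coalgebra_homs K N M"
  proof (rule coalgebra_homsI[OF cN mM gl])
    fix n assume n: "n \<in> carrier N"
    show "counit M (g n) = counit N n" using h n by (simp add: coalgebra_homs_def g_def)
    have "comult M (g n) = ssum N (tensor K M M) (\<lambda>x y. tens K M M (h x) (h y)) n"
      using h n tensor_map_comult[OF cN mM hl n] by (simp add: coalgebra_homs_def g_def)
    also have "\<dots> = ssum N (tensor K M M) (\<lambda>x y. tens K M M (g x) (g y)) n"
      by (rule ssum_cong[OF cN n]) (simp add: g_def)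
    finally show "comult M (g n) = \<dots>" .
  qed
  have gf: "ev (g n) t = f (tens K N T n t)" if "n \<in> carrier N" "t \<in> carrier T" for n t
    using hf[OF that] that by (simp add: g_def)
  show "\<exists>!h. h \<in> extensional (carrier N) \<and> h \<in> bialgebra_homs K N ?M \<and>
              (\<forall>z\<in>carrier (tensor K N T). f z = \<theta> (tensor_map K N T ?M T h id z))"
  proof (intro ex1I[of _ g] conjI)
    show "g \<in> extensional (carrier N)" by (simp add: g_def)
    show "\<forall>z\<in>carrier (tensor K N T). f z = \<theta> (tensor_map K N T ?M T g id z)"
      using iff[OF g] gf by blast
    have "g (n \<otimes>\<^bsub>N\<^esub> n') = m (g n) (g n')" if "n \<in> carrier N" "n' \<in> carrier N" for n n'
    proof (rule hom_product[OF m N g _ that])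
      fix n n' t assume n: "n \<in> carrier N" "n' \<in> carrier N" and t: "t \<in> carrier T"
      have "ev (g (n \<otimes>\<^bsub>N\<^esub> n')) t = ssum T A (\<lambda>t1 t2. f (tens K N T n t1) \<otimes>\<^bsub>A\<^esub> f (tens K N T n' t2)) t"
        using fr n t mult_closed[OF bialgebra_mult_algebra[OF N]] by (simp add: gf)
      also have "\<dots> = ssum T A (\<lambda>t1 t2. ev (g n) t1 \<otimes>\<^bsub>A\<^esub> ev (g n') t2) t"
        by (rule ssum_cong[OF cT t]) (simp add: gf n)
      finally show "ev (g (n \<otimes>\<^bsub>N\<^esub> n')) t = \<dots>" .
    qed
    moreover have "g \<one>\<^bsub>N\<^esub> = e"
      by (rule hom_unit[OF e N g]) (use fr n1 gf in simp)
    ultimately have "g \<in> ring_hom N ?M"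
      using linear_closed[OF gl] by (auto simp: ring_hom_def linear_add[OF gl])
    thus "g \<in> bialgebra_homs K N ?M" using g by (simp add: bialgebra_homs_def homs)
    fix h' assume h': "h' \<in> extensional (carrier N) \<and> h' \<in> bialgebra_homs K N ?M \<and>
              (\<forall>z\<in>carrier (tensor K N T). f z = \<theta> (tensor_map K N T ?M T h' id z))"
    hence h'M: "h' \<in> coalgebra_homs K N M" by (simp add: bialgebra_homs_def homs)
    have "ev (h' n) t = f (tens K N T n t)" if "n \<in> carrier N" "t \<in> carrier T" for n t
      using iff[OF h'M] h' that by blast
    hence "h' n = g n" if "n \<in> carrier N" for n
      by (intro hom_eqI[OF cN h'M g _ that]) (simp add: gf)
    thus "h' = g"
      using h' by (intro extensionalityI[of _ "carrier N"]) (auto simp: g_def)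
  qed
qed

section \<open>The antipode of the universal bimeasuring bialgebra\<close>

text \<open>
  \<open>x(S(t s)) = x(S(s) S(t)) = x\<^sub>1(S s) x\<^sub>2(S t)\<close>, so \<open>x \<otimes> t \<mapsto> x(S t)\<close> is a measuring by the co-opposite
  coalgebra.
\<close>

lemma ex_antipode_map:
  assumes S: "is_antipode T S"
  shows "\<exists>h\<in>Lin M M. \<forall>x\<in>carrier M.
    comult M (h x) = ssum M (tensor K M M) (\<lambda>x1 x2. tens K M M (h x2) (h x1)) x \<and>
    counit M (h x) = counit M x \<and> (\<forall>t\<in>carrier T. ev (h x) t = ev x (S t))"
proof -
  let ?C = "coopposite M"
  have Sl: "S \<in> Lin T T" using S by (simp add: is_antipode_def)
  note Sc = linear_closed[OF Sl]
  note C = coopposite_coalgebra[OF coalgM]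
  note cC = coopposite_comult_module[OF cM]
  have b: "bilinear M T A (\<lambda>x t. ev x (S t))"
    using bilinear_comp[OF ev_bilinear linear_id Sl] by simp
  define F where "F = tensor_lift K M T A (\<lambda>x t. ev x (S t))"
  note Fl = tensor_lift_linear[OF mM mT mA b, folded F_def]
  note F = tensor_lift_tens[OF mM mT mA b, folded F_def]
  have "measuring K ?C T A F"
    unfolding measuring_iff[OF cC mT multA] coopposite_simps counit_coopposite
  proof (intro conjI ballI Fl)
    fix x assume x: "x \<in> carrier M"
    show "F (tens K M T x \<one>\<^bsub>T\<^esub>) = counit M x \<odot>\<^bsub>A\<^esub> \<one>\<^bsub>A\<^esub>"
      using x oneT by (simp add: F antipode_one[OF T S] ev_one)
    fix t s assume t: "t \<in> carrier T" and s: "s \<in> carrier T"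
    have "F (tens K M T x (t \<otimes>\<^bsub>T\<^esub> s)) = ssum M A (\<lambda>x1 x2. ev x1 (S s) \<otimes>\<^bsub>A\<^esub> ev x2 (S t)) x"
      using x t s by (simp add: F multT_closed antipode_mult[OF T S] ev_mult Sc)
    also have "\<dots> = ssum M A (\<lambda>x1 x2. F (tens K M T x2 t) \<otimes>\<^bsub>A\<^esub> F (tens K M T x1 s)) x"
      by (rule ssum_cong[OF cM x]) (simp add: F t s A_simps(1) Sc)
    also have "\<dots> = ssum ?C A (\<lambda>x1 x2. F (tens K M T x1 t) \<otimes>\<^bsub>A\<^esub> F (tens K M T x2 s)) x"
      by (rule ssum_coopposite[OF cM mA measuring_bilinear[OF mM mT multA Fl t s] x, symmetric])
    finally show "F (tens K M T x (t \<otimes>\<^bsub>T\<^esub> s)) = \<dots>" .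
  qed
  then obtain h where h: "h \<in> coalgebra_homs K ?C M"
    and hF: "\<And>x t. x \<in> carrier M \<Longrightarrow> t \<in> carrier T \<Longrightarrow> ev (h x) t = F (tens K M T x t)"
    using ex_hom[OF C, of F iM] iM by (auto simp: ev_def)
  have hl: "h \<in> Lin M M" using h by (simp add: coalgebra_homs_def)
  have MM: "module K (tensor K M M)" using mM by simp
  show ?thesis
  proof (intro bexI[OF _ hl] ballI conjI)
    fix x assume x: "x \<in> carrier M"
    have "comult M (h x) = ssum ?C (tensor K M M) (\<lambda>x1 x2. tens K M M (h x1) (h x2)) x"
      using h x tensor_map_comult[OF cC mM, of h x] hl by (simp add: coalgebra_homs_def)
    also have "\<dots> = ssum M (tensor K M M) (\<lambda>x1 x2. tens K M M (h x2) (h x1)) x"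
      by (rule ssum_coopposite[OF cM MM bilinear_comp[OF bilinear_tens[OF mM mM] hl hl] x])
    finally show "comult M (h x) = \<dots>" .
    show "counit M (h x) = counit M x" using h x by (simp add: coalgebra_homs_def)
    show "ev (h x) t = ev x (S t)" if "t \<in> carrier T" for t
      using hF[OF x that] F[OF x that] by simp
  qed
qed

text \<open>
  The coinduction principle for the pairs \<open>\<phi>(x)\<close>, \<open>\<epsilon>(x) e\<close>. In the step, \<open>\<phi>(u)\<close> may be replaced by
  \<open>\<epsilon>(u) e\<close> in either factor.
\<close>

lemma scaled_unit_eqI:
  assumes e: "is_unit e" and \<phi>: "\<phi> \<in> Lin M M"
    and counit: "\<And>x. x \<in> carrier M \<Longrightarrow> counit M (\<phi> x) = counit M x"
    and ev: "\<And>x t. x \<in> carrier M \<Longrightarrow> t \<in> carrier T \<Longrightarrow>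
      ev (\<phi> x) t = counit T t \<odot>\<^bsub>A\<^esub> (counit M x \<odot>\<^bsub>A\<^esub> \<one>\<^bsub>A\<^esub>)"
    and comult: "\<And>(X :: ('k, ('u \<times> 'u \<Rightarrow> 'k) set) module) \<beta> x.
      x \<in> carrier M \<Longrightarrow> module K X \<Longrightarrow> bilinear M M X \<beta> \<Longrightarrow>
      (\<And>u v. u \<in> carrier M \<Longrightarrow> v \<in> carrier M \<Longrightarrow> \<beta> (\<phi> u) v = counit M u \<odot>\<^bsub>X\<^esub> \<beta> e v) \<Longrightarrow>
      (\<And>u v. u \<in> carrier M \<Longrightarrow> v \<in> carrier M \<Longrightarrow> \<beta> v (\<phi> u) = counit M u \<odot>\<^bsub>X\<^esub> \<beta> v e) \<Longrightarrow>
      ssum M X \<beta> (\<phi> x) = counit M x \<odot>\<^bsub>X\<^esub> \<beta> e e"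
    and x: "x \<in> carrier M"
  shows "\<phi> x = counit M x \<odot>\<^bsub>M\<^esub> e"
proof (rule coinduct[where R = "\<lambda>a b. \<exists>x\<in>carrier M. a = \<phi> x \<and> b = counit M x \<odot>\<^bsub>M\<^esub> e"])
  let ?R = "\<lambda>a b. \<exists>x\<in>carrier M. a = \<phi> x \<and> b = counit M x \<odot>\<^bsub>M\<^esub> e"
  note ec = unit_closed[OF e] and \<phi>c = linear_closed[OF \<phi>] and cs = counit_closed[OF coalgM]
  show "?R (\<phi> x) (counit M x \<odot>\<^bsub>M\<^esub> e)" using x by blast
  fix a b assume "?R a b"
  then obtain x where x: "x \<in> carrier M" and a: "a = \<phi> x" and b: "b = counit M x \<odot>\<^bsub>M\<^esub> e" by blast
  show "a \<in> carrier M \<and> b \<in> carrier M" using x by (simp add: a b \<phi>c cs ec mM)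
  show "counit M a = counit M b"
    using linear_smult[OF counit_linear[OF coalgM] _ ec] x by (simp add: a b counit cs unit_counit[OF e])
  show "ev a t = ev b t" if "t \<in> carrier T" for t
    using linear_smult[OF bilinear_linear_left[OF ev_bilinear that] _ ec] that x
    by (simp add: a b ev cs counit_closed[OF coalgT] unit_ev[OF e] module_smult_comm[OF mA, of "counit T t"])
  fix X :: "('k, ('u \<times> 'u \<Rightarrow> 'k) set) module" and \<beta>
  assume X: "module K X" and \<beta>: "bilinear M M X \<beta>"
    and l: "\<And>a b c. ?R a b \<Longrightarrow> c \<in> carrier M \<Longrightarrow> \<beta> a c = \<beta> b c"
    and r: "\<And>a b c. ?R a b \<Longrightarrow> c \<in> carrier M \<Longrightarrow> \<beta> c a = \<beta> c b"
  have "\<beta> (\<phi> u) v = counit M u \<odot>\<^bsub>X\<^esub> \<beta> e v" "\<beta> v (\<phi> u) = counit M u \<odot>\<^bsub>X\<^esub> \<beta> v e"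
    if "u \<in> carrier M" "v \<in> carrier M" for u v
  proof -
    have "?R (\<phi> u) (counit M u \<odot>\<^bsub>M\<^esub> e)" using that by blast
    from l[OF this that(2)] r[OF this that(2)]
    show "\<beta> (\<phi> u) v = counit M u \<odot>\<^bsub>X\<^esub> \<beta> e v" "\<beta> v (\<phi> u) = counit M u \<odot>\<^bsub>X\<^esub> \<beta> v e"
      using that by (simp_all add: bilinear_smult_left[OF \<beta> cs ec] bilinear_smult_right[OF \<beta> cs _ ec])
  qed
  from comult[OF x X \<beta> this] have "ssum M X \<beta> a = counit M x \<odot>\<^bsub>X\<^esub> \<beta> e e" by (simp add: a)
  also have "\<dots> = ssum M X \<beta> b"
    using linear_smult[OF ssum_arg_linear[OF cM X \<beta>] cs[OF x] ec] unit_ssum[OF e X \<beta>] by (simp add: b)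
  finally show "ssum M X \<beta> a = ssum M X \<beta> b" .
qed

context
  fixes m e h S
  assumes m: "is_product m" and e: "is_unit e" and S: "is_antipode T S" and hl: "h \<in> Lin M M"
    and hcomult: "\<And>x. x \<in> carrier M \<Longrightarrow>
      comult M (h x) = ssum M (tensor K M M) (\<lambda>x1 x2. tens K M M (h x2) (h x1)) x"
    and hcounit: "\<And>x. x \<in> carrier M \<Longrightarrow> counit M (h x) = counit M x"
    and hev: "\<And>x t. x \<in> carrier M \<Longrightarrow> t \<in> carrier T \<Longrightarrow> ev (h x) t = ev x (S t)"
begin

lemma antipode_map_ssum:
  assumes X: "module K X" and \<beta>: "bilinear M M X \<beta>" and x: "x \<in> carrier M"
  shows "ssum M X \<beta> (h x) = ssum M X (\<lambda>x1 x2. \<beta> (h x2) (h x1)) x"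
  by (rule ssum_of_comult[OF cM cM X \<beta> x])
     (use x linear_closed[OF hl] in \<open>simp_all add: hcomult\<close>)

text \<open>
  With four Sweedler components \<open>a\<close>, \<open>b\<close>, \<open>c\<close>, \<open>d\<close> of \<open>x\<close>, the comultiplication of \<open>h(x\<^sub>1) x\<^sub>2\<close> is
  \<open>h(b) c \<otimes> h(a) d\<close>. Coassociativity joins the inner components \<open>b\<close> and \<open>c\<close> to a value of \<open>\<phi>\<close>, which is
  replaced by a multiple of \<open>e\<close>; the counit law then leaves \<open>e \<otimes> h(a) d\<close>, that is \<open>e \<otimes> \<phi>(x)\<close>.
\<close>

lemma left_antipode:
  assumes x: "x \<in> carrier M"
  shows "ssum M M (\<lambda>x1 x2. m (h x1) x2) x = counit M x \<odot>\<^bsub>M\<^esub> e"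
proof (rule scaled_unit_eqI[OF e _ _ _ _ x])
  let ?\<phi> = "ssum M M (\<lambda>x1 x2. m (h x1) x2)"
  note ec = unit_closed[OF e] and mc = product_closed[OF m] and hc = linear_closed[OF hl]
  note mb = product_bilinear[OF m]
  have \<phi>b: "bilinear M M M (\<lambda>x1 x2. m (h x1) x2)" using bilinear_comp[OF mb hl linear_id] by simp
  show "?\<phi> \<in> Lin M M" by (rule ssum_arg_linear[OF cM mM \<phi>b])
  fix x assume x: "x \<in> carrier M"
  have K: "module K (ground_module K)" by simp
  have "counit M (?\<phi> x) = ssum M (ground_module K) (\<lambda>x1 x2. counit M (m (h x1) x2)) x"
    by (rule ssum_linear[OF cM counit_linear[OF coalgM] mM K x]) (simp add: mc hc)
  also have "\<dots> = ssum M (ground_module K) (\<lambda>x1 x2. counit M x1 \<odot>\<^bsub>ground_module K\<^esub> counit M x2) x"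
    by (rule ssum_cong[OF cM x]) (simp add: product_counit[OF m] hc hcounit)
  also have "\<dots> = counit M x" by (rule ssum_counit_left[OF coalgM K counit_linear[OF coalgM] x])
  finally show "counit M (?\<phi> x) = counit M x" .
  {
    fix t assume t: "t \<in> carrier T"
    note evl = bilinear_linear_left[OF ev_bilinear] and evr = bilinear_linear_right[OF ev_bilinear]
    have Sl: "S \<in> Lin T T" using S by (simp add: is_antipode_def)
    note Sc = linear_closed[OF Sl]
    have "ev (?\<phi> x) t = ssum M A (\<lambda>x1 x2. ev (m (h x1) x2) t) x"
      by (rule ssum_linear[OF cM evl[OF t] mM mA x]) (simp add: mc hc)
    also have "\<dots> = ssum M A (\<lambda>x1 x2. ssum T A (\<lambda>t1 t2. ev x1 (S t1) \<otimes>\<^bsub>A\<^esub> ev x2 t2) t) x"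
      by (rule ssum_cong[OF cM x]) (simp add: product_ev[OF m] hc hev t cong: ssum_cong[OF cT])
    also have "\<dots> = ssum T A (\<lambda>t1 t2. ssum M A (\<lambda>x1 x2. ev x1 (S t1) \<otimes>\<^bsub>A\<^esub> ev x2 t2) x) t"
      by (rule ssum_swap[OF cM cT mA x t]) (simp add: Sc)
    also have "\<dots> = ssum T A (\<lambda>t1 t2. ev x (S t1 \<otimes>\<^bsub>T\<^esub> t2)) t"
      by (rule ssum_cong[OF cT t]) (simp add: ev_mult x Sc)
    also have "\<dots> = ev x (ssum T T (\<lambda>t1 t2. S t1 \<otimes>\<^bsub>T\<^esub> t2) t)"
      by (rule ssum_linear[OF cT evr[OF x] mT mA t, symmetric]) (simp add: Sc multT_closed)
    also have "\<dots> = counit T t \<odot>\<^bsub>A\<^esub> (counit M x \<odot>\<^bsub>A\<^esub> \<one>\<^bsub>A\<^esub>)"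
      using S t linear_smult[OF evr[OF x] _ oneT] by (simp add: is_antipode_def counit_closed[OF coalgT] ev_one x)
    finally show "ev (?\<phi> x) t = counit T t \<odot>\<^bsub>A\<^esub> (counit M x \<odot>\<^bsub>A\<^esub> \<one>\<^bsub>A\<^esub>)" .
  }
  fix X :: "('k, ('u \<times> 'u \<Rightarrow> 'k) set) module" and \<beta>
  assume X: "module K X" and \<beta>: "bilinear M M X \<beta>"
    and l: "\<And>u v. u \<in> carrier M \<Longrightarrow> v \<in> carrier M \<Longrightarrow> \<beta> (?\<phi> u) v = counit M u \<odot>\<^bsub>X\<^esub> \<beta> e v"
    and r: "\<And>u v. u \<in> carrier M \<Longrightarrow> v \<in> carrier M \<Longrightarrow> \<beta> v (?\<phi> u) = counit M u \<odot>\<^bsub>X\<^esub> \<beta> v e"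
  note bl = bilinear_linear_left[OF \<beta>] and br = bilinear_linear_right[OF \<beta>]
  let ?\<gamma> = "\<lambda>a b c d. \<beta> (m (h b) c) (m (h a) d)"
  have \<gamma>bc: "bilinear M M X (\<lambda>b c. ?\<gamma> a b c d)" if "a \<in> carrier M" "d \<in> carrier M" for a d
    by (rule bilinear_linear[OF \<phi>b bl[OF mc[OF hc[OF that(1)] that(2)]]])
  have \<gamma>cd: "bilinear M M X (\<lambda>c d. ?\<gamma> a b c d)" if "a \<in> carrier M" "b \<in> carrier M" for a b
    by (rule bilinear_comp[OF \<beta> bilinear_linear_right[OF mb hc[OF that(2)]]
          bilinear_linear_right[OF mb hc[OF that(1)]]])
  have \<gamma>ab: "bilinear M M X (\<lambda>a b. ?\<gamma> a b c d)" if "c \<in> carrier M" "d \<in> carrier M" for c d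
    by (rule bilinear_flip[OF bilinear_comp[OF \<beta> bilinear_linear_left[OF \<phi>b that(1)]
          bilinear_linear_left[OF \<phi>b that(2)]]])
  have tri: "trilinear M M M X (\<lambda>b c d. ?\<gamma> a b c d)" if "a \<in> carrier M" for a
    by (rule trilinearI[OF \<gamma>bc[OF that] \<gamma>cd[OF that]])
  have tri': "trilinear M M M X (\<lambda>a b w. ssum M X (\<lambda>c d. ?\<gamma> a b c d) w)"
    by (rule trilinearI[OF ssum_param_bilinear[OF cM X _ \<gamma>ab] ssum_right_bilinear[OF cM X tri]])
  have "ssum M X \<beta> (?\<phi> x) = ssum M X (\<lambda>x1 x2. ssum M X \<beta> (m (h x1) x2)) x"
    by (rule ssum_linear[OF cM ssum_arg_linear[OF cM X \<beta>] mM X x]) (simp add: mc hc)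
  also have "\<dots> = ssum M X (\<lambda>x1 x2. ssum M X (\<lambda>p1 p2. ssum M X (\<lambda>c d. \<beta> (m p1 c) (m p2 d)) x2) (h x1)) x"
    by (rule ssum_cong[OF cM x product_ssum[OF m X \<beta> hc]])
  also have "\<dots> = ssum M X (\<lambda>x1 x2. ssum M X (\<lambda>a b. ssum M X (\<lambda>c d. ?\<gamma> a b c d) x2) x1) x"
    by (intro ssum_cong[OF cM x] antipode_map_ssum[OF X] ssum_param_bilinear[OF cM X] bilinear_comp[OF \<beta>]
        bilinear_linear_left[OF mb])
  also have "\<dots> = ssum M X (\<lambda>a w. ssum M X (\<lambda>b v. ssum M X (\<lambda>c d. ?\<gamma> a b c d) v) w) x"
    by (rule ssum_coassoc[OF coalgM X x tri'])
  also have "\<dots> = ssum M X (\<lambda>a w. ssum M X (\<lambda>u d. ssum M X (\<lambda>b c. ?\<gamma> a b c d) u) w) x"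
    by (rule ssum_cong[OF cM x ssum_coassoc[OF coalgM X _ tri, symmetric]])
  also have "\<dots> = ssum M X (\<lambda>a w. ssum M X (\<lambda>u d. counit M u \<odot>\<^bsub>X\<^esub> \<beta> e (m (h a) d)) w) x"
  proof (intro ssum_cong[OF cM x] ssum_cong[OF cM])
    fix a u d assume *: "a \<in> carrier M" "u \<in> carrier M" "d \<in> carrier M"
    have ad: "m (h a) d \<in> carrier M" using * by (simp add: mc hc)
    have "ssum M X (\<lambda>b c. ?\<gamma> a b c d) u = \<beta> (?\<phi> u) (m (h a) d)"
      by (rule ssum_linear[OF cM bl[OF ad] mM X *(2), symmetric]) (simp add: mc hc)
    also have "\<dots> = counit M u \<odot>\<^bsub>X\<^esub> \<beta> e (m (h a) d)" by (rule l[OF *(2) ad])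
    finally show "ssum M X (\<lambda>b c. ?\<gamma> a b c d) u = \<dots>" .
  qed
  also have "\<dots> = ssum M X (\<lambda>a w. \<beta> e (m (h a) w)) x"
    by (intro ssum_cong[OF cM x] ssum_counit_left[OF coalgM X] linear_comp[OF _ br[OF ec]]
        bilinear_linear_right[OF mb hc])
  also have "\<dots> = \<beta> e (?\<phi> x)"
    by (rule ssum_linear[OF cM br[OF ec] mM X x, symmetric]) (simp add: mc hc)
  also have "\<dots> = counit M x \<odot>\<^bsub>X\<^esub> \<beta> e e" by (rule r[OF x ec])
  finally show "ssum M X \<beta> (?\<phi> x) = counit M x \<odot>\<^bsub>X\<^esub> \<beta> e e" .
qed

text \<open>
  Here the comultiplication is \<open>a h(d) \<otimes> b h(c)\<close>, and the inner components \<open>b\<close> and \<open>c\<close> occur in the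
  second factor.
\<close>

lemma right_antipode:
  assumes x: "x \<in> carrier M"
  shows "ssum M M (\<lambda>x1 x2. m x1 (h x2)) x = counit M x \<odot>\<^bsub>M\<^esub> e"
proof (rule scaled_unit_eqI[OF e _ _ _ _ x])
  let ?\<phi> = "ssum M M (\<lambda>x1 x2. m x1 (h x2))"
  note ec = unit_closed[OF e] and mc = product_closed[OF m] and hc = linear_closed[OF hl]
  note mb = product_bilinear[OF m]
  have \<phi>b: "bilinear M M M (\<lambda>x1 x2. m x1 (h x2))" using bilinear_comp[OF mb linear_id hl] by simp
  show "?\<phi> \<in> Lin M M" by (rule ssum_arg_linear[OF cM mM \<phi>b])
  fix x assume x: "x \<in> carrier M"
  have K: "module K (ground_module K)" by simp
  have "counit M (?\<phi> x) = ssum M (ground_module K) (\<lambda>x1 x2. counit M (m x1 (h x2))) x"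
    by (rule ssum_linear[OF cM counit_linear[OF coalgM] mM K x]) (simp add: mc hc)
  also have "\<dots> = ssum M (ground_module K) (\<lambda>x1 x2. counit M x1 \<odot>\<^bsub>ground_module K\<^esub> counit M x2) x"
    by (rule ssum_cong[OF cM x]) (simp add: product_counit[OF m] hc hcounit)
  also have "\<dots> = counit M x" by (rule ssum_counit_left[OF coalgM K counit_linear[OF coalgM] x])
  finally show "counit M (?\<phi> x) = counit M x" .
  {
    fix t assume t: "t \<in> carrier T"
    note evl = bilinear_linear_left[OF ev_bilinear] and evr = bilinear_linear_right[OF ev_bilinear]
    have Sl: "S \<in> Lin T T" using S by (simp add: is_antipode_def)
    note Sc = linear_closed[OF Sl]
    have "ev (?\<phi> x) t = ssum M A (\<lambda>x1 x2. ev (m x1 (h x2)) t) x"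
      by (rule ssum_linear[OF cM evl[OF t] mM mA x]) (simp add: mc hc)
    also have "\<dots> = ssum M A (\<lambda>x1 x2. ssum T A (\<lambda>t1 t2. ev x1 t1 \<otimes>\<^bsub>A\<^esub> ev x2 (S t2)) t) x"
      by (rule ssum_cong[OF cM x]) (simp add: product_ev[OF m] hc hev t cong: ssum_cong[OF cT])
    also have "\<dots> = ssum T A (\<lambda>t1 t2. ssum M A (\<lambda>x1 x2. ev x1 t1 \<otimes>\<^bsub>A\<^esub> ev x2 (S t2)) x) t"
      by (rule ssum_swap[OF cM cT mA x t]) (simp add: Sc)
    also have "\<dots> = ssum T A (\<lambda>t1 t2. ev x (t1 \<otimes>\<^bsub>T\<^esub> S t2)) t"
      by (rule ssum_cong[OF cT t]) (simp add: ev_mult x Sc)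
    also have "\<dots> = ev x (ssum T T (\<lambda>t1 t2. t1 \<otimes>\<^bsub>T\<^esub> S t2) t)"
      by (rule ssum_linear[OF cT evr[OF x] mT mA t, symmetric]) (simp add: Sc multT_closed)
    also have "\<dots> = counit T t \<odot>\<^bsub>A\<^esub> (counit M x \<odot>\<^bsub>A\<^esub> \<one>\<^bsub>A\<^esub>)"
      using S t linear_smult[OF evr[OF x] _ oneT] by (simp add: is_antipode_def counit_closed[OF coalgT] ev_one x)
    finally show "ev (?\<phi> x) t = counit T t \<odot>\<^bsub>A\<^esub> (counit M x \<odot>\<^bsub>A\<^esub> \<one>\<^bsub>A\<^esub>)" .
  }
  fix X :: "('k, ('u \<times> 'u \<Rightarrow> 'k) set) module" and \<beta>
  assume X: "module K X" and \<beta>: "bilinear M M X \<beta>"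
    and l: "\<And>u v. u \<in> carrier M \<Longrightarrow> v \<in> carrier M \<Longrightarrow> \<beta> (?\<phi> u) v = counit M u \<odot>\<^bsub>X\<^esub> \<beta> e v"
    and r: "\<And>u v. u \<in> carrier M \<Longrightarrow> v \<in> carrier M \<Longrightarrow> \<beta> v (?\<phi> u) = counit M u \<odot>\<^bsub>X\<^esub> \<beta> v e"
  note bl = bilinear_linear_left[OF \<beta>] and br = bilinear_linear_right[OF \<beta>]
  let ?\<gamma> = "\<lambda>a b c d. \<beta> (m a (h d)) (m b (h c))"
  have \<gamma>bc: "bilinear M M X (\<lambda>b c. ?\<gamma> a b c d)" if "a \<in> carrier M" "d \<in> carrier M" for a d
    by (rule bilinear_linear[OF \<phi>b br[OF mc[OF that(1) hc[OF that(2)]]]])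
  have \<gamma>ab: "bilinear M M X (\<lambda>a b. ?\<gamma> a b c d)" if "c \<in> carrier M" "d \<in> carrier M" for c d
    by (rule bilinear_comp[OF \<beta> bilinear_linear_left[OF mb hc[OF that(2)]]
          bilinear_linear_left[OF mb hc[OF that(1)]]])
  have \<gamma>cd: "bilinear M M X (\<lambda>c d. ?\<gamma> a b c d)" if "a \<in> carrier M" "b \<in> carrier M" for a b
    by (rule bilinear_flip[OF bilinear_comp[OF \<beta> bilinear_linear_right[OF \<phi>b that(1)]
          bilinear_linear_right[OF \<phi>b that(2)]]])
  have tri: "trilinear M M M X (\<lambda>a b c. ?\<gamma> a b c d)" if "d \<in> carrier M" for d
    by (rule trilinearI[OF \<gamma>ab[OF _ that] \<gamma>bc[OF _ that]])
  have tri': "trilinear M M M X (\<lambda>w c d. ssum M X (\<lambda>a b. ?\<gamma> a b c d) w)"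
    by (rule trilinearI[OF ssum_left_bilinear[OF cM X tri] ssum_param_bilinear[OF cM X _ \<gamma>cd]])
  have "ssum M X \<beta> (?\<phi> x) = ssum M X (\<lambda>x1 x2. ssum M X \<beta> (m x1 (h x2))) x"
    by (rule ssum_linear[OF cM ssum_arg_linear[OF cM X \<beta>] mM X x]) (simp add: mc hc)
  also have "\<dots> = ssum M X (\<lambda>x1 x2. ssum M X (\<lambda>a b. ssum M X (\<lambda>p1 p2. \<beta> (m a p1) (m b p2)) (h x2)) x1) x"
    by (rule ssum_cong[OF cM x product_ssum[OF m X \<beta> _ hc]])
  also have "\<dots> = ssum M X (\<lambda>x1 x2. ssum M X (\<lambda>a b. ssum M X (\<lambda>c d. ?\<gamma> a b c d) x2) x1) x"
    by (intro ssum_cong[OF cM x] ssum_cong[OF cM] antipode_map_ssum[OF X] bilinear_comp[OF \<beta>]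
        bilinear_linear_right[OF mb])
  also have "\<dots> = ssum M X (\<lambda>x1 x2. ssum M X (\<lambda>c d. ssum M X (\<lambda>a b. ?\<gamma> a b c d) x1) x2) x"
    by (intro ssum_cong[OF cM x] ssum_swap[OF cM cM X]) (simp_all add: bilinear_closed[OF \<beta>] mc hc)
  also have "\<dots> = ssum M X (\<lambda>u d. ssum M X (\<lambda>w c. ssum M X (\<lambda>a b. ?\<gamma> a b c d) w) u) x"
    by (rule ssum_coassoc[OF coalgM X x tri', symmetric])
  also have "\<dots> = ssum M X (\<lambda>u d. ssum M X (\<lambda>a v. ssum M X (\<lambda>b c. ?\<gamma> a b c d) v) u) x"
    by (rule ssum_cong[OF cM x ssum_coassoc[OF coalgM X _ tri]])
  also have "\<dots> = ssum M X (\<lambda>u d. ssum M X (\<lambda>a v. counit M v \<odot>\<^bsub>X\<^esub> \<beta> (m a (h d)) e) u) x"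
  proof (intro ssum_cong[OF cM x] ssum_cong[OF cM])
    fix a v d assume *: "a \<in> carrier M" "v \<in> carrier M" "d \<in> carrier M"
    have ad: "m a (h d) \<in> carrier M" using * by (simp add: mc hc)
    have "ssum M X (\<lambda>b c. ?\<gamma> a b c d) v = \<beta> (m a (h d)) (?\<phi> v)"
      by (rule ssum_linear[OF cM br[OF ad] mM X *(2), symmetric]) (simp add: mc hc)
    also have "\<dots> = counit M v \<odot>\<^bsub>X\<^esub> \<beta> (m a (h d)) e" by (rule r[OF *(2) ad])
    finally show "ssum M X (\<lambda>b c. ?\<gamma> a b c d) v = \<dots>" .
  qed
  also have "\<dots> = ssum M X (\<lambda>u d. \<beta> (m u (h d)) e) x"
    by (intro ssum_cong[OF cM x] ssum_counit_right[OF coalgM X] linear_comp[OF _ bl[OF ec]]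
        bilinear_linear_left[OF mb hc])
  also have "\<dots> = \<beta> (?\<phi> x) e"
    by (rule ssum_linear[OF cM bl[OF ec] mM X x, symmetric]) (simp add: mc hc)
  also have "\<dots> = counit M x \<odot>\<^bsub>X\<^esub> \<beta> e e" by (rule l[OF x ec])
  finally show "ssum M X \<beta> (?\<phi> x) = counit M x \<odot>\<^bsub>X\<^esub> \<beta> e e" .
qed

end

lemma hopf_structure:
  assumes m: "is_product m" and e: "is_unit e" and H: "hopf_algebra K T"
  shows "hopf_algebra K (M\<lparr>mult := m, one := e\<rparr>)"
proof -
  obtain S where S: "is_antipode T S" using H by (auto simp: hopf_algebra_iff)
  obtain h where h: "h \<in> Lin M M"
    "\<And>x. x \<in> carrier M \<Longrightarrow> comult M (h x) = ssum M (tensor K M M) (\<lambda>x1 x2. tens K M M (h x2) (h x1)) x"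
    "\<And>x. x \<in> carrier M \<Longrightarrow> counit M (h x) = counit M x"
    "\<And>x t. x \<in> carrier M \<Longrightarrow> t \<in> carrier T \<Longrightarrow> ev (h x) t = ev x (S t)"
    using ex_antipode_map[OF S] by blast
  have "is_antipode (M\<lparr>mult := m, one := e\<rparr>) h"
    using h(1) left_antipode[OF m e S h] right_antipode[OF m e S h] by (simp add: is_antipode_def)
  thus ?thesis
    using structure_of_product(1)[OF m e] by (auto simp: hopf_algebra_iff)
qed

end

section \<open>The universal measuring coalgebra as a bialgebra\<close>

theorem proposition2p3:
  fixes K :: "'k ring"
    and T :: "('k, 't) coalgebra"
    and A :: "('k, 'a) module"
    and M :: "('k, 'm) coalgebra"
    and \<theta> :: "('m \<times> 't \<Rightarrow> 'k) set \<Rightarrow> 'a"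
  assumes "field K"
    and "bialgebra K T"
    and "algebra K A"
    and "universal_measuring TYPE(('k + 'm + 'n) list) K T A M \<theta>"
  shows "(\<exists>!s. measured_bialgebra_structure K T A M \<theta> s) \<and>
    (\<forall>m e. measured_bialgebra_structure K T A M \<theta> (m, e) \<longrightarrow>
       bialgebra K (M\<lparr>mult := m, one := e\<rparr>) \<and>
       universal_bimeasuring TYPE('n) K T A (M\<lparr>mult := m, one := e\<rparr>) \<theta> \<and>
       (hopf_algebra K T \<longrightarrow> hopf_algebra K (M\<lparr>mult := m, one := e\<rparr>)))"
proof -
  interpret field K by (rule assms(1))
  interpret ground_ring K by unfold_locales
  have "coalgebra K M" using assms(4) by (simp add: universal_measuring_def)
  then obtain i :: "('m \<times> 'm \<Rightarrow> 'k) set \<Rightarrow> ('k + 'm + 'n) list" where i: "inj_on i (carrier (tensor K M M))"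
    using ex_inj_tensor[OF comult_module_module[OF coalgebra_comult_module]] by blast
  interpret bialgebra_measuring K T A M \<theta> "\<lambda>x. [Inr (Inl x)] :: ('k + 'm + 'n) list" "\<lambda>a. [Inl a]" i
    by (intro bialgebra_measuring.intro bialgebra_measuring_axioms.intro universal_coalgebra.intro
        universal_coalgebra_axioms.intro ground_ring_axioms assms(2-4) i bialgebra_mult_algebra
        bialgebra_one_closed algebra_mult_algebra)
       (simp_all add: inj_on_def)
  have iN: "inj (\<lambda>n. [Inr (Inr n)] :: ('k + 'm + 'n) list)" by (simp add: inj_on_def)
  show ?thesis
  proof (intro conjI allI impI)
    show "\<exists>!s. measured_bialgebra_structure K T A M \<theta> s" by (rule ex1_structure)
    fix m e assume "measured_bialgebra_structure K T A M \<theta> (m, e)"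
    hence B: "bialgebra K (M\<lparr>mult := m, one := e\<rparr>)" and r: "measures_right K (M\<lparr>mult := m, one := e\<rparr>) T A \<theta>"
      by (simp_all add: measured_bialgebra_structure_def)
    show "bialgebra K (M\<lparr>mult := m, one := e\<rparr>)" by (rule B)
    note me = product_of_structure[OF B r]
    show "universal_bimeasuring TYPE('n) K T A (M\<lparr>mult := m, one := e\<rparr>) \<theta>"
      by (rule universal_bimeasuring_structure[OF me iN])
    show "hopf_algebra K (M\<lparr>mult := m, one := e\<rparr>)" if "hopf_algebra K T"
      by (rule hopf_structure[OF me that])
  qed
qed

end
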